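(* Let $\mathcal{M}$ be an o-minimal expansion of an ordered group. Let $X\subseteq M^{n}$ be a definable bounded set with $\dim X=1$, and let $\tau$ be a definable Hausdorff topology on $X$. Then the following are equivalent: (1) $(X,\tau)$ is definably homeomorphic to a definable set with its affine topology. (2) Every definable subset of $X$ has a finite number of definably connected components, with respect to $\tau$. (3) For all but finitely many $x\in X$, $\mathcal{B}_{x}\preceq\mathcal{B}_{x}^{af}$. (4) There is a finite set $G\subseteq X$ such that every $\tau$-open subset of $X\setminus G$ is $\tau^{af}$-open in $X$.
   Context: "Definable" means definable in $\mathcal{M}$ with parameters. A topology $\tau$ on a definable set $X\subseteq M^n$ is a definable topology if it has a basis $\mathcal B$ of the form $\{\varphi(M^n,\bar b):\bar b\in M^m\}$ for some formula $\varphi(\bar x,\bar y)$ (possibly with parameters), all of whose members are subsets of $X$; fix such a $\mathcal B$ and put $\mathcal{B}_{x}=\{U\in\mathcal B: x\in U\}$ for $x\in X$. The affine topology $\tau^{af}$ on $M^k$ is the product topology of the order topology on $M$; the affine topology of a subset of $M^k$ is the induced subspace topology, and "$\tau^{af}$-open in $X$" means open in the affine topology of $X$. $\mathcal{B}_{x}^{af}$ is the basis of neighborhoods of $x$ in the affine topology of $X$ consisting of the sets $B\cap X$ with $B\subseteq M^n$ an open box containing $x$. For families $T,S$ of subsets of $X$, $T\preceq S$ means that for each $U\in T$ there is $V\in S$ with $V\subseteq U$. A definable homeomorphism is a homeomorphism whose graph is definable. A definable set $Y\subseteq X$ is definably connected (with respect to $\tau$) if there are no definable non-empty sets $U,W$,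 open in the subspace topology $\tau|_Y$, with $U\cap W=\emptyset$ and $U\cup W=Y$. A definably connected component of a definable set $Y\subseteq X$ is a definable subset of $Y$ which is maximal among the definable definably connected subsets of $Y$ (with respect to $\tau|_Y$). $Y$ has a finite number of definably connected components if $Y$ is the disjoint union of finitely many definably connected components. *)

theory Defs
  imports "HOL-Analysis.Analysis"
begin

text \<open>Linearly ordered groups, written additively; commutativity is not assumed.\<close>

class linordered_group_add = group_add + linorder +
  assumes group_add_left_mono: "a \<le> b \<Longrightarrow> c + a \<le> c + b"
    and group_add_right_mono: "a \<le> b \<Longrightarrow> a + c \<le> b + c"


section \<open>First-order structures expanding an ordered group\<close>

text \<open>The logical language consists of \<open>=\<close>, \<open><\<close>, \<open>+\<close> and arbitrary further function symbols
  \<open>'f\<close> and relation symbols \<open>'r\<close>, so that a structure on the type \<open>'a\<close> only has to interpret the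
  latter. Symbols take argument lists: a symbol used with different numbers of arguments
  amounts to several symbols. A signature with fixed arities is
  covered by interpreting its symbols trivially on lists of any other length.\<close>

datatype 'f fo_term = Var nat | Plus "'f fo_term" "'f fo_term" | Fn 'f "'f fo_term list"

datatype ('f, 'r) fo_formula =
    Equal "'f fo_term" "'f fo_term"
  | Less "'f fo_term" "'f fo_term"
  | Rel 'r "'f fo_term list"
  | Neg "('f, 'r) fo_formula"
  | Conj "('f, 'r) fo_formula" "('f, 'r) fo_formula"
  | Ex nat "('f, 'r) fo_formula"

record ('a, 'f, 'r) fo_struct =
  fn_interp :: "'f \<Rightarrow> 'a list \<Rightarrow> 'a"
  rel_interp :: "'r \<Rightarrow> 'a list \<Rightarrow> bool"

primrec term_val ::
  "('a::linordered_group_add, 'f, 'r) fo_struct \<Rightarrow> (nat \<Rightarrow> 'a) \<Rightarrow> 'f fo_term \<Rightarrow> 'a" where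
  "term_val M s (Var i) = s i"
| "term_val M s (Plus t u) = term_val M s t + term_val M s u"
| "term_val M s (Fn f ts) = fn_interp M f (map (term_val M s) ts)"

primrec sat ::
  "('a::linordered_group_add, 'f, 'r) fo_struct \<Rightarrow> (nat \<Rightarrow> 'a) \<Rightarrow> ('f, 'r) fo_formula \<Rightarrow> bool" where
  "sat M s (Equal t u) \<longleftrightarrow> term_val M s t = term_val M s u"
| "sat M s (Less t u) \<longleftrightarrow> term_val M s t < term_val M s u"
| "sat M s (Rel r ts) \<longleftrightarrow> rel_interp M r (map (term_val M s) ts)"
| "sat M s (Neg \<phi>) \<longleftrightarrow> \<not> sat M s \<phi>"
| "sat M s (Conj \<phi> \<psi>) \<longleftrightarrow> sat M s \<phi> \<and> sat M s \<psi>"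
| "sat M s (Ex i \<phi>) \<longleftrightarrow> (\<exists>a. sat M (s(i := a)) \<phi>)"


section \<open>Definable sets\<close>

text \<open>The Cartesian power \<open>M\<^sup>n\<close> is the set of functions on \<open>{..<n}\<close>, extended by \<open>undefined\<close>, i.e.
  the carrier of the library's product topology over \<open>{..<n}\<close>.\<close>

definition cpow :: "nat \<Rightarrow> (nat \<Rightarrow> 'a) set" where
  "cpow n = PiE {..<n} (\<lambda>_. UNIV)"

text \<open>Concatenation of an \<open>n\<close>-tuple with a tuple or an infinite sequence. It maps
  \<open>cpow n \<times> cpow m\<close> bijectively onto \<open>cpow (n + m)\<close>.\<close>

definition concat_tuple :: "nat \<Rightarrow> (nat \<Rightarrow> 'a) \<Rightarrow> (nat \<Rightarrow> 'a) \<Rightarrow> nat \<Rightarrow> 'a" where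
  "concat_tuple n x y = (\<lambda>i. if i < n then x i else y (i - n))"

text \<open>Parameters are supplied by a sequence \<open>c\<close> assigned to the variables following those of the
  tuples; a formula mentions only finitely many of them.\<close>

definition definable ::
  "('a::linordered_group_add, 'f, 'r) fo_struct \<Rightarrow> nat \<Rightarrow> (nat \<Rightarrow> 'a) set \<Rightarrow> bool" where
  "definable M n X \<longleftrightarrow>
     (\<exists>\<phi> c. X = {x \<in> cpow n. sat M (concat_tuple n x c) \<phi>})"

definition definable_family ::
  "('a::linordered_group_add, 'f, 'r) fo_struct \<Rightarrow> nat \<Rightarrow> (nat \<Rightarrow> 'a) set set \<Rightarrow> bool" where
  "definable_family M n \<B> \<longleftrightarrow>
     (\<exists>m \<phi> c. \<B> = (\<lambda>b. {x \<in> cpow n. sat M (concat_tuple n x (concat_tuple m b c)) \<phi>}) ` cpow m)"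


section \<open>O-minimality, boxes and dimension\<close>

definition open_intervals :: "'a::linorder set set" where
  "open_intervals = {I. I = UNIV \<or> (\<exists>a. I = {a<..}) \<or> (\<exists>b. I = {..<b}) \<or> (\<exists>a b. I = {a<..<b})}"

definition o_minimal :: "('a::linordered_group_add, 'f, 'r) fo_struct \<Rightarrow> bool" where
  "o_minimal M \<longleftrightarrow>
     (\<forall>X. definable M 1 X \<longrightarrow>
        (\<exists>P \<I>. finite P \<and> finite \<I> \<and> \<I> \<subseteq> open_intervals \<and> (\<lambda>x. x 0) ` X = P \<union> \<Union>\<I>))"

definition open_boxes :: "nat \<Rightarrow> (nat \<Rightarrow> 'a::linorder) set set" where
  "open_boxes n = {PiE {..<n} I |I. \<forall>i<n. I i \<in> open_intervals}"

definition bounded_in_power :: "nat \<Rightarrow> (nat \<Rightarrow> 'a::linorder) set \<Rightarrow> bool" where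
  "bounded_in_power n X \<longleftrightarrow> (\<exists>a b. \<forall>x\<in>X. \<forall>i<n. a \<le> x i \<and> x i \<le> b)"

text \<open>For \<open>'a::linorder_topology\<close>, \<open>euclidean\<close> is the order topology of \<open>'a\<close>.\<close>

definition affine_topology :: "nat \<Rightarrow> (nat \<Rightarrow> 'a::linorder_topology) set \<Rightarrow> (nat \<Rightarrow> 'a) topology" where
  "affine_topology n X = subtopology (product_topology (\<lambda>_. euclidean) {..<n}) X"

text \<open>The dimension of a definable \<open>X \<subseteq> M\<^sup>n\<close> is the largest \<open>d\<close> such that the projection of \<open>X\<close>
  to some \<open>d\<close> coordinates has non-empty interior. The projection to the coordinates in \<open>J\<close> is
  restriction to \<open>J\<close>. The empty set, usually given dimension \<open>-\<infinity>\<close>, gets dimension 0.\<close>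

definition o_dim :: "nat \<Rightarrow> (nat \<Rightarrow> 'a::linorder_topology) set \<Rightarrow> nat" where
  "o_dim n X = Max (insert 0 {card J |J. J \<subseteq> {..<n} \<and>
     product_topology (\<lambda>_. euclidean) J interior_of ((\<lambda>x. restrict x J) ` X) \<noteq> {}})"


section \<open>Definable topologies\<close>

definition definable_basis ::
  "('a::linordered_group_add, 'f, 'r) fo_struct \<Rightarrow> nat \<Rightarrow> (nat \<Rightarrow> 'a) topology
     \<Rightarrow> (nat \<Rightarrow> 'a) set set \<Rightarrow> bool" where
  "definable_basis M n \<tau> \<B> \<longleftrightarrow>
     definable_family M n \<B> \<and> (\<forall>U\<in>\<B>. openin \<tau> U) \<and>
     (\<forall>W x. openin \<tau> W \<and> x \<in> W \<longrightarrow> (\<exists>U\<in>\<B>. x \<in> U \<and> U \<subseteq> W))"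

definition basis_at :: "'b set set \<Rightarrow> 'b \<Rightarrow> 'b set set" where
  "basis_at \<B> x = {U \<in> \<B>. x \<in> U}"

definition affine_basis_at ::
  "nat \<Rightarrow> (nat \<Rightarrow> 'a::linorder) set \<Rightarrow> (nat \<Rightarrow> 'a) \<Rightarrow> (nat \<Rightarrow> 'a) set set" where
  "affine_basis_at n X x = {B \<inter> X |B. B \<in> open_boxes n \<and> x \<in> B}"

definition refined_by :: "'b set set \<Rightarrow> 'b set set \<Rightarrow> bool"  (infix "\<preceq>" 50) where
  "T \<preceq> S \<longleftrightarrow> (\<forall>U\<in>T. \<exists>V\<in>S. V \<subseteq> U)"

definition definably_homeomorphic ::
  "('a::linordered_group_add, 'f, 'r) fo_struct \<Rightarrow> nat \<Rightarrow> (nat \<Rightarrow> 'a) topology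
     \<Rightarrow> nat \<Rightarrow> (nat \<Rightarrow> 'a) topology \<Rightarrow> bool" where
  "definably_homeomorphic M n \<tau> k \<sigma> \<longleftrightarrow>
     (\<exists>f. homeomorphic_map \<tau> \<sigma> f \<and>
          definable M (n + k) ((\<lambda>x. concat_tuple n x (f x)) ` topspace \<tau>))"

definition definably_connected ::
  "('a::linordered_group_add, 'f, 'r) fo_struct \<Rightarrow> nat \<Rightarrow> (nat \<Rightarrow> 'a) topology
     \<Rightarrow> (nat \<Rightarrow> 'a) set \<Rightarrow> bool" where
  "definably_connected M n \<tau> Y \<longleftrightarrow>
     \<not> (\<exists>U W. definable M n U \<and> definable M n W \<and> U \<noteq> {} \<and> W \<noteq> {} \<and>
            openin (subtopology \<tau> Y) U \<and> openin (subtopology \<tau> Y) W \<and>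
            U \<inter> W = {} \<and> U \<union> W = Y)"

definition definably_connected_component ::
  "('a::linordered_group_add, 'f, 'r) fo_struct \<Rightarrow> nat \<Rightarrow> (nat \<Rightarrow> 'a) topology
     \<Rightarrow> (nat \<Rightarrow> 'a) set \<Rightarrow> (nat \<Rightarrow> 'a) set \<Rightarrow> bool" where
  "definably_connected_component M n \<tau> Y C \<longleftrightarrow>
     C \<subseteq> Y \<and> definable M n C \<and> definably_connected M n (subtopology \<tau> Y) C \<and>
     (\<forall>D. C \<subseteq> D \<and> D \<subseteq> Y \<and> definable M n D \<and> definably_connected M n (subtopology \<tau> Y) D
          \<longrightarrow> D = C)"

definition finitely_many_components ::
  "('a::linordered_group_add, 'f, 'r) fo_struct \<Rightarrow> nat \<Rightarrow> (nat \<Rightarrow> 'a) topology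
     \<Rightarrow> (nat \<Rightarrow> 'a) set \<Rightarrow> bool" where
  "finitely_many_components M n \<tau> Y \<longleftrightarrow>
     (\<exists>\<C>. finite \<C> \<and> (\<forall>C\<in>\<C>. definably_connected_component M n \<tau> Y C) \<and>
          pairwise disjnt \<C> \<and> \<Union>\<C> = Y)"

end

(* The theorem reduces to the line. By uniform finiteness of finite fibres a one-dimensional
   bounded X is the image of a bounded definable L in M under a definable bijection h, so tau becomes
   a definable Hausdorff topology on L. Call a point of L good if its tau-neighbourhoods contain
   intervals around it; all four conditions are equivalent to cofinitely many points being good.
   The main tool is a compactness principle for one-sided germs of points of M: if all neighbourhoods
   of y meet a definable set A, then A contains a germ converging to y. By the Hausdorff property a
   germ converges to at most one point. If infinitely many points are bad, there is an interval on
   which no germ converges to a foreign point of the interval; there tau refines the order topology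
   and one-sided neighbourhoods make it totally disconnected. If cofinitely many points are good,
   (L, tau) is a finite graph whose edges are intervals, and tent functions together with truncated
   distances to the vertices embed it. *)
theory Submission
  imports Defs
begin

section \<open>Definable predicates on assignments\<close>


text \<open>In place of cell decomposition and the monotonicity theorem the proof uses an elementary
  uniformity principle, \<open>uniform_parameter\<close>: if each point of an interval satisfies a
  condition for some value of a parameter, and the condition persists when the parameter decreases,
  then one value serves a whole subinterval. It yields continuity off a finite set, uniform
  finiteness, and a uniform distance between germs and their foreign limits. Boundedness of X enters
  through the compactness principle: the suprema in question exist in M, so that germs at points
  suffice and none at infinity occur. The bijection h is merely definable. The affine topology of X
  is therefore carried to L as well and treated as a second Hausdorff topology with a definable
  basis, the boxes. Cofinitely many points are good for it too, so off a finite set affine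
  neighbourhoods in X and intervals in L can be exchanged, which is what (3) needs. In the embedding
  the obstacle is that a germ at one point may converge to another and that several germs may
  converge to the same vertex; hence the distance to a vertex is measured along all germs converging
  to it.\<close>

primrec rename_term :: "(nat \<Rightarrow> nat) \<Rightarrow> 'f fo_term \<Rightarrow> 'f fo_term" where
  "rename_term f (Var i) = Var (f i)"
| "rename_term f (Plus t u) = Plus (rename_term f t) (rename_term f u)"
| "rename_term f (Fn g ts) = Fn g (map (rename_term f) ts)"

primrec rename :: "(nat \<Rightarrow> nat) \<Rightarrow> ('f, 'r) fo_formula \<Rightarrow> ('f, 'r) fo_formula" where
  "rename f (Equal t u) = Equal (rename_term f t) (rename_term f u)"
| "rename f (Less t u) = Less (rename_term f t) (rename_term f u)"
| "rename f (Rel r ts) = Rel r (map (rename_term f) ts)"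
| "rename f (Neg \<phi>) = Neg (rename f \<phi>)"
| "rename f (Conj \<phi> \<psi>) = Conj (rename f \<phi>) (rename f \<psi>)"
| "rename f (Ex i \<phi>) = Ex (f i) (rename f \<phi>)"

lemma term_val_rename: "term_val M s (rename_term f t) = term_val M (\<lambda>i. s (f i)) t"
proof (induction t)
  case (Fn g ts)
  then have "map (term_val M s) (map (rename_term f) ts) = map (term_val M (\<lambda>i. s (f i))) ts"
    by simp
  then show ?case by (simp del: map_map map_eq_conv)
qed auto

text \<open>Injectivity of the renaming rules out variable capture.\<close>

lemma sat_rename: "inj f \<Longrightarrow> sat M s (rename f \<phi>) \<longleftrightarrow> sat M (\<lambda>i. s (f i)) \<phi>"
proof (induction \<phi> arbitrary: s)
  case (Rel r ts)
  have "map (term_val M s) (map (rename_term f) ts) = map (term_val M (\<lambda>i. s (f i))) ts"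
    by (simp add: term_val_rename)
  then show ?case by (simp del: map_map map_eq_conv)
next
  case (Ex i \<phi>)
  have "(\<lambda>j. (s(f i := a)) (f j)) = (\<lambda>j. s (f j))(i := a)" for a
    using \<open>inj f\<close> by (auto simp: fun_eq_iff inj_eq)
  with Ex show ?case by simp
qed (auto simp: term_val_rename)

text \<open>The semantic side of definability: the variables from \<open>n\<close> on are filled
  with parameters, so only finitely many entries of \<open>s\<close> count. Predicates on
  assignments can then be shown definable by introduction rules that follow their HOL syntax,
  without writing formulas.\<close>

definition dpred :: "('a::linordered_group_add, 'f, 'r) fo_struct \<Rightarrow> ((nat \<Rightarrow> 'a) \<Rightarrow> bool) \<Rightarrow> bool" where
  "dpred M P \<longleftrightarrow> (\<exists>n \<phi> c. \<forall>s. P s \<longleftrightarrow> sat M (concat_tuple n s c) \<phi>)"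

text \<open>A definable function, given by its graph with the value as variable 0 and the arguments
  moved up by one. It need not be the value of a term of the language.\<close>

definition dterm :: "('a::linordered_group_add, 'f, 'r) fo_struct \<Rightarrow> ((nat \<Rightarrow> 'a) \<Rightarrow> 'a) \<Rightarrow> bool" where
  "dterm M t \<longleftrightarrow> dpred M (\<lambda>s. s 0 = t (\<lambda>i. s (Suc i)))"

lemma dpredI: "(\<And>s. P s \<longleftrightarrow> sat M (concat_tuple n s c) \<phi>) \<Longrightarrow> dpred M P"
  unfolding dpred_def by blast

text \<open>The parameter variables can be renamed beyond any bound \<open>n0\<close>. This makes
  room for further free variables and brings two predicates to compatible cut-offs.\<close>

lemma dpred_rep:
  assumes "dpred M P"
  shows "\<exists>n c \<phi>. n \<ge> n0 \<and> (\<forall>s. P s \<longleftrightarrow> sat M (concat_tuple n s c) \<phi>)"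
proof -
  obtain m c \<phi> where P: "\<forall>s. P s \<longleftrightarrow> sat M (concat_tuple m s c) \<phi>"
    using assms unfolding dpred_def by (elim exE) (rule that)
  define n where "n = max m n0"
  define f where "f i = (if i < m then i else n + (i - m))" for i
  have "inj f"
    by (rule injI) (auto simp: f_def n_def split: if_splits)
  have "(\<lambda>i. concat_tuple n s c (f i)) = concat_tuple m s c" for s
    by (auto simp: concat_tuple_def fun_eq_iff f_def n_def)
  then have "\<forall>s. P s \<longleftrightarrow> sat M (concat_tuple n s c) (rename f \<phi>)"
    by (simp add: sat_rename \<open>inj f\<close> P)
  moreover have "n \<ge> n0" by (simp add: n_def)
  ultimately show ?thesis by (intro exI conjI)
qed

lemma dpred_support:
  assumes "dpred M P"
  shows "\<exists>n. \<forall>s s'. (\<forall>i<n. s i = s' i) \<longrightarrow> P s = P s'"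
proof -
  obtain n c \<phi> where P: "\<forall>s. P s \<longleftrightarrow> sat M (concat_tuple n s c) \<phi>"
    using assms unfolding dpred_def by (elim exE) (rule that)
  have "P s = P s'" if "\<forall>i<n. s i = s' i" for s s'
  proof -
    have "concat_tuple n s c = concat_tuple n s' c"
      using that by (auto simp: concat_tuple_def fun_eq_iff)
    then show ?thesis by (simp add: P)
  qed
  then show ?thesis by (intro exI allI impI)
qed

lemma dpred_neg: "dpred M P \<Longrightarrow> dpred M (\<lambda>s. \<not> P s)"
  unfolding dpred_def by (metis sat.simps(4))

lemma dpred_conj:
  assumes "dpred M P" "dpred M Q"
  shows "dpred M (\<lambda>s. P s \<and> Q s)"
proof -
  obtain n1 c \<phi> where P: "\<forall>s. P s \<longleftrightarrow> sat M (concat_tuple n1 s c) \<phi>"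
    using dpred_rep[OF assms(1), of 0] by (elim exE conjE) (rule that)
  obtain n d \<psi> where "n \<ge> n1" and Q: "\<forall>s. Q s \<longleftrightarrow> sat M (concat_tuple n s d) \<psi>"
    using dpred_rep[OF assms(2), of n1] by (elim exE conjE) (rule that)
  \<comment> \<open>The two parameter sequences are interleaved behind position \<open>n\<close>,
    that of \<open>P\<close> at the even places and that of \<open>Q\<close> at the odd ones. Since
    \<open>n1 \<le> n\<close>, the free variables of \<open>P\<close> are not touched.\<close>
  define f where "f i = (if i < n1 then i else n + 2 * (i - n1))" for i
  define g where "g i = (if i < n then i else Suc (n + 2 * (i - n)))" for i
  define e where "e i = (if even i then c (i div 2) else d (i div 2))" for i
  have "inj f"
    by (rule injI) (use \<open>n \<ge> n1\<close> in \<open>auto simp: f_def split: if_splits\<close>)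
  have "inj g"
    by (rule injI) (auto simp: g_def split: if_splits)
  have "(\<lambda>i. concat_tuple n s e (f i)) = concat_tuple n1 s c" "(\<lambda>i. concat_tuple n s e (g i)) = concat_tuple n s d" for s
    using \<open>n \<ge> n1\<close> by (auto simp: concat_tuple_def fun_eq_iff f_def g_def e_def)
  then have "(P s \<and> Q s) \<longleftrightarrow> sat M (concat_tuple n s e) (Conj (rename f \<phi>) (rename g \<psi>))" for s
    by (simp add: sat_rename \<open>inj f\<close> \<open>inj g\<close> P Q)
  then show ?thesis by (rule dpredI)
qed

lemma dpred_const: "dpred M (\<lambda>s. b)"
proof (cases b)
  case True
  then have "b \<longleftrightarrow> sat M (concat_tuple 0 s (\<lambda>i. 0)) (Equal (Var 0) (Var 0))" for s by simp
  then show ?thesis by (rule dpredI)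
next
  case False
  then have "b \<longleftrightarrow> sat M (concat_tuple 0 s (\<lambda>i. 0)) (Neg (Equal (Var 0) (Var 0)))" for s by simp
  then show ?thesis by (rule dpredI)
qed

lemma dpred_disj:
  assumes "dpred M P" "dpred M Q" shows "dpred M (\<lambda>s. P s \<or> Q s)"
proof -
  have "dpred M (\<lambda>s. \<not> (\<not> P s \<and> \<not> Q s))"
    by (intro dpred_neg dpred_conj assms)
  then show ?thesis by simp
qed

lemma dpred_imp:
  assumes "dpred M P" "dpred M Q" shows "dpred M (\<lambda>s. P s \<longrightarrow> Q s)"
  unfolding imp_conv_disj by (intro dpred_neg dpred_disj assms)

section \<open>Renaming, quantifiers and substitution\<close>

lemma dpred_rename:
  assumes "dpred M P" "inj f"
  shows "dpred M (\<lambda>s. P (\<lambda>i. s (f i)))"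
proof -
  obtain n c \<phi> where P: "\<forall>s. P s \<longleftrightarrow> sat M (concat_tuple n s c) \<phi>"
    using dpred_rep[OF assms(1), of 0] by (elim exE conjE) (rule that)
  obtain N where N: "\<And>i. i < n \<Longrightarrow> f i < N"
    by (metis finite_imageI finite_lessThan finite_nat_set_iff_bounded imageI lessThan_iff)
  define g where "g i = (if i < n then f i else N + (i - n))" for i
  have "inj g"
  proof (rule injI)
    fix x y assume "g x = g y"
    then show "x = y"
      using N[of x] N[of y] by (auto simp: g_def inj_eq[OF \<open>inj f\<close>] split: if_splits)
  qed
  have "(\<lambda>i. concat_tuple N s c (g i)) = concat_tuple n (\<lambda>i. s (f i)) c" for s
    using N by (auto simp: concat_tuple_def fun_eq_iff g_def)
  then have "P (\<lambda>i. s (f i)) \<longleftrightarrow> sat M (concat_tuple N s c) (rename g \<phi>)" for s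
    by (simp add: sat_rename \<open>inj g\<close> P)
  then show ?thesis by (rule dpredI)
qed

lemma dpred_ex_upd:
  assumes "dpred M P"
  shows "dpred M (\<lambda>s. \<exists>a. P (s(k := a)))"
proof -
  obtain n c \<phi> where "n \<ge> Suc k" and P: "\<forall>s. P s \<longleftrightarrow> sat M (concat_tuple n s c) \<phi>"
    using dpred_rep[OF assms, of "Suc k"] by (elim exE conjE) (rule that)
  then have "concat_tuple n (s(k := a)) c = (concat_tuple n s c)(k := a)" for s a
    by (auto simp: concat_tuple_def fun_eq_iff)
  then have "(\<exists>a. P (s(k := a))) \<longleftrightarrow> sat M (concat_tuple n s c) (Ex k \<phi>)" for s
    by (simp add: P)
  then show ?thesis by (rule dpredI)
qed

text \<open>De Bruijn convention: the bound variable is variable 0 and the others are moved up by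
  one. Formulas quantify a named variable instead; \<open>f\<close> therefore sends 0 to
  \<open>n\<close>, where it does not clash with the variables that matter, and moves the next ones
  back down.\<close>

lemma dpred_ex:
  assumes "dpred M (\<lambda>s. P (s 0) (\<lambda>i. s (Suc i)))"
  shows "dpred M (\<lambda>s. \<exists>a. P a s)"
proof -
  let ?Q = "\<lambda>s. P (s 0) (\<lambda>i. s (Suc i))"
  obtain n where n: "\<forall>s s'. (\<forall>i<n. s i = s' i) \<longrightarrow> ?Q s = ?Q s'"
    using dpred_support[OF assms] by (elim exE) (rule that)
  define f where "f i = (if i = 0 then n else if i \<le> n then i - 1 else i)" for i
  have "inj f"
  proof (rule injI)
    fix x y assume "f x = f y"
    then show "x = y" unfolding f_def by (simp split: if_splits)
  qed
  have "dpred M (\<lambda>s. \<exists>a. ?Q (\<lambda>i. (s(n := a)) (f i)))"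
    by (rule dpred_ex_upd[OF dpred_rename[OF assms \<open>inj f\<close>], where k = n])
  moreover have "?Q (\<lambda>i. (s(n := a)) (f i)) = P a s" for s a
  proof -
    have "?Q (\<lambda>i. (s(n := a)) (f i)) = ?Q (case_nat a s)"
      by (rule n[THEN spec, THEN spec, THEN mp]) (auto simp: f_def split: nat.splits)
    then show ?thesis by simp
  qed
  ultimately show ?thesis by simp
qed

lemma dpred_all:
  assumes "dpred M (\<lambda>s. P (s 0) (\<lambda>i. s (Suc i)))"
  shows "dpred M (\<lambda>s. \<forall>a. P a s)"
proof -
  have "dpred M (\<lambda>s. \<not> (\<exists>a. \<not> P a s))"
    by (intro dpred_neg dpred_ex assms)
  then show ?thesis by simp
qed

text \<open>Quantifying over a dummy variable lowers all indices by one.\<close>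

lemma dpred_unshift:
  assumes "dpred M (\<lambda>s. P (\<lambda>i. s (n + i)))"
  shows "dpred M P"
  using assms
proof (induction n)
  case (Suc n)
  have "dpred M (\<lambda>s. \<exists>a::'a. P (\<lambda>i. s (n + i)))"
    by (rule dpred_ex) (use Suc.prems in simp)
  then show ?case using Suc.IH by simp
qed simp

text \<open>Simultaneous substitution, carried out one variable at a time by means of a quantifier
  and the graph of \<open>t k\<close>. The terms read a copy of the assignment that starts at
  \<open>n\<close>, a bound for the support of \<open>P\<close>, so that variables already replaced
  cannot interfere; \<open>dpred_unshift\<close> removes the offset at the end.\<close>

lemma dpred_comp:
  assumes P: "dpred M P" and t: "\<And>i. dterm M (t i)"
  shows "dpred M (\<lambda>s. P (\<lambda>i. t i s))"
proof -
  obtain n where n: "\<forall>s s'. (\<forall>i<n. s i = s' i) \<longrightarrow> P s = P s'"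
    using dpred_support[OF P] by (elim exE) (rule that)
  have "dpred M (\<lambda>s. P (\<lambda>i. if i < k then t i (\<lambda>j. s (n + j)) else s i))" if "k \<le> n" for k
    using that
  proof (induction k)
    case 0 show ?case using P by simp
  next
    case (Suc k)
    let ?A = "\<lambda>s. P (\<lambda>i. if i < k then t i (\<lambda>j. s (n + j)) else s i)"
    define f where "f i = (case i of 0 \<Rightarrow> k | Suc j \<Rightarrow> n + j)" for i
    have "inj f"
    proof (rule injI)
      fix x y assume "f x = f y"
      then show "x = y" using Suc.prems by (cases x; cases y; simp add: f_def)
    qed
    have "dpred M (\<lambda>s. s k = t k (\<lambda>j. s (n + j)))"
      using dpred_rename[OF t[of k, unfolded dterm_def] \<open>inj f\<close>] by (simp add: f_def)
    with Suc have "dpred M (\<lambda>s. \<exists>a. ((s(k := a)) k = t k (\<lambda>j. (s(k := a)) (n + j)) \<and> ?A (s(k := a))))"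
      by (intro dpred_ex_upd dpred_conj) auto
    moreover have "(\<lambda>j. (s(k := a)) (n + j)) = (\<lambda>j. s (n + j))" for s :: "nat \<Rightarrow> 'a" and a
      using Suc.prems by (auto simp: fun_eq_iff)
    ultimately have *: "dpred M (\<lambda>s. \<exists>a. a = t k (\<lambda>j. s (n + j)) \<and>
        P (\<lambda>i. if i < k then t i (\<lambda>j. s (n + j)) else (s(k := a)) i))"
      by (simp only: fun_upd_same)
    have "(\<lambda>i. if i < k then t i (\<lambda>j. s (n + j)) else (s(k := t k (\<lambda>j. s (n + j)))) i) =
        (\<lambda>i. if i < Suc k then t i (\<lambda>j. s (n + j)) else s i)" for s
      by (auto simp: fun_eq_iff less_Suc_eq)
    with * show ?case by simp
  qed
  from this[of n] have "dpred M (\<lambda>s. P (\<lambda>i. if i < n then t i (\<lambda>j. s (n + j)) else s i))" by simp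
  moreover have "P (\<lambda>i. if i < n then t i (\<lambda>j. s (n + j)) else s i) = P (\<lambda>i. t i (\<lambda>j. s (n + j)))" for s
    by (rule n[THEN spec, THEN spec, THEN mp]) auto
  ultimately have "dpred M (\<lambda>s. P (\<lambda>i. t i (\<lambda>j. s (n + j))))" by simp
  then show ?thesis by (rule dpred_unshift[of M "\<lambda>s. P (\<lambda>i. t i s)"])
qed

section \<open>Equality, order and the group operations\<close>

lemma dpred_atom_eq: "i \<noteq> j \<Longrightarrow> dpred M (\<lambda>s. s i = s j)"
  by (rule dpredI[where n = "Suc (max i j)" and c = "\<lambda>_. 0" and \<phi> = "Equal (Var i) (Var j)"])
    (auto simp: concat_tuple_def)

lemma dterm_var: "dterm M (\<lambda>s. s i)"
  unfolding dterm_def by (intro dpred_atom_eq) simp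

lemma dterm_const: "dterm M (\<lambda>s. c)"
  unfolding dterm_def
  by (rule dpredI[where n = 1 and c = "\<lambda>_. c" and \<phi> = "Equal (Var 0) (Var 1)"])
    (auto simp: concat_tuple_def)

lemma dterm_rename:
  assumes "dterm M t" "inj f"
  shows "dterm M (\<lambda>s. t (\<lambda>i. s (f i)))"
proof -
  let ?g = "case_nat 0 (\<lambda>i. Suc (f i))"
  have "inj ?g"
  proof (rule injI)
    fix x y assume "?g x = ?g y"
    then show "x = y" by (cases x; cases y; simp add: inj_eq[OF assms(2)])
  qed
  from dpred_rename[OF assms(1)[unfolded dterm_def] this] show ?thesis
    by (simp add: dterm_def)
qed

lemma dterm_shift: "dterm M t \<Longrightarrow> dterm M (\<lambda>s. t (\<lambda>i. s (Suc i)))"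
  by (rule dterm_rename) auto

lemma dpred_shift: "dpred M P \<Longrightarrow> dpred M (\<lambda>s. P (\<lambda>i. s (Suc i)))"
  by (rule dpred_rename) auto

lemma dterm_comp:
  assumes "dterm M t" "\<And>i. dterm M (u i)"
  shows "dterm M (\<lambda>s. t (\<lambda>i. u i s))"
  unfolding dterm_def
  using dpred_comp[OF assms(1)[unfolded dterm_def],
      where t = "\<lambda>i. case i of 0 \<Rightarrow> (\<lambda>s. s 0) | Suc j \<Rightarrow> (\<lambda>s. u j (\<lambda>i. s (Suc i)))"]
  by (auto simp: dterm_var dterm_shift assms split: nat.splits)

text \<open>This rule and the three after it pass from definability in the variables 0 and 1 to
  arbitrary definable arguments. Instances such as \<open>dpred_binary[OF A]\<close> serve below as
  introduction rules for a fixed relation.\<close>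

lemma dpred_unary:
  assumes "dpred M (\<lambda>s. P (s 0))" "dterm M t" shows "dpred M (\<lambda>s. P (t s))"
  using dpred_comp[OF assms(1), where t = "\<lambda>_. t"] assms by simp

lemma dpred_binary:
  assumes "dpred M (\<lambda>s. P (s 0) (s 1))" "dterm M t" "dterm M u" shows "dpred M (\<lambda>s. P (t s) (u s))"
  using dpred_comp[OF assms(1), where t = "\<lambda>i. if i = 0 then t else u"] assms by simp

lemma dterm_unary:
  assumes "dterm M (\<lambda>s. f (s 0))" "dterm M t" shows "dterm M (\<lambda>s. f (t s))"
  using dterm_comp[OF assms(1), where u = "\<lambda>_. t"] assms by simp

lemma dterm_binary:
  assumes "dterm M (\<lambda>s. f (s 0) (s 1))" "dterm M t" "dterm M u" shows "dterm M (\<lambda>s. f (t s) (u s))"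
  using dterm_comp[OF assms(1), where u = "\<lambda>i. if i = 0 then t else u"] assms by simp

lemma dpred_eq: "dterm M t \<Longrightarrow> dterm M u \<Longrightarrow> dpred M (\<lambda>s. t s = u s)"
  by (rule dpred_binary[where P = "(=)"]) (auto intro: dpred_atom_eq)

lemma dpred_less: "dterm M t \<Longrightarrow> dterm M u \<Longrightarrow> dpred M (\<lambda>s. t s < u s)"
  by (rule dpred_binary[where P = "(<)"],
      rule dpredI[where n = 2 and c = "\<lambda>_. 0" and \<phi> = "Less (Var 0) (Var 1)"])
    (auto simp: concat_tuple_def)

lemma dpred_le: "dterm M t \<Longrightarrow> dterm M u \<Longrightarrow> dpred M (\<lambda>s. t s \<le> u s)"
  unfolding le_less by (intro dpred_disj dpred_less dpred_eq)

lemma dterm_graphI: "dpred M (\<lambda>s. s 0 = t (\<lambda>i. s (Suc i))) \<Longrightarrow> dterm M t"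
  by (simp add: dterm_def)

lemma dterm_plus: "dterm M t \<Longrightarrow> dterm M u \<Longrightarrow> dterm M (\<lambda>s. t s + u s)"
  by (rule dterm_binary[where f = "(+)"], unfold dterm_def,
      rule dpredI[where n = 3 and c = "\<lambda>_. 0" and \<phi> = "Equal (Var 0) (Plus (Var 1) (Var 2))"])
    (simp add: concat_tuple_def numeral_2_eq_2 numeral_3_eq_3, assumption+)

text \<open>Subtraction is no symbol of the language; the difference is the unique solution of an
  equation in \<open>+\<close>.\<close>

lemma dterm_minus:
  assumes "dterm M t" "dterm M u" shows "dterm M (\<lambda>s. t s - u s)"
proof -
  have "dpred M (\<lambda>s. s 0 + u (\<lambda>i. s (Suc i)) = t (\<lambda>i. s (Suc i)))"
    by (intro dpred_eq dterm_plus dterm_var dterm_shift assms)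
  then show ?thesis
    by (intro dterm_graphI) (simp add: eq_diff_eq)
qed

lemma dterm_uminus: "dterm M t \<Longrightarrow> dterm M (\<lambda>s. - t s)"
  using dterm_minus[OF dterm_const[of M 0], of t] by simp

lemma dterm_if:
  assumes "dpred M P" "dterm M t" "dterm M u"
  shows "dterm M (\<lambda>s. if P s then t s else u s)"
proof -
  have "dpred M (\<lambda>s. (P (\<lambda>i. s (Suc i)) \<and> s 0 = t (\<lambda>i. s (Suc i))) \<or>
      (\<not> P (\<lambda>i. s (Suc i)) \<and> s 0 = u (\<lambda>i. s (Suc i))))"
    by (intro dpred_conj dpred_disj dpred_neg dpred_eq dterm_var dterm_shift dpred_shift assms)
  then show ?thesis
    by (intro dterm_graphI) (rule back_subst[of "dpred M"], assumption, auto)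
qed

lemma dterm_min: "dterm M t \<Longrightarrow> dterm M u \<Longrightarrow> dterm M (\<lambda>s. min (t s) (u s))"
  unfolding min_def by (intro dterm_if dpred_le)

section \<open>Tuples and definable families\<close>

lemma restrict_cpow: "x \<in> cpow n \<Longrightarrow> restrict x {..<n} = x" "restrict s {..<n} \<in> cpow n"
  by (auto simp: cpow_def PiE_iff extensional_def fun_eq_iff)

text \<open>In the rules for quantifiers the quantified variables are inserted in front of the others.\<close>

lemma dpred_ex_cpow:
  assumes "dpred M (\<lambda>s. P (restrict s {..<n}) (\<lambda>i. s (n + i)))"
  shows "dpred M (\<lambda>s. \<exists>x\<in>cpow n. P x s)"
proof -
  have ex: "dpred M (\<lambda>s. \<exists>y. Q (concat_tuple k y s))" if "dpred M Q" for Q :: "(nat \<Rightarrow> 'a) \<Rightarrow> bool" and k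
    using that
  proof (induction k arbitrary: Q)
    case 0 then show ?case by (simp add: concat_tuple_def)
  next
    case (Suc k)
    have "dpred M (\<lambda>s. \<exists>a. Q (case_nat a s))"
    proof (rule dpred_ex)
      have "case_nat (s 0) (\<lambda>i. s (Suc i)) = s" for s :: "nat \<Rightarrow> 'a"
        by (auto simp: fun_eq_iff split: nat.splits)
      with Suc.prems show "dpred M (\<lambda>s. Q (case_nat (s 0) (\<lambda>i. s (Suc i))))" by simp
    qed
    from Suc.IH[OF this] show ?case
    proof (rule back_subst[of "dpred M"], intro ext iffI)
      fix s assume "\<exists>y a. Q (case_nat a (concat_tuple k y s))"
      then obtain y a where "Q (case_nat a (concat_tuple k y s))" by blast
      moreover have "case_nat a (concat_tuple k y s) = concat_tuple (Suc k) (case_nat a y) s"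
        by (auto simp: fun_eq_iff concat_tuple_def split: nat.splits)
      ultimately show "\<exists>y. Q (concat_tuple (Suc k) y s)" by auto
    next
      fix s assume "\<exists>y. Q (concat_tuple (Suc k) y s)"
      then obtain y where "Q (concat_tuple (Suc k) y s)" by blast
      moreover have "concat_tuple (Suc k) y s = case_nat (y 0) (concat_tuple k (\<lambda>i. y (Suc i)) s)"
        by (auto simp: fun_eq_iff concat_tuple_def split: nat.splits)
      ultimately show "\<exists>y a. Q (case_nat a (concat_tuple k y s))" by auto
    qed
  qed
  show ?thesis
  proof (rule back_subst[of "dpred M", OF ex[OF assms, of n]], intro ext iffI)
    fix s assume "\<exists>y. P (restrict (concat_tuple n y s) {..<n}) (\<lambda>i. concat_tuple n y s (n + i))"
    then obtain y where "P (restrict (concat_tuple n y s) {..<n}) (\<lambda>i. concat_tuple n y s (n + i))" by blast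
    then have "P (restrict (concat_tuple n y s) {..<n}) s" by (simp add: concat_tuple_def)
    then show "\<exists>x\<in>cpow n. P x s"
      using restrict_cpow(2) by blast
  next
    fix s assume "\<exists>x\<in>cpow n. P x s"
    then obtain x where x: "x \<in> cpow n" "P x s" by blast
    then have "restrict (concat_tuple n x s) {..<n} = x"
      by (auto simp: cpow_def concat_tuple_def fun_eq_iff PiE_iff extensional_def)
    then show "\<exists>y. P (restrict (concat_tuple n y s) {..<n}) (\<lambda>i. concat_tuple n y s (n + i))"
      using x by (intro exI[of _ x]) (simp add: concat_tuple_def)
  qed
qed

lemma dpred_all_cpow:
  assumes "dpred M (\<lambda>s. P (restrict s {..<n}) (\<lambda>i. s (n + i)))"
  shows "dpred M (\<lambda>s. \<forall>x\<in>cpow n. P x s)"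
proof -
  have "dpred M (\<lambda>s. \<not> (\<exists>x\<in>cpow n. \<not> P x s))"
    by (intro dpred_neg dpred_ex_cpow assms)
  then show ?thesis by simp
qed

lemma definable_iff_dpred:
  "definable M n X \<longleftrightarrow> X \<subseteq> cpow n \<and> dpred M (\<lambda>s. restrict s {..<n} \<in> X)"
proof (intro iffI conjI)
  assume "definable M n X"
  then obtain \<phi> c where X: "X = {x \<in> cpow n. sat M (concat_tuple n x c) \<phi>}"
    unfolding definable_def by blast
  then show "X \<subseteq> cpow n" by blast
  have "concat_tuple n (restrict s {..<n}) c = concat_tuple n s c" for s
    by (auto simp: concat_tuple_def fun_eq_iff)
  then show "dpred M (\<lambda>s. restrict s {..<n} \<in> X)"
    by (intro dpredI[where n = n and c = c and \<phi> = \<phi>]) (simp add: X restrict_cpow)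
next
  assume "X \<subseteq> cpow n \<and> dpred M (\<lambda>s. restrict s {..<n} \<in> X)"
  then have X: "X \<subseteq> cpow n" and D: "dpred M (\<lambda>s. restrict s {..<n} \<in> X)" by auto
  obtain m c \<phi> where m: "m \<ge> n"
    "\<forall>s. restrict s {..<n} \<in> X \<longleftrightarrow> sat M (concat_tuple m s c) \<phi>"
    using dpred_rep[OF D, of n] by (elim exE conjE) (rule that)
  \<comment> \<open>A tuple in \<open>cpow n\<close> has the value \<open>undefined\<close> from
    \<open>n\<close> on, so the variables between \<open>n\<close> and \<open>m\<close> are turned
    into parameters with this value.\<close>
  define d where "d j = (if j + n < m then undefined else c (j + n - m))" for j
  have "concat_tuple m x c = concat_tuple n x d" if "x \<in> cpow n" for x
    using that m(1) by (auto simp: concat_tuple_def fun_eq_iff d_def cpow_def PiE_iff extensional_def)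
  moreover have "x \<in> X \<longleftrightarrow> sat M (concat_tuple m x c) \<phi>" if "x \<in> cpow n" for x
    using m(2)[rule_format, of x] unfolding restrict_cpow(1)[OF that] .
  ultimately have "X = {x \<in> cpow n. sat M (concat_tuple n x d) \<phi>}"
    using X by (intro set_eqI iffI CollectI conjI) auto
  then show "definable M n X" unfolding definable_def by blast
qed

lemma definable_family_rep:
  assumes "definable_family M n \<B>"
  obtains m R where "\<B> = (\<lambda>b. {x \<in> cpow n. R b x}) ` cpow m"
    "dpred M (\<lambda>s. R (restrict (\<lambda>i. s (n + i)) {..<m}) (restrict s {..<n}))"
proof -
  obtain m \<phi> c where B: "\<B> = (\<lambda>b. {x \<in> cpow n. sat M (concat_tuple n x (concat_tuple m b c)) \<phi>}) ` cpow m"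
    using assms unfolding definable_family_def by blast
  define R where "R b x = sat M (concat_tuple n x (concat_tuple m b c)) \<phi>" for b x
  have "concat_tuple n (restrict s {..<n}) (concat_tuple m (restrict (\<lambda>i. s (n + i)) {..<m}) c)
     = concat_tuple (n + m) s c" for s
    by (auto simp: concat_tuple_def fun_eq_iff)
  then have "dpred M (\<lambda>s. R (restrict (\<lambda>i. s (n + i)) {..<m}) (restrict s {..<n}))"
    by (intro dpredI[where n = "n+m" and c = c and \<phi> = \<phi>]) (simp add: R_def)
  then show thesis using that[of R m] B by (simp add: R_def)
qed

section \<open>O-minimal expansions of non-trivial ordered groups\<close>

context linordered_group_add
begin

text \<open>Left and right translations are treated separately until \<open>commute\<close> makes
  the theory of ordered abelian groups available.\<close>

lemma gadd_le_left [simp]: "c + a \<le> c + b \<longleftrightarrow> a \<le> b"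
proof
  assume "c + a \<le> c + b"
  from group_add_left_mono[OF this, of "- c"] show "a \<le> b" by (simp add: add.assoc[symmetric])
qed (rule group_add_left_mono)

lemma gadd_le_right [simp]: "a + c \<le> b + c \<longleftrightarrow> a \<le> b"
proof
  assume "a + c \<le> b + c"
  from group_add_right_mono[OF this, of "- c"] show "a \<le> b" by (simp add: add.assoc)
qed (rule group_add_right_mono)

lemma gadd_less_left [simp]: "c + a < c + b \<longleftrightarrow> a < b"
  by (simp add: less_le)

lemma gadd_less_right [simp]: "a + c < b + c \<longleftrightarrow> a < b"
  by (simp add: less_le)

end

section \<open>Definable subsets of the line\<close>

definition dset :: "('a::linordered_group_add, 'f, 'r) fo_struct \<Rightarrow> 'a set \<Rightarrow> bool" where
  "dset M A \<longleftrightarrow> dpred M (\<lambda>s. s 0 \<in> A)"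

lemma dsetI: "dpred M (\<lambda>s. P (s 0)) \<Longrightarrow> dset M {x. P x}"
  by (simp add: dset_def)

lemma dsetD: "dset M A \<Longrightarrow> dterm M t \<Longrightarrow> dpred M (\<lambda>s. t s \<in> A)"
  unfolding dset_def by (rule dpred_unary)

lemmas dintros = dpred_neg dpred_conj dpred_disj dpred_imp dpred_const dpred_ex dpred_all
  dpred_eq dpred_less dpred_le dterm_var dterm_const dterm_plus dterm_minus dterm_uminus dterm_min
  dterm_if

lemma dset_Int: "dset M A \<Longrightarrow> dset M B \<Longrightarrow> dset M (A \<inter> B)"
  unfolding dset_def Int_iff by (rule dpred_conj)

lemma dset_Un: "dset M A \<Longrightarrow> dset M B \<Longrightarrow> dset M (A \<union> B)"
  unfolding dset_def Un_iff by (rule dpred_disj)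

lemma dset_Diff: "dset M A \<Longrightarrow> dset M B \<Longrightarrow> dset M (A - B)"
  unfolding dset_def Diff_iff by (intro dpred_conj dpred_neg)

lemma dset_singleton: "dset M {a}"
  unfolding dset_def singleton_iff by (intro dintros)

lemma dset_empty: "dset M {}"
  unfolding dset_def empty_iff by (intro dintros)

lemma dset_finite: "finite A \<Longrightarrow> dset M A"
proof (induction rule: finite_induct)
  case (insert x F)
  then show ?case using dset_Un[OF dset_singleton[of M x] insert.IH] by simp
qed (rule dset_empty)

lemma dset_interval: "dset M {a<..<b}" "dset M {a<..}" "dset M {..<b}" "dset M {a..b}"
  unfolding dset_def greaterThanLessThan_iff greaterThan_iff lessThan_iff atLeastAtMost_iff
  by (intro dintros)+

lemma definable_1I:
  assumes "dset M A"
  shows "definable M 1 {x \<in> cpow 1. x 0 \<in> A}"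
  unfolding definable_iff_dpred
  using assms by (simp add: dset_def restrict_cpow subset_iff)

text \<open>\<open>True\<close> stands for the right-hand side. With the side as a Boolean argument,
  statements about the two one-sided limits share their proofs.\<close>

definition germ :: "bool \<Rightarrow> 'a::linorder_topology \<Rightarrow> 'a filter" where
  "germ d x = (if d then at_right x else at_left x)"

locale omin =
  fixes M :: "('a::{linordered_group_add, linorder_topology}, 'f, 'r) fo_struct"
  assumes omin: "o_minimal M" and nontriv: "\<exists>x::'a. x \<noteq> 0"
begin

text \<open>O-minimality as an induction principle: what holds for points and open intervals and is
  stable under unions of two sets holds for every definable subset of the line. The alternatives
  proved with it below are phrased so that they survive unions.\<close>

lemma dset_induct [consumes 1, case_names empty point interval union]:
  assumes "dset M A" and "Q {}" and "\<And>p. Q {p}" and "\<And>I. I \<in> open_intervals \<Longrightarrow> Q I"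
    and "\<And>A B. Q A \<Longrightarrow> Q B \<Longrightarrow> Q (A \<union> B)"
  shows "Q A"
proof -
  let ?X = "{x \<in> cpow 1. x 0 \<in> A}"
  have "(\<lambda>x. x 0) ` ?X = A"
  proof (intro set_eqI iffI)
    fix a assume "a \<in> A"
    then have "restrict (\<lambda>_. a) {..<1::nat} \<in> ?X" by (simp add: restrict_cpow)
    then show "a \<in> (\<lambda>x. x 0) ` ?X" by (rule rev_image_eqI) simp
  qed auto
  then obtain P \<I> where "finite P" "finite \<I>" "\<I> \<subseteq> open_intervals" and A: "A = P \<union> \<Union>\<I>"
    using omin[unfolded o_minimal_def, rule_format, OF definable_1I[OF assms(1)]]
    by (elim exE conjE) (rule that; simp)
  have "Q P"
    using \<open>finite P\<close>
  proof (induction rule: finite_induct)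
    case (insert x F)
    then show ?case using assms(5)[OF assms(3)[of x] insert.IH] by simp
  qed (rule assms(2))
  moreover have "Q (\<Union>\<I>)"
    using \<open>finite \<I>\<close> \<open>\<I> \<subseteq> open_intervals\<close>
  proof (induction rule: finite_induct)
    case (insert x F)
    then show ?case using assms(5)[OF assms(4)[of x]] by simp
  qed (simp add: assms(2))
  ultimately show ?thesis using assms(5) A by simp
qed

lemma ex_pos: "\<exists>e::'a. e > 0"
proof -
  obtain x :: 'a where "x \<noteq> 0" using nontriv by blast
  then consider "x > 0" | "x < 0" by fastforce
  then show ?thesis
  proof cases
    case 2
    then have "- x + x < - x + 0" by (simp only: gadd_less_left)
    then show ?thesis by auto
  qed auto
qed

lemma ex_gt: "\<exists>y::'a. x < y"
  using ex_pos by (metis add.right_neutral gadd_less_left)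

lemma ex_lt: "\<exists>y::'a. y < x"
proof -
  obtain e :: 'a where "e > 0" using ex_pos by blast
  then have "x + - e + 0 < x + - e + e" by (simp only: gadd_less_left)
  then show ?thesis by (auto simp: add.assoc)
qed

text \<open>A finite union of points and intervals either contains a ray to the right or is bounded
  above.\<close>

lemma ray:
  assumes "dset M A" "\<And>x. \<exists>y\<in>A. x < y"
  shows "\<exists>a. {a<..} \<subseteq> A"
proof -
  have "(\<exists>a. {a<..} \<subseteq> A) \<or> (\<exists>b. \<forall>x\<in>A. x \<le> b)"
    using assms(1)
  proof (induction rule: dset_induct)
    case (interval I)
    then consider "\<exists>a. {a<..} \<subseteq> I" | a b where "I = {..<b} \<or> I = {a<..<b}"
      unfolding open_intervals_def by auto
    then consider "\<exists>a. {a<..} \<subseteq> I" | "\<exists>b. \<forall>x\<in>I. x \<le> b"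
    proof cases
      case (2 a b)
      then have "\<forall>x\<in>I. x \<le> b" by auto
      then show ?thesis using that by blast
    qed
    then show ?case by blast
  next
    case (union A B)
    then show ?case
    proof (elim disjE exE)
      fix a b assume "\<forall>x\<in>A. x \<le> a" "\<forall>x\<in>B. x \<le> b"
      then have "\<forall>x\<in>A \<union> B. x \<le> max a b" by (auto simp: max.coboundedI1 max.coboundedI2)
      then show ?thesis by blast
    qed blast+
  qed auto
  then show ?thesis using assms(2) by (meson leD)
qed

text \<open>If there were a least positive element \<open>d\<close>, then \<open>x + d\<close> and \<open>x\<close> could not both be of the
  form \<open>y + y\<close>; but the definable set of all such elements is cofinal and hence contains a ray.\<close>

lemma dense:
  assumes "(a::'a) < b"
  shows "\<exists>c. a < c \<and> c < b"
proof (rule ccontr)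
  assume no: "\<nexists>c. a < c \<and> c < b"
  define d where "d = - a + b"
  have d: "a + d = b" by (simp add: d_def add.assoc[symmetric])
  have "d > 0" using assms gadd_less_left[of a 0 d] by (simp add: d)
  have min: "d \<le> c" if "c > 0" for c
  proof -
    have "a + c > a" using that gadd_less_left[of a 0 c] by simp
    then have "b \<le> a + c" using no by auto
    then show ?thesis using gadd_less_left[of a c d] by (auto simp: d[symmetric] simp del: gadd_less_left)
  qed
  have E: "dset M {x::'a. \<exists>y. x = y + y}" by (intro dsetI dintros)
  have unbounded: "\<exists>y\<in>{x::'a. \<exists>y. x = y + y}. x < y" for x :: 'a
  proof (cases "x > 0")
    case True
    then show ?thesis using gadd_less_left[of x 0 x] by auto
  next
    case False
    then have "x < d + d" using \<open>d > 0\<close> gadd_less_left[of d 0 d] by auto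
    then show ?thesis by auto
  qed
  obtain z where z: "{z<..} \<subseteq> {x::'a. \<exists>y. x = y + y}"
    using ray[OF E unbounded] by blast
  obtain y where y: "z < y" using ex_gt by blast
  with z obtain u where u: "y = u + u" by blast
  have "y < y + d" using \<open>d > 0\<close> gadd_less_left[of y 0 d] by simp
  with z y have "y + d \<in> {x::'a. \<exists>y. x = y + y}" by (meson greaterThan_iff less_trans subsetD)
  then obtain v where v: "y + d = v + v" by blast
  have "u < v"
  proof (rule ccontr)
    assume "\<not> u < v"
    then have "v + v \<le> u + u" by (meson group_add_left_mono group_add_right_mono leI order_trans)
    then show False using \<open>y < y + d\<close> u v by auto
  qed
  then have "- u + v > 0" using gadd_less_left[of "-u" u v] by simp
  then have "u + d \<le> v"
    using group_add_left_mono[OF min, of "-u + v" u] by (simp add: add.assoc[symmetric])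
  then have "(u + d) + (u + d) \<le> v + v" by (meson group_add_left_mono group_add_right_mono order_trans)
  moreover have "(u + d) + (u + d) > u + u + d"
  proof -
    have "d + (u + d) > 0 + (u + d)" using \<open>d > 0\<close> by (simp only: gadd_less_right)
    then have "u + (d + (u + d)) > u + (u + d)" by simp
    then show ?thesis by (simp add: add.assoc)
  qed
  ultimately have "u + u + d < v + v" by (rule less_le_trans[rotated])
  then show False using v u by simp
qed

lemma interval_infinite: "(a::'a) < b \<Longrightarrow> infinite {a<..<b}"
proof
  assume "a < b" "finite {a<..<b}"
  then have "finite ({a<..<b} \<union> {a})" by simp
  define m where "m = Max ({a<..<b} \<union> {a})"
  have "m \<in> {a<..<b} \<union> {a}" unfolding m_def by (rule Max_in) (use \<open>finite {a<..<b}\<close> in auto)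
  then have "m < b" "a \<le> m" using \<open>a < b\<close> by auto
  then obtain c where "m < c" "c < b" using dense by blast
  then have "c \<in> {a<..<b} \<union> {a}" using \<open>a \<le> m\<close> by auto
  then have "c \<le> m" unfolding m_def using \<open>finite {a<..<b}\<close> by (intro Max_ge) auto
  with \<open>m < c\<close> show False by simp
qed

lemma infinite_contains_interval:
  assumes "dset M A" "infinite A"
  shows "\<exists>a b. a < b \<and> {a<..<b} \<subseteq> A"
proof -
  have "finite A \<or> (\<exists>a b. a < b \<and> {a<..<b} \<subseteq> A)"
    using assms(1)
  proof (induction rule: dset_induct)
    case (interval I)
    then consider "I = UNIV" | a where "I = {a<..}" | b where "I = {..<b}" | a b where "I = {a<..<b}"
      unfolding open_intervals_def by auto
    then show ?case
    proof cases
      case 1 then show ?thesis using ex_gt by blast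
    next
      case (2 a)
      obtain b where "a < b" using ex_gt by blast
      then show ?thesis using 2 by (intro disjI2 exI[of _ a] exI[of _ b]) auto
    next
      case (3 b)
      obtain a where "a < b" using ex_lt by blast
      then show ?thesis using 3 by (intro disjI2 exI[of _ a] exI[of _ b]) auto
    next
      case (4 a b) then show ?thesis by (cases "a < b") auto
    qed
  next
    case (union A B)
    then show ?case by (metis finite_UnI le_supI1 le_supI2)
  qed auto
  then show ?thesis using assms(2) by blast
qed

text \<open>The criterion behind many of the finiteness results below: it suffices to exhibit in
  each interval one point outside of the set.\<close>

lemma finite_if_no_interval:
  assumes "dset M A" "\<And>a b. a < b \<Longrightarrow> \<exists>x. a < x \<and> x < b \<and> x \<notin> A"
  shows "finite A"
proof (rule ccontr)
  assume "infinite A"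
  then obtain a b where "a < b" "{a<..<b} \<subseteq> A" using infinite_contains_interval assms(1) by blast
  then show False using assms(2)[of a b] by auto
qed

text \<open>Definable completeness. The order of M may have gaps, but a non-empty finite union of
  points and intervals that is bounded above has its supremum among the points and the right end
  points of the intervals.\<close>

lemma sup:
  assumes "dset M A" "A \<noteq> {}" "\<And>x. x \<in> A \<Longrightarrow> x \<le> B"
  shows "\<exists>s. (\<forall>x\<in>A. x \<le> s) \<and> (\<forall>y<s. \<exists>x\<in>A. y < x)"
proof -
  have "A = {} \<or> \<not> (\<exists>B. \<forall>x\<in>A. x \<le> B) \<or> (\<exists>s. (\<forall>x\<in>A. x \<le> s) \<and> (\<forall>y<s. \<exists>x\<in>A. y < x))"
    using assms(1)
  proof (induction rule: dset_induct)
    case (interval I)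
    then consider "\<exists>a. {a<..} \<subseteq> I" | b where "I = {..<b}" | a b where "I = {a<..<b}"
      unfolding open_intervals_def by auto
    then show ?case
    proof cases
      case 1
      then obtain a where "{a<..} \<subseteq> I" by blast
      moreover have "\<exists>x>a. \<not> x \<le> B" for B using ex_gt[of "max a B"] by auto
      ultimately have "\<not> (\<exists>B. \<forall>x\<in>I. x \<le> B)" by (meson greaterThan_iff subsetD)
      then show ?thesis by blast
    next
      case (2 b)
      then show ?thesis using dense[of _ b] by (intro disjI2 exI[of _ b]) force
    next
      case (3 a b)
      have "\<exists>x\<in>I. y < x" if "y < b" "a < b" for y
        using dense[of "max a y" b] that 3 by auto
      then have "(\<forall>x\<in>I. x \<le> b) \<and> (\<forall>y<b. \<exists>x\<in>I. y < x)" if "a < b"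
        using 3 that by auto
      moreover have "I = {}" if "\<not> a < b" using 3 that by auto
      ultimately show ?thesis by blast
    qed
  next
    case (union A B)
    consider "A = {}" | "B = {}" | "\<not> (\<exists>u. \<forall>x\<in>A \<union> B. x \<le> u)"
      | "\<exists>s. (\<forall>x\<in>A. x \<le> s) \<and> (\<forall>y<s. \<exists>x\<in>A. y < x)" "\<exists>t. (\<forall>x\<in>B. x \<le> t) \<and> (\<forall>y<t. \<exists>x\<in>B. y < x)"
      using union by (metis UnCI)
    then show ?case
    proof cases
      case 4
      then obtain s t where "\<forall>x\<in>A. x \<le> s" "\<forall>y<s. \<exists>x\<in>A. y < x"
        "\<forall>x\<in>B. x \<le> t" "\<forall>y<t. \<exists>x\<in>B. y < x" by (elim exE conjE) (rule that)
      then have "(\<forall>x\<in>A \<union> B. x \<le> max s t) \<and> (\<forall>y<max s t. \<exists>x\<in>A \<union> B. y < x)"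
        by (auto simp: less_max_iff_disj le_max_iff_disj)
      then show ?thesis by blast
    qed (use union in auto)
  qed auto
  then show ?thesis using assms by auto
qed

section \<open>Definable subgroups, commutativity and divisibility\<close>

lemma subgroup_eq_UNIV:
  assumes "dset M H" and plus: "\<And>x y. x \<in> H \<Longrightarrow> y \<in> H \<Longrightarrow> x + y \<in> H"
    and uminus: "\<And>x. x \<in> H \<Longrightarrow> - x \<in> H" and "h \<in> H" "h \<noteq> 0"
  shows "H = UNIV"
proof -
  obtain h where h: "h \<in> H" "h > 0"
  proof (cases "h > 0")
    case False
    then have "h < 0" using \<open>h \<noteq> 0\<close> by auto
    then have "- h > 0" using gadd_less_left[of "-h" h 0] by simp
    then show thesis using that uminus[OF \<open>h \<in> H\<close>] by blast
  qed (use that assms in blast)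
  \<comment> \<open>A bounded \<open>H\<close> would have a supremum \<open>s\<close>; an element of
    \<open>H\<close> beyond \<open>s - h\<close> is moved past \<open>s\<close> by adding
    \<open>h\<close>. Hence \<open>H\<close> is cofinal and contains a ray.\<close>
  have "\<exists>y\<in>H. x < y" for x
  proof (rule ccontr)
    assume "\<not> ?thesis"
    then have "\<And>y. y \<in> H \<Longrightarrow> y \<le> x" by auto
    then obtain s where s: "\<forall>x\<in>H. x \<le> s" "\<forall>y<s. \<exists>x\<in>H. y < x" using sup[OF assms(1)] h by blast
    have "s - h < s" using gadd_less_left[of s "-h" 0] gadd_less_left[of "-h" 0 h] h by simp
    then obtain x where "x \<in> H" "s - h < x" using s by blast
    then have "s < x + h" using gadd_less_right[of "s - h" h x] by simp
    moreover have "x + h \<in> H" using plus h \<open>x \<in> H\<close> by blast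
    ultimately show False using s by auto
  qed
  then obtain a where a: "{a<..} \<subseteq> H" using ray[OF assms(1)] by blast
  \<comment> \<open>Every \<open>y\<close> is the difference of two elements of the ray:
    \<open>x\<close> is taken so large that \<open>x\<close> and \<open>x + y\<close> both lie in
    it.\<close>
  have "y \<in> H" for y
  proof -
    obtain x where x: "x > max a (a - y)" using ex_gt by blast
    then have "x \<in> H" using a by auto
    have "x + y > a" using gadd_less_right[of "a - y" y x] x by simp
    then have "x + y \<in> H" using a by auto
    with \<open>x \<in> H\<close> have "- x + (x + y) \<in> H" by (blast intro: plus uminus)
    then show ?thesis by simp
  qed
  then show ?thesis by blast
qed

text \<open>For \<open>x \<noteq> 0\<close> the centralizer of \<open>x\<close> is a definable
  subgroup that contains \<open>x\<close>, hence the whole group.\<close>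

lemma commute: "x + y = y + (x::'a)"
proof (cases "x = 0")
  case False
  have "{y. x + y = y + x} = UNIV"
  proof (rule subgroup_eq_UNIV)
    show "dset M {y. x + y = y + x}" by (intro dsetI dintros)
    show "x \<in> {y. x + y = y + x}" by simp
  next
    fix a b assume "a \<in> {y. x + y = y + x}" "b \<in> {y. x + y = y + x}"
    then show "a + b \<in> {y. x + y = y + x}" proof -
      assume ab: "a \<in> {y. x + y = y + x}" "b \<in> {y. x + y = y + x}"
      have "x + (a + b) = a + x + b" using ab(1) by (simp add: add.assoc[symmetric])
      also have "\<dots> = a + b + x" using ab(2) by (simp add: add.assoc)
      finally show ?thesis by simp
    qed
  next
    fix a assume "a \<in> {y. x + y = y + x}"
    then have "x + a = a + x" by simp
    have "- a + x = - a + (x + a) + - a" by (simp add: add.assoc del: add_uminus_conv_diff)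
    also have "\<dots> = x + - a" by (simp add: \<open>x + a = a + x\<close>)
    finally have "- a + x = x + - a" .
    then show "- a \<in> {y. x + y = y + x}" by simp
  qed (rule False)
  then show ?thesis by blast
qed simp

sublocale og: linordered_ab_group_add "(+)" "0::'a" "(-)" uminus "(\<le>)" "(<)"
  by unfold_locales (auto simp: commute group_add_left_mono)

text \<open>By commutativity the doubles form a definable subgroup; it contains
  \<open>e + e \<noteq> 0\<close>.\<close>

lemma halve: "\<exists>y. y + y = (x::'a)"
proof -
  obtain e :: 'a where "e > 0" using ex_pos by blast
  then have "e + e \<noteq> 0" using og.add_pos_pos[of e e] by auto
  have "{x::'a. \<exists>y. y + y = x} = UNIV"
  proof (rule subgroup_eq_UNIV[of _ "e + e"])
    show "dset M {x::'a. \<exists>y. y + y = x}" by (intro dsetI dintros)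
    fix a b assume "a \<in> {x::'a. \<exists>y. y + y = x}" "b \<in> {x::'a. \<exists>y. y + y = x}"
    then obtain u v :: 'a where "a = u + u" "b = v + v" by auto
    then have "(u + v) + (u + v) = a + b" by (simp add: og.add_ac)
    then show "a + b \<in> {x::'a. \<exists>y. y + y = x}" by blast
  next
    fix a assume "a \<in> {x::'a. \<exists>y. y + y = x}"
    then obtain u :: 'a where "a = u + u" by auto
    then have "- u + - u = - a" by (simp add: og.minus_add_distrib)
    then show "- a \<in> {x::'a. \<exists>y. y + y = x}" by blast
  qed (use \<open>e + e \<noteq> 0\<close> in auto)
  then show ?thesis by blast
qed

lemma half_pos: "(e::'a) > 0 \<Longrightarrow> \<exists>c>0. c + c = e"
  using halve[of e] by (metis og.add_nonpos_nonpos leD leI)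

end

section \<open>One-sided germs\<close>

context omin
begin

lemma eventually_germ_True: "eventually P (germ True x) \<longleftrightarrow> (\<exists>b>x. \<forall>y. x < y \<and> y < b \<longrightarrow> P y)" for x :: 'a
proof -
  obtain y where "x < y" using ex_gt by blast
  show ?thesis using eventually_at_right[OF \<open>x < y\<close>] by (auto simp: germ_def)
qed

lemma eventually_germ_False: "eventually P (germ False x) \<longleftrightarrow> (\<exists>b<x. \<forall>y. b < y \<and> y < x \<longrightarrow> P y)" for x :: 'a
proof -
  obtain y where "y < x" using ex_lt by blast
  show ?thesis using eventually_at_left[OF \<open>y < x\<close>] by (auto simp: germ_def)
qed

lemma germ_neq_bot: "germ d (x::'a) \<noteq> bot"
proof
  assume "germ d x = bot"
  then have *: "eventually (\<lambda>_. False) (germ d x)" by simp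
  show False
  proof (cases d)
    case True
    then show ?thesis using * dense unfolding eventually_germ_True by (metis (full_types) eventually_germ_True)
  next
    case False
    then show ?thesis using * dense by (metis (full_types) eventually_germ_False)
  qed
qed

lemma eventually_germ_ex: "eventually P (germ d (x::'a)) \<Longrightarrow> \<exists>y. P y"
  using germ_neq_bot eventually_happens by blast

lemma eventually_germ_contra:
  "eventually P (germ d (x::'a)) \<Longrightarrow> eventually (\<lambda>y. \<not> P y) (germ d x) \<Longrightarrow> False"
  using eventually_germ_ex[OF eventually_conj, of P d x "\<lambda>y. \<not> P y"] by blast

text \<open>On definable sets the filter of one-sided neighbourhoods behaves like an ultrafilter:
  the germ is a complete type over M. Negations of "eventually" can therefore be pushed
  inside.\<close>

lemma germ_dichotomy_set:
  assumes "dset M A"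
  shows "eventually (\<lambda>y. y \<in> A) (germ d x) \<or> eventually (\<lambda>y. y \<notin> A) (germ d x)"
  using assms
proof (induction rule: dset_induct)
  case (point p)
  have "eventually (\<lambda>y. y \<noteq> p) (germ d x)"
  proof (cases d)
    case True
    then show ?thesis
      using ex_gt[of x] by (cases "x < p") (auto simp: eventually_germ_True intro: exI[of _ p])
  next
    case False
    then show ?thesis
      using ex_lt[of x] by (cases "p < x") (auto simp: eventually_germ_False intro: exI[of _ p])
  qed
  then show ?case by simp
next
  case (interval I)
  have lower: "eventually (\<lambda>y. a < y) (germ d x) \<or> eventually (\<lambda>y. \<not> a < y) (germ d x)" for a
  proof (cases d)
    case True
    then show ?thesis
      using ex_gt[of x] by (cases "x < a") (auto simp: eventually_germ_True intro: exI[of _ a])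
  next
    case False
    then show ?thesis
      using ex_lt[of x] by (cases "a < x") (auto simp: eventually_germ_False intro: exI[of _ a])
  qed
  have upper: "eventually (\<lambda>y. y < b) (germ d x) \<or> eventually (\<lambda>y. \<not> y < b) (germ d x)" for b
  proof (cases d)
    case True
    then show ?thesis
      using ex_gt[of x] by (cases "x < b") (auto simp: eventually_germ_True intro: exI[of _ b])
  next
    case False
    then show ?thesis
      using ex_lt[of x] by (cases "b < x") (auto simp: eventually_germ_False intro: exI[of _ b])
  qed
  consider "I = UNIV" | a where "I = {a<..}" | b where "I = {..<b}" | a b where "I = {a<..<b}"
    using interval unfolding open_intervals_def by auto
  then show ?case
  proof cases
    case (4 a b)
    show ?thesis
    proof (cases "eventually (\<lambda>y. a < y) (germ d x) \<and> eventually (\<lambda>y. y < b) (germ d x)")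
      case False
      then have "eventually (\<lambda>y. \<not> a < y) (germ d x) \<or> eventually (\<lambda>y. \<not> y < b) (germ d x)"
        using lower[of a] upper[of b] by blast
      then have "eventually (\<lambda>y. y \<notin> I) (germ d x)"
        unfolding 4 by (elim disjE) (erule eventually_mono, simp)+
      then show ?thesis ..
    qed (simp add: 4 eventually_conj_iff)
  next
    case (2 a) then show ?thesis using lower[of a] by simp
  next
    case (3 b) then show ?thesis using upper[of b] by simp
  qed simp
next
  case (union A B)
  show ?case
  proof (cases "eventually (\<lambda>y. y \<notin> A) (germ d x) \<and> eventually (\<lambda>y. y \<notin> B) (germ d x)")
    case False
    then have "eventually (\<lambda>y. y \<in> A) (germ d x) \<or> eventually (\<lambda>y. y \<in> B) (germ d x)"
      using union by blast
    then have "eventually (\<lambda>y. y \<in> A \<union> B) (germ d x)"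
      by (elim disjE) (erule eventually_mono, simp)+
    then show ?thesis ..
  qed (simp add: eventually_conj_iff)
qed simp

lemma germ_dichotomy:
  assumes "dpred M (\<lambda>s. P (s 0))"
  shows "eventually P (germ d x) \<or> eventually (\<lambda>y. \<not> P y) (germ d x)"
  using germ_dichotomy_set[OF dsetI[OF assms], of d x] by simp

lemma dpred_germ:
  assumes P: "dpred M (\<lambda>s. P (s 0) (\<lambda>i. s (Suc i)))" and t: "dterm M t"
  shows "dpred M (\<lambda>s. eventually (\<lambda>y. P y s) (germ d (t s)))"
proof -
  \<comment> \<open>After unfolding, the bound \<open>b\<close> of the one-sided neighbourhood is
    quantified outside of \<open>y\<close>, so it becomes variable 1 and the remaining variables
    move up by two.\<close>
  let ?f = "case_nat 0 (\<lambda>i. Suc (Suc i)) :: nat \<Rightarrow> nat"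
  have "inj ?f"
  proof (rule injI)
    fix x y assume "?f x = ?f y"
    then show "x = y" by (cases x; cases y; simp)
  qed
  from dpred_rename[OF P this] have P2: "dpred M (\<lambda>s. P (s 0) (\<lambda>i. s (Suc (Suc i))))" by simp
  note t2 = dterm_shift[OF t] dterm_shift[OF dterm_shift[OF t]]
  show ?thesis
  proof (cases d)
    case True
    have "dpred M (\<lambda>s. \<exists>b. t s < b \<and> (\<forall>y. t s < y \<and> y < b \<longrightarrow> P y s))"
      by (intro dpred_ex dpred_all dpred_conj dpred_imp dpred_less dterm_var P2 t2)
    with True show ?thesis by (simp add: eventually_germ_True)
  next
    case False
    have "dpred M (\<lambda>s. \<exists>b. b < t s \<and> (\<forall>y. b < y \<and> y < t s \<longrightarrow> P y s))"
      by (intro dpred_ex dpred_all dpred_conj dpred_imp dpred_less dterm_var P2 t2)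
    with False show ?thesis by (simp add: eventually_germ_False)
  qed
qed

section \<open>Uniform parameters, limits and continuity\<close>

lemma subinterval_bounds:
  assumes "(c::'a) < d" "{c<..<d} \<subseteq> {a<..<b}"
  shows "a \<le> c" "d \<le> b"
proof -
  show "a \<le> c"
  proof (rule ccontr)
    assume "\<not> a \<le> c"
    then have "c < min a d" using assms by simp
    then obtain z where "c < z" "z < min a d" using dense by blast
    then show False using assms(2) by (auto simp: subset_iff dest: spec[of _ z])
  qed
  show "d \<le> b"
  proof (rule ccontr)
    assume "\<not> d \<le> b"
    then have "max b c < d" using assms by simp
    then obtain z where "max b c < z" "z < d" using dense by blast
    then show False using assms(2) by (auto simp: subset_iff dest: spec[of _ z])
  qed
qed

text \<open>If all the sets \<open>F u = {x \<in> (a,b). Q x u}\<close> were finite, their maxima would form a cofinal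
  definable subset \<open>B\<close> of \<open>(a,b)\<close>, on which the parameter would have to decrease strictly;
  hence one \<open>F u\<close> would contain an interval.\<close>

lemma uniform_parameter:
  assumes Q: "dpred M (\<lambda>s. Q (s 0) (s 1))" and W: "dset M W" and "a < b"
    and anti: "\<And>x u v. u \<in> W \<Longrightarrow> v \<in> W \<Longrightarrow> v \<le> u \<Longrightarrow> Q x u \<Longrightarrow> Q x v"
    and ex: "\<And>x. a < x \<Longrightarrow> x < b \<Longrightarrow> \<exists>u\<in>W. Q x u"
  obtains c d u where "a \<le> c" "c < d" "d \<le> b" "u \<in> W" "\<And>x. c < x \<Longrightarrow> x < d \<Longrightarrow> Q x u"
proof (rule ccontr)
  note result = that
  assume no: "\<not> thesis"
  define F where "F u = {x. a < x \<and> x < b \<and> Q x u}" for u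
  note Q' = dpred_binary[OF Q]
  have "finite (F u)" if "u \<in> W" for u
  proof (rule ccontr)
    assume "infinite (F u)"
    moreover have "dset M (F u)" unfolding F_def by (intro dsetI dintros Q')
    ultimately obtain c d where cd: "c < d" "{c<..<d} \<subseteq> F u" using infinite_contains_interval by blast
    then have "{c<..<d} \<subseteq> {a<..<b}" by (auto simp: F_def)
    then have "a \<le> c" "d \<le> b" using subinterval_bounds[OF cd(1)] by blast+
    moreover have "Q x u" if "c < x" "x < d" for x using cd(2) that by (auto simp: F_def)
    ultimately have thesis using result cd(1) \<open>u \<in> W\<close> by blast
    then show False using no by simp
  qed
  define B where "B = {x. a < x \<and> x < b \<and> (\<exists>u. u \<in> W \<and> Q x u \<and> (\<forall>y. x < y \<and> y < b \<longrightarrow> \<not> Q y u))}"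
  have "dset M B" unfolding B_def by (intro dsetI dintros Q' dsetD[OF W])
  have above: "\<exists>y\<in>B. x \<le> y" if x: "a < x" "x < b" for x
  proof -
    obtain u where u: "u \<in> W" "Q x u" using ex x by blast
    then have "finite (F u)" "x \<in> F u" using \<open>\<And>u. u \<in> W \<Longrightarrow> finite (F u)\<close> x by (auto simp: F_def)
    define m where "m = Max (F u)"
    have "m \<in> F u" "x \<le> m" unfolding m_def using \<open>finite (F u)\<close> \<open>x \<in> F u\<close> Max_in Max_ge by auto
    moreover have "\<not> Q y u" if "m < y" "y < b" for y
    proof
      assume "Q y u"
      then have "y \<in> F u" using that \<open>m \<in> F u\<close> by (auto simp: F_def)
      then show False using Max_ge[OF \<open>finite (F u)\<close>, of y] that by (simp add: m_def)
    qed
    ultimately have "m \<in> B" using u by (auto simp: B_def F_def)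
    then show ?thesis using \<open>x \<le> m\<close> by blast
  qed
  have "infinite B"
  proof
    assume "finite B"
    moreover have "B \<noteq> {}" using above dense[OF \<open>a < b\<close>] by blast
    ultimately have "Max B \<in> B" by simp
    then have "a < Max B" "Max B < b" by (auto simp: B_def)
    then obtain x where x: "Max B < x" "x < b" using dense by blast
    then have "a < x" using \<open>a < Max B\<close> by (rule_tac less_trans)
    then obtain y where "y \<in> B" "x \<le> y" using above[of x] x by blast
    then show False using x Max_ge[OF \<open>finite B\<close>, of y] by simp
  qed
  then obtain c d where cd: "c < d" "{c<..<d} \<subseteq> B" using infinite_contains_interval \<open>dset M B\<close> by blast
  obtain z where z: "c < z" "z < d" using dense cd by blast
  then have "z \<in> B" using cd by auto
  then obtain u where u: "u \<in> W" "Q z u" "z < b" by (auto simp: B_def)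
  have "{c<..<z} \<subseteq> F u"
  proof
    fix y assume y: "y \<in> {c<..<z}"
    then have "y \<in> B" using cd z by auto
    \<comment> \<open>Here \<open>v\<close> is the parameter that puts \<open>y\<close> into
      \<open>B\<close>, so \<open>Q z v\<close> fails, whereas \<open>Q z u\<close> holds. By
      monotonicity \<open>u < v\<close>, and \<open>Q y v\<close> passes to
      \<open>Q y u\<close>.\<close>
    then obtain v where v: "v \<in> W" "Q y v" "\<not> Q z v" "a < y" using y u(3) by (auto simp: B_def)
    then have "\<not> v \<le> u" using anti u by blast
    then have "Q y u" using anti[of v u y] v u by auto
    then show "y \<in> F u" using v y u(3) by (auto simp: F_def)
  qed
  then have "finite {c<..<z}" using \<open>\<And>u. u \<in> W \<Longrightarrow> finite (F u)\<close> u finite_subset by blast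
  then show False using interval_infinite[OF z(1)] by simp
qed

text \<open>\<open>b\<close> is the lower limit, as \<open>x\<close> runs along the germ, of the
  fibres of \<open>R\<close> within \<open>[lo, hi]\<close>. Working with a relation instead of a
  function avoids choosing values definably. A number between \<open>b\<close> and \<open>v\<close>
  is no eventual lower bound, so by the dichotomy for germs the fibres eventually have points below
  it.\<close>

lemma limit_along_germ:
  assumes R: "dpred M (\<lambda>s. R (s 0) (s 1))"
    and ev: "eventually (\<lambda>x. \<exists>y. lo \<le> y \<and> y \<le> hi \<and> R x y) (germ d p)"
  obtains b where "lo \<le> b" "b \<le> hi"
    "\<And>u v. u < b \<Longrightarrow> b < v \<Longrightarrow> eventually (\<lambda>x. \<exists>y. u < y \<and> y < v \<and> R x y) (germ d p)"
proof -
  note R' = dpred_binary[OF R]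
  define Z where "Z = {v. v \<le> hi \<and> eventually (\<lambda>x. \<forall>y. lo \<le> y \<and> y \<le> hi \<and> R x y \<longrightarrow> v \<le> y) (germ d p)}"
  have "dset M Z" unfolding Z_def
    by (intro dsetI dintros R' dpred_germ)
  obtain x0 y0 where "lo \<le> y0" "y0 \<le> hi" using eventually_germ_ex[OF ev] by blast
  then have "lo \<in> Z" by (auto simp: Z_def)
  have "\<exists>b. (\<forall>x\<in>Z. x \<le> b) \<and> (\<forall>y<b. \<exists>x\<in>Z. y < x)"
  proof (rule sup[OF \<open>dset M Z\<close>])
    show "x \<le> hi" if "x \<in> Z" for x using that by (simp add: Z_def)
  qed (use \<open>lo \<in> Z\<close> in blast)
  then obtain b where b: "\<forall>x\<in>Z. x \<le> b" "\<forall>y<b. \<exists>x\<in>Z. y < x" by blast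
  show thesis
  proof (rule that[of b])
    show "lo \<le> b" using b \<open>lo \<in> Z\<close> by blast
    show "b \<le> hi"
    proof (rule ccontr)
      assume "\<not> b \<le> hi"
      then obtain z where "z \<in> Z" "hi < z" using b(2) by (meson leI)
      then show False by (auto simp: Z_def)
    qed
    fix u v assume uv: "u < b" "b < v"
    obtain w where "w \<in> Z" "u < w" using b uv by blast
    then have lower: "eventually (\<lambda>x. \<forall>y. lo \<le> y \<and> y \<le> hi \<and> R x y \<longrightarrow> u < y) (germ d p)"
      unfolding Z_def by (auto elim!: eventually_mono intro: less_le_trans)
    have upper: "eventually (\<lambda>x. \<exists>y. lo \<le> y \<and> y \<le> hi \<and> R x y \<and> y < v) (germ d p)"
    proof -
      obtain w where w: "b < w" "w < v" using dense uv by blast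
      show ?thesis
      proof (cases "w \<le> hi")
        case True
        have "w \<notin> Z" using b w by auto
        then have "\<not> eventually (\<lambda>x. \<forall>y. lo \<le> y \<and> y \<le> hi \<and> R x y \<longrightarrow> w \<le> y) (germ d p)"
          using True by (auto simp: Z_def)
        moreover have "dpred M (\<lambda>s. \<forall>y. lo \<le> y \<and> y \<le> hi \<and> R (s 0) y \<longrightarrow> w \<le> y)"
          by (intro dintros R')
        ultimately have "eventually (\<lambda>x. \<not> (\<forall>y. lo \<le> y \<and> y \<le> hi \<and> R x y \<longrightarrow> w \<le> y)) (germ d p)"
          using germ_dichotomy[of "\<lambda>x. \<forall>y. lo \<le> y \<and> y \<le> hi \<and> R x y \<longrightarrow> w \<le> y" d p] by blast
        then show ?thesis
          by (rule eventually_mono) (use w in \<open>meson leI less_trans\<close>)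
      next
        case False
        show ?thesis using ev
          by (rule eventually_mono) (use w False in \<open>meson leI le_less_trans less_trans\<close>)
      qed
    qed
    show "eventually (\<lambda>x. \<exists>y. u < y \<and> y < v \<and> R x y) (germ d p)"
      using eventually_conj[OF lower upper] by (rule eventually_mono) blast
  qed
qed

text \<open>Definable connectedness of intervals in the order topology: if membership in
  \<open>G\<close> is locally constant on \<open>[x, x']\<close>, the supremum of the initial
  segments contained in \<open>G\<close> lies in \<open>G\<close> and cannot be smaller than
  \<open>x'\<close>.\<close>

lemma dichotomy_interval:
  assumes "dset M G" "x \<in> G" "x \<le> x'"
    and loc: "\<And>z. x \<le> z \<Longrightarrow> z \<le> x' \<Longrightarrow> \<exists>c d. c < z \<and> z < d \<and> (\<forall>w. c < w \<and> w < d \<and> x \<le> w \<and> w \<le> x' \<longrightarrow> (w \<in> G \<longleftrightarrow> z \<in> G))"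
  shows "x' \<in> G"
proof -
  define S where "S = {z. x \<le> z \<and> z \<le> x' \<and> (\<forall>w. x \<le> w \<and> w \<le> z \<longrightarrow> w \<in> G)}"
  have "dset M S" unfolding S_def by (intro dsetI dintros dsetD[OF assms(1)])
  have "x \<in> S" using assms by (auto simp: S_def)
  have "\<exists>s. (\<forall>z\<in>S. z \<le> s) \<and> (\<forall>y<s. \<exists>z\<in>S. y < z)"
  proof (rule sup[OF \<open>dset M S\<close>])
    show "z \<le> x'" if "z \<in> S" for z using that by (simp add: S_def)
  qed (use \<open>x \<in> S\<close> in blast)
  then obtain s where s: "\<forall>z\<in>S. z \<le> s" "\<forall>y<s. \<exists>z\<in>S. y < z" by blast
  have "x \<le> s" using s \<open>x \<in> S\<close> by blast
  have "s \<le> x'"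
  proof (rule ccontr)
    assume "\<not> s \<le> x'"
    then obtain z where "z \<in> S" "x' < z" using s(2) by (meson leI)
    then show False by (auto simp: S_def)
  qed
  obtain c d where cd: "c < s" "s < d" "\<And>w. c < w \<Longrightarrow> w < d \<Longrightarrow> x \<le> w \<Longrightarrow> w \<le> x' \<Longrightarrow> w \<in> G \<longleftrightarrow> s \<in> G"
    using loc[OF \<open>x \<le> s\<close> \<open>s \<le> x'\<close>] by blast
  obtain z where z: "z \<in> S" "c < z" using s cd by blast
  have "z \<le> s" using z s by blast
  have "s \<in> G" using cd(3)[of z] z cd \<open>z \<le> s\<close> by (auto simp: S_def)
  have below: "w \<in> G" if "x \<le> w" "w \<le> s" for w
  proof (cases "w \<le> z")
    case True then show ?thesis using z that by (auto simp: S_def)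
  next
    case False
    then show ?thesis using cd(3)[of w] that \<open>s \<in> G\<close> z cd(2) \<open>s \<le> x'\<close> by auto
  qed
  have "s = x'"
  proof (rule ccontr)
    assume "s \<noteq> x'"
    then have "s < min d x'" using \<open>s \<le> x'\<close> cd by auto
    then obtain t where t: "s < t" "t < min d x'" using dense by blast
    have "w \<in> G" if "x \<le> w" "w \<le> t" for w
    proof (cases "w \<le> s")
      case False
      then show ?thesis using cd(3)[of w] that t cd(1) \<open>s \<in> G\<close> by auto
    qed (use below that in blast)
    then have "t \<in> S" using t \<open>x \<le> s\<close> by (auto simp: S_def)
    then show False using s t by auto
  qed
  then show ?thesis using \<open>s \<in> G\<close> by simp
qed

text \<open>Continuity for the order topology, written with bounds from M so that the set of
  continuity points of a definable function is visibly definable.\<close>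

definition cont :: "('a \<Rightarrow> 'a) \<Rightarrow> 'a \<Rightarrow> bool" where
  "cont f x \<longleftrightarrow> (\<forall>u v. u < f x \<and> f x < v \<longrightarrow>
     (\<exists>c d. c < x \<and> x < d \<and> (\<forall>y. c < y \<and> y < d \<longrightarrow> u < f y \<and> f y < v)))"

lemma near_add: "b - h < x \<Longrightarrow> y < b + h \<Longrightarrow> y < x + (h + h)" for x :: 'a
  by (metis add.assoc gadd_less_right less_trans og.diff_less_eq)

lemma near_sub: "b - h < x \<Longrightarrow> y < b + h \<Longrightarrow> y - (h + h) < x" for x :: 'a
  by (metis near_add og.diff_less_eq)

text \<open>Suppose that \<open>f\<close> is discontinuous on the whole interval. On a subinterval
  \<open>f\<close> is bounded, and on a smaller one the oscillation at each point is at least a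
  fixed \<open>e\<close>. But the values of \<open>f\<close> have a limit \<open>l\<close> at the
  left end point \<open>a2\<close>, so near \<open>a2\<close> any two of them differ by less than
  \<open>e\<close>.\<close>

lemma continuous_somewhere:
  assumes f: "dterm M (\<lambda>s. f (s 0))" and "a < b"
  shows "\<exists>x. a < x \<and> x < b \<and> cont f x"
proof (rule ccontr)
  assume no: "\<not> ?thesis"
  note f' = dterm_unary[OF f]
  \<comment> \<open>One parameter \<open>B\<close> bounds \<open>f\<close> on both sides, since the
    condition has to persist when the parameter decreases.\<close>
  have "dpred M (\<lambda>s. s 1 \<le> f (s 0) \<and> f (s 0) \<le> - s 1)" by (intro dintros f')
  moreover have "dset M UNIV" by (simp add: dset_def dpred_const)
  ultimately obtain a1 b1 B where 1: "a \<le> a1" "a1 < b1" "b1 \<le> b"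
    "\<And>x. a1 < x \<Longrightarrow> x < b1 \<Longrightarrow> B \<le> f x \<and> f x \<le> - B"
  proof (rule uniform_parameter[OF _ _ \<open>a < b\<close>])
    fix x u v :: 'a assume "v \<le> u" "u \<le> f x \<and> f x \<le> - u"
    then show "v \<le> f x \<and> f x \<le> - v" by (meson og.neg_le_iff_le order_trans)
  next
    fix x
    show "\<exists>u\<in>UNIV. u \<le> f x \<and> f x \<le> - u"
      by (rule bexI[of _ "min (f x) (- f x)"]) (auto simp: min_def og.neg_le_iff_le og.le_minus_iff)
  qed blast
  define Q where "Q x e \<longleftrightarrow> (\<forall>c d. c < x \<and> x < d \<longrightarrow> (\<exists>y. c < y \<and> y < d \<and> \<not> (f x - e < f y \<and> f y < f x + e)))" for x e
  have "dpred M (\<lambda>s. Q (s 0) (s 1))" unfolding Q_def by (intro dintros f')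
  then obtain a2 b2 e where 2: "a1 \<le> a2" "a2 < b2" "b2 \<le> b1" "e \<in> {0<..}"
    "\<And>x. a2 < x \<Longrightarrow> x < b2 \<Longrightarrow> Q x e"
  proof (rule uniform_parameter[OF _ dset_interval(2)[of M 0] 1(2)])
    fix x u v :: 'a assume "v \<le> u" "Q x u"
    have "f x + v \<le> f x + u" "f x - u \<le> f x - v" using \<open>v \<le> u\<close> by (auto simp: og.diff_left_mono)
    then have "\<not> (f x - v < f y \<and> f y < f x + v)" if "\<not> (f x - u < f y \<and> f y < f x + u)" for y
      using that by (meson le_less_trans less_le_trans)
    with \<open>Q x u\<close> show "Q x v" unfolding Q_def by blast
  next
    fix x assume "a1 < x" "x < b1"
    then have "\<not> cont f x" using no 1 by (meson le_less_trans less_le_trans)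
    then obtain u v where uv: "u < f x" "f x < v"
      "\<And>c d. c < x \<Longrightarrow> x < d \<Longrightarrow> \<exists>y. c < y \<and> y < d \<and> \<not> (u < f y \<and> f y < v)"
      unfolding cont_def by blast
    define e where "e = min (f x - u) (v - f x)"
    have "e > 0" using uv by (simp add: e_def og.diff_gt_0_iff_gt)
    have "e \<le> f x - u" "e \<le> v - f x" by (auto simp: e_def)
    then have "u \<le> f x - e" "f x + e \<le> v" by (metis og.le_diff_eq add.commute og.add.commute)+
    then have "Q x e" unfolding Q_def using uv(3) by (meson le_less_trans less_le_trans)
    then show "\<exists>u\<in>{0<..}. Q x u" using \<open>e > 0\<close> by auto
  qed blast
  obtain h where h: "h > 0" "h + h = e" using half_pos 2 by auto
  have "dpred M (\<lambda>s. s 1 = f (s 0))" by (intro dintros f')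
  moreover have "eventually (\<lambda>x. \<exists>y. B \<le> y \<and> y \<le> - B \<and> y = f x) (germ True a2)"
    unfolding eventually_germ_True using 1 2 by (intro exI[of _ b2]) auto
  ultimately obtain l where l: "\<And>u v. u < l \<Longrightarrow> l < v \<Longrightarrow> eventually (\<lambda>x. \<exists>y. u < y \<and> y < v \<and> y = f x) (germ True a2)"
    by (rule limit_along_germ) blast
  have "l - h < l" "l < l + h" using h og.diff_less_eq by auto
  from l[OF this] obtain t where t: "a2 < t" "\<And>x. a2 < x \<Longrightarrow> x < t \<Longrightarrow> l - h < f x \<and> f x < l + h"
    unfolding eventually_germ_True by auto
  obtain x where x: "a2 < x" "x < min t b2" using dense[of a2 "min t b2"] t 2 by auto
  then have "Q x e" using 2 by auto
  then obtain y where y: "a2 < y" "y < t" "\<not> (f x - e < f y \<and> f y < f x + e)"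
    unfolding Q_def using x by (metis min_less_iff_conj)
  have "f y < f x + e" "f x - e < f y" using near_add near_sub t(2)[of x] t(2)[of y] x y h(2) by auto
  then show False using y by blast
qed

lemma continuous_cofinite:
  assumes f: "dterm M (\<lambda>s. f (s 0))"
  shows "finite {x. \<not> cont f x}"
proof (rule finite_if_no_interval)
  show "dset M {x. \<not> cont f x}" unfolding cont_def
    by (intro dsetI dintros dterm_unary[OF f])
  show "\<exists>x. a < x \<and> x < b \<and> x \<notin> {x. \<not> cont f x}" if "a < b" for a b
    using continuous_somewhere[OF f that] by auto
qed

end

section \<open>Plane sets without interior\<close>

context omin
begin

text \<open>Infinite fibres contain intervals. On a subinterval \<open>(p, q)\<close> these can be
  taken to have a common length \<open>e\<close>; their left end points accumulate at some
  \<open>l\<close> as \<open>x\<close> approaches \<open>p\<close> from the right. Windows of length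
  \<open>e\<close> that start within less than \<open>e\<close> of each other overlap in a common
  interval, and this gives the rectangle.\<close>

lemma box_if_infinite_fibres:
  assumes A: "dpred M (\<lambda>s. A (s 0) (s 1))" and bnd: "\<And>x y. A x y \<Longrightarrow> lo \<le> y \<and> y \<le> hi"
    and inf: "infinite {x. infinite {y. A x y}}"
  shows "\<exists>a b c d. a < b \<and> c < d \<and> (\<forall>x y. a < x \<and> x < b \<and> c < y \<and> y < d \<longrightarrow> A x y)"
proof -
  note A' = dpred_binary[OF A]
  define I where "I = {x. \<exists>c d. c < d \<and> (\<forall>y. c < y \<and> y < d \<longrightarrow> A x y)}"
  have "dset M I" unfolding I_def by (intro dsetI dintros A')
  have "{x. infinite {y. A x y}} \<subseteq> I"
  proof
    fix x assume "x \<in> {x. infinite {y. A x y}}"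
    moreover have "dset M {y. A x y}" by (intro dsetI dintros A')
    ultimately obtain c d where "c < d" "{c<..<d} \<subseteq> {y. A x y}" using infinite_contains_interval by blast
    then have "c < d \<and> (\<forall>y. c < y \<and> y < d \<longrightarrow> A x y)" by auto
    then show "x \<in> I" unfolding I_def by blast
  qed
  then have "infinite I" using inf finite_subset by blast
  then obtain a b where ab: "a < b" "{a<..<b} \<subseteq> I" using infinite_contains_interval \<open>dset M I\<close> by blast
  define Q where "Q x e \<longleftrightarrow> (\<exists>y. \<forall>w. y < w \<and> w < y + e \<longrightarrow> A x w)" for x e
  have "dpred M (\<lambda>s. Q (s 0) (s 1))" unfolding Q_def by (intro dintros A')
  then obtain p q e where pq: "a \<le> p" "p < q" "q \<le> b" "e \<in> {0<..}" "\<And>x. p < x \<Longrightarrow> x < q \<Longrightarrow> Q x e"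
  proof (rule uniform_parameter[OF _ dset_interval(2)[of M 0] ab(1)])
    fix x u v :: 'a assume "v \<le> u" "Q x u"
    have "y + v \<le> y + u" for y using \<open>v \<le> u\<close> by simp
    with \<open>Q x u\<close> show "Q x v" unfolding Q_def by (meson less_le_trans)
  next
    fix x assume "a < x" "x < b"
    then have "x \<in> I" using ab by auto
    then obtain c d where cd: "c < d" "\<And>y. c < y \<Longrightarrow> y < d \<Longrightarrow> A x y" by (auto simp: I_def)
    have "c + (d - c) = d" by (metis og.add.commute og.diff_add_cancel)
    then have "Q x (d - c)" unfolding Q_def using cd by (intro exI[of _ c]) auto
    moreover have "d - c > 0" using cd by (simp add: og.diff_gt_0_iff_gt)
    ultimately show "\<exists>u\<in>{0<..}. Q x u" by auto
  qed blast
  define R where "R x y \<longleftrightarrow> (\<forall>w. y < w \<and> w < y + e \<longrightarrow> A x w)" for x y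
  have "dpred M (\<lambda>s. R (s 0) (s 1))" unfolding R_def by (intro dintros A')
  \<comment> \<open>The window lies in the bounded fibre, but its excluded left end point
    \<open>y\<close> need not; the crude lower bound \<open>lo - e\<close> is enough for the
    limit.\<close>
  moreover have "eventually (\<lambda>x. \<exists>y. lo - e \<le> y \<and> y \<le> hi \<and> R x y) (germ True p)"
    unfolding eventually_germ_True
  proof (rule exI[of _ q], rule conjI, simp add: pq(2), intro allI impI)
    fix x assume "p < x \<and> x < q"
    then obtain y where y: "R x y" using pq(5) unfolding Q_def R_def by blast
    have "y < y + e" using pq(4) gadd_less_left[of y 0 e] by simp
    then obtain w where w: "y < w" "w < y + e" using dense by blast
    then have "lo \<le> w" "w \<le> hi" using y bnd unfolding R_def by blast+
    then have "lo < y + e" "y \<le> hi" using w by auto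
    then show "\<exists>y. lo - e \<le> y \<and> y \<le> hi \<and> R x y"
      using y by (intro exI[of _ y]) (simp add: og.diff_le_eq)
  qed
  ultimately obtain l where l: "\<And>u v. u < l \<Longrightarrow> l < v \<Longrightarrow> eventually (\<lambda>x. \<exists>y. u < y \<and> y < v \<and> R x y) (germ True p)"
    by (rule limit_along_germ) blast
  obtain h where h: "h > 0" "h + h = e" using half_pos pq by auto
  \<comment> \<open>With \<open>u = l - h\<close>, half a window length below \<open>l\<close>, the
    window that starts at \<open>u\<close> still reaches beyond \<open>l\<close> and leaves room for
    \<open>v\<close>.\<close>
  obtain u where u: "u < l" "l < u + e"
  proof (rule that[of "l - h"])
    show "l - h < l" using h by (simp add: og.diff_less_eq)
    have "l - h + e = l + h" using h(2) by (metis og.add_diff_eq og.diff_add_cancel add.assoc)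
    then show "l < l - h + e" using h gadd_less_left[of l 0 h] by simp
  qed
  then obtain v where v: "l < v" "v < u + e" using dense by blast
  from l[OF u(1) v(1)] obtain t where t: "p < t" "\<And>x. p < x \<Longrightarrow> x < t \<Longrightarrow> \<exists>y. u < y \<and> y < v \<and> R x y"
    unfolding eventually_germ_True by auto
  have "A x w" if "p < x" "x < t" "v < w" "w < u + e" for x w
  proof -
    obtain y where y: "u < y" "y < v" "R x y" using t(2) \<open>p < x\<close> \<open>x < t\<close> by blast
    have "u + e < y + e" using y by simp
    then show ?thesis using y that unfolding R_def by (meson less_trans)
  qed
  then show ?thesis using t(1) v(2) by blast
qed

text \<open>Distances of at least \<open>h + h\<close> within \<open>A\<close> force distinct points
  of \<open>A\<close> to have distinct partners within distance \<open>h\<close> in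
  \<open>B\<close>.\<close>

lemma card_le_of_close:
  assumes fin: "finite A" "finite B" and gap: "\<And>y y'. y \<in> A \<Longrightarrow> y' \<in> A \<Longrightarrow> y < y' \<Longrightarrow> y + (h + h) \<le> (y' :: 'a)"
    and close: "\<And>y. y \<in> A \<Longrightarrow> \<exists>y'\<in>B. y - h < y' \<and> y' < y + h"
  obtains f where "inj_on f A" "f ` A \<subseteq> B" "\<And>y. y \<in> A \<Longrightarrow> y - h < f y \<and> f y < y + h"
proof -
  obtain f where f: "\<And>y. y \<in> A \<Longrightarrow> f y \<in> B \<and> y - h < f y \<and> f y < y + h"
    using close by metis
  have ne: "f y \<noteq> f y'" if "y \<in> A" "y' \<in> A" "y < y'" for y y'
  proof
    assume "f y = f y'"
    then have "y' - h < y + h" using f[of y] f[of y'] that by auto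
    then have "y' < y + (h + h)" by (simp add: og.diff_less_eq add.assoc)
    then show False using gap[of y y'] that by auto
  qed
  have "inj_on f A"
    by (rule inj_onI) (metis ne linorder_less_linear)
  then show thesis using that f by blast
qed

lemma finite_gap:
  assumes "finite (A :: 'a set)"
  shows "\<exists>e>0. \<forall>y\<in>A. \<forall>y'\<in>A. y < y' \<longrightarrow> y + e \<le> y'"
proof -
  obtain e0 :: 'a where "e0 > 0" using ex_pos by blast
  define D where "D = insert e0 ((\<lambda>(y, y'). y' - y) ` {(y, y') \<in> A \<times> A. y < y'})"
  have "finite {(y, y') \<in> A \<times> A. y < y'}" using assms by (auto intro: finite_subset[of _ "A \<times> A"])
  then have "finite D" "D \<noteq> {}" unfolding D_def by (blast intro: finite_imageI finite.insertI)+
  have "Min D \<in> D" by (rule Min_in) fact+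
  moreover have "x > 0" if "x \<in> D" for x using that \<open>e0 > 0\<close> unfolding D_def by (auto simp: og.diff_gt_0_iff_gt)
  ultimately have "Min D > 0" by blast
  moreover have "y + Min D \<le> y'" if "y \<in> A" "y' \<in> A" "y < y'" for y y'
  proof -
    have "Min D \<le> y' - y" by (rule Min_le[OF \<open>finite D\<close>]) (use that in \<open>auto simp: D_def\<close>)
    then show ?thesis by (simp add: og.le_diff_eq og.add.commute)
  qed
  ultimately show ?thesis by blast
qed

text \<open>In a finite fibre this removes the least point and so lowers the cardinality by one.
  Iteration makes the cardinality of a fibre definable and allows induction on it.\<close>

definition peel :: "('a \<Rightarrow> 'a \<Rightarrow> bool) \<Rightarrow> 'a \<Rightarrow> 'a \<Rightarrow> bool" where
  "peel A x y \<longleftrightarrow> A x y \<and> (\<exists>y'. y' < y \<and> A x y')"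

lemma dpred_peel:
  assumes "dpred M (\<lambda>s. A (s 0) (s 1))"
  shows "dpred M (\<lambda>s. peel A (s 0) (s 1))"
  unfolding peel_def by (intro dintros dpred_binary[OF assms])

lemma card_peel:
  assumes "finite {y. A x y}"
  shows "card {y. peel A x y} = card {y. A x y} - 1"
proof (cases "{y. A x y} = {}")
  case True
  then have "{y. peel A x y} = {}" by (auto simp: peel_def)
  with True show ?thesis by simp
next
  case False
  define m where "m = Min {y. A x y}"
  have m: "A x m" "\<And>y. A x y \<Longrightarrow> m \<le> y" using assms False Min_in[of "{y. A x y}"] by (auto simp: m_def)
  then have "peel A x y \<longleftrightarrow> A x y \<and> y \<noteq> m" for y
    unfolding peel_def by (metis order.strict_iff_order leD)
  then have "{y. peel A x y} = {y. A x y} - {m}" by auto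
  then show ?thesis using m(1) assms by simp
qed

lemma dset_card_greater:
  assumes "dpred M (\<lambda>s. A (s 0) (s 1))" "\<And>x. finite {y. A x y}"
  shows "dset M {x. card {y. A x y} > k}"
  using assms
proof (induction k arbitrary: A)
  case 0
  have "dset M {x. \<exists>y. A x y}" by (intro dsetI dintros dpred_binary[OF 0(1)])
  moreover have "{x. \<exists>y. A x y} = {x. card {y. A x y} > 0}"
    using 0(2) by (auto simp: card_gt_0_iff)
  ultimately show ?case by simp
next
  case (Suc k)
  have "finite {y. peel A x y}" for x
    by (rule finite_subset[OF _ Suc.prems(2)[of x]]) (auto simp: peel_def)
  then have "dset M {x. card {y. peel A x y} > k}"
    by (intro Suc.IH dpred_peel Suc.prems)
  then show ?case using card_peel[OF Suc.prems(2)] by (simp add: less_diff_conv)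
qed

text \<open>Near a point with property \<open>H\<close> the fibres of \<open>A\<close> are in bijection by proximity, so that
  their cardinality is locally constant there; and \<open>H\<close> fails only finitely often.\<close>

lemma uniform_finiteness:
  assumes A: "dpred M (\<lambda>s. A (s 0) (s 1))" and bnd: "\<And>x y. A x y \<Longrightarrow> lo \<le> y \<and> y \<le> hi"
    and fin: "\<And>x. finite {y. A x y}"
  shows "\<exists>N. \<forall>x. card {y. A x y} \<le> N"
proof -
  note A' = dpred_binary[OF A]
  define G where "G x e \<longleftrightarrow> (\<forall>y y'. A x y \<and> A x y' \<and> y < y' \<longrightarrow> y + e \<le> y')" for x e
  have Gd: "dpred M (\<lambda>s. G (s 0) (s 1))" unfolding G_def by (intro dintros A')
  note G' = dpred_binary[OF Gd]
  define T where "T h x x' \<longleftrightarrow> (\<forall>y. A x y \<longrightarrow> (\<exists>y'. A x' y' \<and> y - h < y' \<and> y' < y + h))" for h x x'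
  \<comment> \<open>The gaps are twice the radius \<open>h\<close> of proximity, as
    \<open>card_le_of_close\<close> requires, and \<open>T\<close> is demanded in both directions,
    so that fibres near \<open>a\<close> inject into each other.\<close>
  define H where "H a \<longleftrightarrow> (\<exists>c d h. c < a \<and> a < d \<and> 0 < h \<and> (\<forall>x. c < x \<and> x < d \<longrightarrow> G x (h + h)) \<and>
     (\<forall>x x'. c < x \<and> x < d \<and> c < x' \<and> x' < d \<longrightarrow> T h x x'))" for a
  have Hd: "dpred M (\<lambda>s. H (s 0))" unfolding H_def T_def by (intro dintros A' G')
  have inj: "\<exists>f. inj_on f {y. A x y} \<and> f ` {y. A x y} \<subseteq> {y. A x' y} \<and> (\<forall>y. A x y \<longrightarrow> y - h < f y \<and> f y < y + h)"
    if g: "G x (h + h)" and t: "T h x x'" for h x x'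
  proof -
    obtain f where "inj_on f {y. A x y}" "f ` {y. A x y} \<subseteq> {y. A x' y}"
      "\<And>y. y \<in> {y. A x y} \<Longrightarrow> y - h < f y \<and> f y < y + h"
    proof (rule card_le_of_close[OF fin[of x] fin[of x'], of h])
      show "y + (h + h) \<le> y'" if "y \<in> {y. A x y}" "y' \<in> {y. A x y}" "y < y'" for y y'
        using g that by (auto simp: G_def)
      show "\<exists>y'\<in>{y. A x' y}. y - h < y' \<and> y' < y + h" if "y \<in> {y. A x y}" for y
        using t that by (auto simp: T_def)
    qed blast
    then show ?thesis by (intro exI[of _ f]) auto
  qed
  have card_le: "card {y. A x y} \<le> card {y. A x' y}" if "G x (h + h)" "T h x x'" for h x x'
    using inj[OF that] card_inj_on_le[OF _ _ fin] by blast
  have "finite {x. \<not> H x}"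
  proof (rule finite_if_no_interval)
    show "dset M {x. \<not> H x}" by (intro dsetI dpred_neg Hd)
    fix a b :: 'a assume "a < b"
    obtain p q e where pq: "a \<le> p" "p < q" "q \<le> b" "e \<in> {0<..}" "\<And>x. p < x \<Longrightarrow> x < q \<Longrightarrow> G x e"
    proof (rule uniform_parameter[OF Gd dset_interval(2)[of M 0] \<open>a < b\<close>])
      fix x u v :: 'a assume "v \<le> u" "G x u"
      have "y + v \<le> y + u" for y using \<open>v \<le> u\<close> by simp
      with \<open>G x u\<close> show "G x v" unfolding G_def by (meson order_trans)
    next
      fix x show "\<exists>u\<in>{0<..}. G x u"
        using finite_gap[OF fin[of x]] unfolding G_def by auto
    qed blast
    obtain h where h: "h > 0" "h + h = e" using half_pos pq by auto
    obtain k where k: "k > 0" "k + k = h" using half_pos h by auto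
    \<comment> \<open>\<open>R\<close> collects the points of the fibre over \<open>x\<close> that
      have no partner over some \<open>x'\<close> between \<open>p\<close> and \<open>x\<close>. If
      every \<open>x\<close> near \<open>p\<close> had such a point, these points would accumulate
      at some \<open>l\<close>; those over \<open>x\<close> and over \<open>x'\<close> would both be
      within \<open>k\<close> of \<open>l\<close>, hence within \<open>k + k = h\<close> of each
      other.\<close>
    define R where "R x y \<longleftrightarrow> A x y \<and> (\<exists>x'. p < x' \<and> x' < x \<and> (\<forall>y'. A x' y' \<longrightarrow> \<not> (y - h < y' \<and> y' < y + h)))" for x y
    have Rd: "dpred M (\<lambda>s. R (s 0) (s 1))" unfolding R_def by (intro dintros A')
    have "\<not> eventually (\<lambda>x. \<exists>y. R x y) (germ True p)"
    proof
      assume "eventually (\<lambda>x. \<exists>y. R x y) (germ True p)"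
      then have "eventually (\<lambda>x. \<exists>y. lo \<le> y \<and> y \<le> hi \<and> R x y) (germ True p)"
        by (rule eventually_mono) (use bnd R_def in blast)
      with Rd obtain l where l: "\<And>u v. u < l \<Longrightarrow> l < v \<Longrightarrow> eventually (\<lambda>x. \<exists>y. u < y \<and> y < v \<and> R x y) (germ True p)"
        by (rule limit_along_germ) blast
      have "l - k < l" "l < l + k" using k og.diff_less_eq by auto
      from l[OF this] obtain t where t: "p < t" "\<And>x. p < x \<Longrightarrow> x < t \<Longrightarrow> \<exists>y. l - k < y \<and> y < l + k \<and> R x y"
        unfolding eventually_germ_True by auto
      obtain x where x: "p < x" "x < t" using dense t by blast
      then obtain y where y: "l - k < y" "y < l + k" "R x y" using t by blast
      then obtain x' where x': "p < x'" "x' < x" "\<And>y'. A x' y' \<Longrightarrow> \<not> (y - h < y' \<and> y' < y + h)"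
        unfolding R_def by blast
      then obtain y' where y': "l - k < y'" "y' < l + k" "R x' y'" using t(2)[OF _ less_trans] x by blast
      have "y - h < y' \<and> y' < y + h" using near_add near_sub y y' k by metis
      then show False using x'(3)[of y'] y'(3) by (simp add: R_def)
    qed
    moreover have "dpred M (\<lambda>s. \<exists>y. R (s 0) y)" by (intro dintros dpred_binary[OF Rd])
    ultimately have "eventually (\<lambda>x. \<not> (\<exists>y. R x y)) (germ True p)"
      using germ_dichotomy[of "\<lambda>x. \<exists>y. R x y" True p] by blast
    then obtain t0 where t0: "p < t0" "\<And>x y. p < x \<Longrightarrow> x < t0 \<Longrightarrow> \<not> R x y"
      unfolding eventually_germ_True by auto
    define t where "t = min t0 q"
    have "p < t" "t \<le> q" using t0 pq by (auto simp: t_def)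
    have close_left: "T h x x'" if "p < x'" "x' < x" "x < t" for x x'
      unfolding T_def
    proof (intro allI impI)
      fix y assume "A x y"
      then show "\<exists>y'. A x' y' \<and> y - h < y' \<and> y' < y + h"
        using t0(2)[of x y] that unfolding R_def t_def by auto
    qed
    have gap: "G x (h + h)" if "p < x" "x < t" for x
      using pq(5)[of x] that h \<open>t \<le> q\<close> by auto
    obtain z where "p < z \<and> z < t" using dense \<open>p < t\<close> by blast
    \<comment> \<open>To the left of a point the fibres are at least as large as over it. Beyond an
      \<open>x0\<close> with a smallest fibre the cardinality is therefore constant, the injections
      are bijections, and proximity holds in both directions.\<close>
    then obtain x0 where x0: "p < x0 \<and> x0 < t"
      and least: "\<And>x. p < x \<and> x < t \<Longrightarrow> card {y. A x0 y} \<le> card {y. A x y}"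
      using ex_has_least_nat[of "\<lambda>x. p < x \<and> x < t" z "\<lambda>x. card {y. A x y}"] by blast
    have const: "card {y. A x y} = card {y. A x0 y}" if "x0 < x" "x < t" for x
    proof (rule antisym)
      show "card {y. A x y} \<le> card {y. A x0 y}"
        using card_le[OF gap[of x] close_left[of x0 x]] that x0 by auto
      show "card {y. A x0 y} \<le> card {y. A x y}" using least[of x] that x0 by auto
    qed
    have TT: "T h x x'" if "x0 < x" "x < t" "x0 < x'" "x' < t" for x x'
    proof (cases x x' rule: linorder_cases)
      case greater then show ?thesis using close_left that x0 by (meson less_trans)
    next
      case equal
      have "y - h < y" "y < y + h" for y using h og.diff_less_eq by auto
      then show ?thesis using equal by (auto simp: T_def)
    next
      case less
      have "p < x'" "p < x" using x0 that by auto
      note gap[OF \<open>p < x'\<close> \<open>x' < t\<close>] close_left[OF \<open>p < x\<close> less \<open>x' < t\<close>]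
      from inj[OF this] obtain f where f: "inj_on f {y. A x' y}" "f ` {y. A x' y} \<subseteq> {y. A x y}"
        "\<forall>y. A x' y \<longrightarrow> y - h < f y \<and> f y < y + h" by (elim exE conjE) (rule that)
      then have "f ` {y. A x' y} = {y. A x y}"
        using fin const[of x] const[of x'] that by (intro card_subset_eq) (auto simp: card_image)
      show ?thesis unfolding T_def
      proof (intro allI impI)
        fix y assume "A x y"
        then obtain y' where y': "A x' y'" "y = f y'" using \<open>f ` {y. A x' y} = {y. A x y}\<close> by blast
        then have "y' - h < y" "y < y' + h" using f by auto
        then have "y - h < y'" "y' < y + h" by (simp_all add: og.diff_less_eq)
        then show "\<exists>y'. A x' y' \<and> y - h < y' \<and> y' < y + h" using y' by blast
      qed
    qed
    obtain x where x: "x0 < x" "x < t" using dense x0 by blast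
    have "\<forall>x. x0 < x \<and> x < t \<longrightarrow> G x (h + h)" using gap x0 less_trans by blast
    then have "H x" unfolding H_def using x h(1) TT by blast
    then show "\<exists>x. a < x \<and> x < b \<and> x \<notin> {x. \<not> H x}"
      using x x0 pq \<open>t \<le> q\<close> by (intro exI[of _ x]) auto
  qed
  define E where "E = {x. \<not> H x}"
  have "finite E" using \<open>finite {x. \<not> H x}\<close> by (simp add: E_def)
  \<comment> \<open>On an interval free of \<open>E\<close> the set where the cardinality exceeds
    \<open>k\<close> is locally constant, so \<open>dichotomy_interval\<close> applies to it or to
    its complement.\<close>
  have step: "card {y. A x' y} > k \<longleftrightarrow> card {y. A x y} > k"
    if "x \<le> x'" "\<And>z. x \<le> z \<Longrightarrow> z \<le> x' \<Longrightarrow> z \<notin> E" for x x' k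
  proof -
    define S where "S = {x. card {y. A x y} > k}"
    have "dset M S" unfolding S_def by (rule dset_card_greater[OF A fin])
    have loc: "\<exists>c d. c < z \<and> z < d \<and> (\<forall>w. c < w \<and> w < d \<and> x \<le> w \<and> w \<le> x' \<longrightarrow> (w \<in> S \<longleftrightarrow> z \<in> S))"
      if z: "x \<le> z" "z \<le> x'" for z
    proof -
      have "H z" using \<open>\<And>z. x \<le> z \<Longrightarrow> z \<le> x' \<Longrightarrow> z \<notin> E\<close>[OF z] by (simp add: E_def)
      then obtain c d h where cd: "c < z" "z < d" "0 < h" "\<forall>x. c < x \<and> x < d \<longrightarrow> G x (h + h)"
        "\<forall>x x'. c < x \<and> x < d \<and> c < x' \<and> x' < d \<longrightarrow> T h x x'"
        unfolding H_def by (elim exE conjE) (rule that)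
      have "card {y. A w y} = card {y. A z y}" if "c < w" "w < d" for w
        using card_le[of w h z] card_le[of z h w] that cd by (intro antisym) simp_all
      then have "\<forall>w. c < w \<and> w < d \<and> x \<le> w \<and> w \<le> x' \<longrightarrow> (w \<in> S \<longleftrightarrow> z \<in> S)" by (simp add: S_def)
      with cd(1,2) show ?thesis by blast
    qed
    show ?thesis
    proof (cases "x \<in> S")
      case True
      then have "x' \<in> S" by (rule dichotomy_interval[OF \<open>dset M S\<close> _ \<open>x \<le> x'\<close> loc])
      with True show ?thesis by (simp add: S_def)
    next
      case False
      have "dset M (- S)" using \<open>dset M S\<close> unfolding dset_def Compl_iff by (rule dpred_neg)
      then have "x' \<in> - S"
        by (rule dichotomy_interval[OF _ _ \<open>x \<le> x'\<close>]) (use False loc in auto)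
      with False show ?thesis by (simp add: S_def)
    qed
  qed
  have same: "card {y. A x y} = card {y. A x' y}"
    if "x \<notin> E" "x' \<notin> E" "{e\<in>E. e < x} = {e\<in>E. e < x'}" "x \<le> x'" for x x'
  proof -
    have "z \<notin> E" if z: "x \<le> z" "z \<le> x'" for z
    proof
      assume "z \<in> E"
      then have "z \<noteq> x" "z \<noteq> x'" using that \<open>x \<notin> E\<close> \<open>x' \<notin> E\<close> by auto
      then have "z \<in> {e\<in>E. e < x'}" "z \<notin> {e\<in>E. e < x}" using z \<open>z \<in> E\<close> by auto
      then show False using \<open>{e\<in>E. e < x} = {e\<in>E. e < x'}\<close> by blast
    qed
    from step[OF \<open>x \<le> x'\<close> this] show ?thesis by (metis linorder_less_linear less_irrefl)
  qed
  \<comment> \<open>Outside of \<open>E\<close> the cardinality depends only on which points of the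
    finite set \<open>E\<close> lie below \<open>x\<close>; \<open>r\<close> picks a representative
    for each such subset.\<close>
  have "finite ((\<lambda>x. card {y. A x y}) ` (- E))"
  proof -
    define r where "r S = (SOME x. x \<notin> E \<and> {e\<in>E. e < x} = S)" for S
    have "(\<lambda>x. card {y. A x y}) ` (- E) \<subseteq> (\<lambda>S. card {y. A (r S) y}) ` Pow E"
    proof safe
      fix x assume "x \<notin> E"
      let ?S = "{e\<in>E. e < x}"
      have "r ?S \<notin> E \<and> {e\<in>E. e < r ?S} = ?S"
        unfolding r_def by (rule someI[of _ x]) (use \<open>x \<notin> E\<close> in auto)
      then have "card {y. A x y} = card {y. A (r ?S) y}"
        using same[of x "r ?S"] same[of "r ?S" x] \<open>x \<notin> E\<close> by (metis linear)
      then show "card {y. A x y} \<in> (\<lambda>S. card {y. A (r S) y}) ` Pow E" by auto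
    qed
    then show ?thesis using \<open>finite E\<close> finite_subset by blast
  qed
  moreover have "finite ((\<lambda>x. card {y. A x y}) ` E)" using \<open>finite E\<close> by simp
  ultimately have "finite ((\<lambda>x. card {y. A x y}) ` (- E) \<union> (\<lambda>x. card {y. A x y}) ` E)" by (rule finite_UnI)
  moreover have "(\<lambda>x. card {y. A x y}) ` (- E) \<union> (\<lambda>x. card {y. A x y}) ` E = range (\<lambda>x. card {y. A x y})"
    by auto
  ultimately obtain N where "\<forall>n \<in> range (\<lambda>x. card {y. A x y}). n \<le> N"
    using finite_nat_set_iff_bounded_le by auto
  then show ?thesis by blast
qed

end

section \<open>One-dimensional sets embed definably in the line\<close>

lemma dpred_mem:
  assumes "definable M n X" "\<And>i. dterm M (t i)"
  shows "dpred M (\<lambda>s. restrict (\<lambda>i. t i s) {..<n} \<in> X)"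
proof (rule dpred_comp[where P = "\<lambda>s. restrict s {..<n} \<in> X"])
  show "dpred M (\<lambda>s. restrict s {..<n} \<in> X)" using assms(1) by (simp add: definable_iff_dpred)
qed (rule assms(2))

section \<open>Injections of plane sets into the line\<close>

context omin
begin

text \<open>The inductive step of the embedding into the line. \<open>G\<close> is total, so that it
  is a definable term, but injective only on \<open>A\<close>; its bounds leave room to place
  another image beside that of \<open>A\<close>.\<close>

definition plane_thin :: "('a \<Rightarrow> 'a \<Rightarrow> bool) \<Rightarrow> bool" where
  "plane_thin A \<longleftrightarrow> (\<exists>G a b. dterm M (\<lambda>s. G (s 0) (s 1)) \<and>
     (\<forall>x y x' y'. A x y \<and> A x' y' \<and> G x y = G x' y' \<longrightarrow> x = x' \<and> y = y') \<and>
     (\<forall>x y. A x y \<longrightarrow> a \<le> G x y \<and> G x y \<le> b))"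

lemma plane_thin_mono:
  assumes "plane_thin A" and BA: "\<And>x y. B x y \<Longrightarrow> A x y"
  shows "plane_thin B"
proof -
  obtain G a b where G: "dterm M (\<lambda>s. G (s 0) (s 1))"
    "\<forall>x y x' y'. A x y \<and> A x' y' \<and> G x y = G x' y' \<longrightarrow> x = x' \<and> y = y'"
    "\<forall>x y. A x y \<longrightarrow> a \<le> G x y \<and> G x y \<le> b"
    using assms(1) unfolding plane_thin_def by (elim exE conjE) (rule that)
  have "\<forall>x y x' y'. B x y \<and> B x' y' \<and> G x y = G x' y' \<longrightarrow> x = x' \<and> y = y'"
    using G(2) BA by blast
  moreover have "\<forall>x y. B x y \<longrightarrow> a \<le> G x y \<and> G x y \<le> b" using G(3) BA by blast
  ultimately show ?thesis unfolding plane_thin_def using G(1) by (intro exI conjI)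
qed

text \<open>The image of \<open>B\<close> is translated by \<open>k\<close> past the bound
  \<open>b\<close> of the image of \<open>A\<close>. Definability of \<open>A\<close> permits the
  distinction of cases in \<open>F\<close>.\<close>

lemma plane_thin_Un:
  assumes "plane_thin A" "plane_thin B" and A: "dpred M (\<lambda>s. A (s 0) (s 1))"
  shows "plane_thin (\<lambda>x y. A x y \<or> B x y)"
proof -
  obtain G a b where G: "dterm M (\<lambda>s. G (s 0) (s 1))"
    "\<forall>x y x' y'. A x y \<and> A x' y' \<and> G x y = G x' y' \<longrightarrow> x = x' \<and> y = y'"
    "\<forall>x y. A x y \<longrightarrow> a \<le> G x y \<and> G x y \<le> b"
    using assms(1) unfolding plane_thin_def by (elim exE conjE) (rule that)
  obtain H c d where H: "dterm M (\<lambda>s. H (s 0) (s 1))"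
    "\<forall>x y x' y'. B x y \<and> B x' y' \<and> H x y = H x' y' \<longrightarrow> x = x' \<and> y = y'"
    "\<forall>x y. B x y \<longrightarrow> c \<le> H x y \<and> H x y \<le> d"
    using assms(2) unfolding plane_thin_def by (elim exE conjE) (rule that)
  obtain k where "b - c < k" using ex_gt by blast
  then have k: "b < c + k" by (simp add: og.diff_less_eq og.add.commute)
  define F where "F x y = (if A x y then G x y else H x y + k)" for x y
  have F: "dterm M (\<lambda>s. F (s 0) (s 1))"
    unfolding F_def by (intro dterm_if A G(1) dterm_plus H(1) dterm_const)
  have lower: "b < H x y + k" if "B x y" for x y
  proof -
    have "c + k \<le> H x y + k" using H(3) that by simp
    then show ?thesis using k by (rule less_le_trans[rotated])
  qed
  have upper: "H x y + k \<le> d + k" if "B x y" for x y using H(3) that by simp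
  show ?thesis
    unfolding plane_thin_def
  proof (intro exI conjI allI impI)
    show "dterm M (\<lambda>s. F (s 0) (s 1))" by (rule F)
    fix x y
    assume xy: "A x y \<or> B x y"
    show "min a b \<le> F x y"
      using G(3) lower[of x y] xy by (cases "A x y") (auto simp: F_def min_le_iff_disj)
    show "F x y \<le> max b (d + k)"
      using G(3) upper[of x y] xy by (cases "A x y") (auto simp: F_def le_max_iff_disj)
  next
    fix x y x' y'
    assume *: "(A x y \<or> B x y) \<and> (A x' y' \<or> B x' y') \<and> F x y = F x' y'"
    have "x = x' \<and> y = y'"
    proof (cases "A x y"; cases "A x' y'")
      assume "A x y" "A x' y'"
      with * have "A x y \<and> A x' y' \<and> G x y = G x' y'" by (simp add: F_def)
      then show ?thesis using G(2) by blast
    next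
      assume "A x y" "\<not> A x' y'"
      then have "G x y = H x' y' + k" "b < H x' y' + k" using * lower[of x' y'] by (auto simp: F_def)
      moreover have "G x y \<le> b" using G(3) \<open>A x y\<close> by blast
      ultimately show ?thesis by simp
    next
      assume "\<not> A x y" "A x' y'"
      then have "G x' y' = H x y + k" "b < H x y + k" using * lower[of x y] by (auto simp: F_def)
      moreover have "G x' y' \<le> b" using G(3) \<open>A x' y'\<close> by blast
      ultimately show ?thesis by simp
    next
      assume "\<not> A x y" "\<not> A x' y'"
      with * have "B x y \<and> B x' y' \<and> H x y = H x' y'" by (simp add: F_def)
      then show ?thesis using H(2) by blast
    qed
    then show "x = x'" "y = y'" by auto
  qed
qed

lemma plane_thin_graph:
  assumes "\<And>x y y'. A x y \<Longrightarrow> A x y' \<Longrightarrow> y = y'" "\<And>x y. A x y \<Longrightarrow> lo \<le> x \<and> x \<le> hi"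
  shows "plane_thin A"
  unfolding plane_thin_def
  by (rule exI[of _ "\<lambda>x y. x"], rule exI[of _ lo], rule exI[of _ hi])
    (use assms in \<open>auto intro: dterm_var\<close>)

lemma plane_thin_fibre:
  assumes "\<And>x y. A x y \<Longrightarrow> x = a \<and> lo \<le> y \<and> y \<le> hi"
  shows "plane_thin A"
  unfolding plane_thin_def
  by (rule exI[of _ "\<lambda>x y. y"], rule exI[of _ lo], rule exI[of _ hi])
    (use assms in \<open>auto intro: dterm_var\<close>)

text \<open>The least points of the fibres form the graph of a function, on which the first
  coordinate is injective; removing them lowers the bound \<open>N\<close> by one.\<close>

lemma plane_thin_bounded_fibres:
  assumes "dpred M (\<lambda>s. A (s 0) (s 1))" "\<And>x. finite {y. A x y}" "\<And>x. card {y. A x y} \<le> N"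
    "\<And>x y. A x y \<Longrightarrow> lo \<le> x \<and> x \<le> hi"
  shows "plane_thin A"
  using assms
proof (induction N arbitrary: A)
  case 0
  then have "\<not> A x y" for x y using card_gt_0_iff[of "{y. A x y}"] by auto
  then show ?case by (intro plane_thin_graph) auto
next
  case (Suc N)
  have P: "dpred M (\<lambda>s. peel A (s 0) (s 1))" by (rule dpred_peel[OF Suc.prems(1)])
  have "plane_thin (peel A)"
  proof (rule Suc.IH[OF P])
    show "finite {y. peel A x y}" for x
      by (rule finite_subset[OF _ Suc.prems(2)[of x]]) (auto simp: peel_def)
    show "card {y. peel A x y} \<le> N" for x
      using card_peel[OF Suc.prems(2)] Suc.prems(3)[of x] by simp
  qed (use Suc.prems(4) in \<open>auto simp: peel_def\<close>)
  moreover have "plane_thin (\<lambda>x y. A x y \<and> \<not> (\<exists>y'. y' < y \<and> A x y'))"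
  proof (rule plane_thin_graph)
    fix x y y' assume "A x y \<and> \<not> (\<exists>y'. y' < y \<and> A x y')" "A x y' \<and> \<not> (\<exists>y''. y'' < y' \<and> A x y'')"
    then show "y = y'" by (metis linorder_less_linear)
  qed (use Suc.prems(4) in auto)
  ultimately have "plane_thin (\<lambda>x y. peel A x y \<or> (A x y \<and> \<not> (\<exists>y'. y' < y \<and> A x y')))"
    using P by (rule plane_thin_Un)
  then show ?case by (rule plane_thin_mono) (auto simp: peel_def)
qed

text \<open>Only finitely many fibres are infinite, and each of these is embedded by its second
  coordinate. On the remaining part the sizes of the fibres are uniformly bounded.\<close>

lemma plane_thin_if_no_box:
  assumes A: "dpred M (\<lambda>s. A (s 0) (s 1))" and bnd: "\<And>x y. A x y \<Longrightarrow> lo \<le> x \<and> x \<le> hi \<and> lo \<le> y \<and> y \<le> hi"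
    and no: "\<not> (\<exists>a b c d. a < b \<and> c < d \<and> (\<forall>x y. a < x \<and> x < b \<and> c < y \<and> y < d \<longrightarrow> A x y))"
  shows "plane_thin A"
proof -
  define E where "E = {x. infinite {y. A x y}}"
  have "finite E"
  proof (rule ccontr)
    assume "infinite E"
    then have "infinite {x. infinite {y. A x y}}" by (simp add: E_def)
    from box_if_infinite_fibres[OF A _ this] bnd no show False by blast
  qed
  then have E: "dset M E" by (rule dset_finite)
  define B where "B x y \<longleftrightarrow> A x y \<and> x \<notin> E" for x y
  have B: "dpred M (\<lambda>s. B (s 0) (s 1))" unfolding B_def by (intro dintros A dsetD[OF E])
  have Bfin: "finite {y. B x y}" for x
    by (cases "x \<in> E") (auto simp: B_def E_def)
  obtain N where "\<forall>x. card {y. B x y} \<le> N"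
    using uniform_finiteness[OF B _ Bfin, of lo hi] bnd unfolding B_def by blast
  then have thinB: "plane_thin B"
    by (intro plane_thin_bounded_fibres[OF B Bfin, of N lo hi]) (use bnd B_def in auto)
  have "plane_thin (\<lambda>x y. A x y \<and> x \<in> F)" if "finite F" for F
    using that
  proof (induction F rule: finite_induct)
    case empty
    show ?case by (rule plane_thin_graph) auto
  next
    case (insert a F)
    have "plane_thin (\<lambda>x y. A x y \<and> x = a)"
      by (rule plane_thin_fibre[of _ a lo hi]) (use bnd in auto)
    moreover have "dpred M (\<lambda>s. A (s 0) (s 1) \<and> s 0 = a)" by (intro dintros A)
    ultimately have "plane_thin (\<lambda>x y. (A x y \<and> x = a) \<or> (A x y \<and> x \<in> F))"
      using insert.IH by (intro plane_thin_Un)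
    then show ?case by (rule plane_thin_mono) auto
  qed
  with \<open>finite E\<close> thinB B have "plane_thin (\<lambda>x y. B x y \<or> (A x y \<and> x \<in> E))"
    by (intro plane_thin_Un) auto
  then show ?thesis by (rule plane_thin_mono) (auto simp: B_def)
qed

section \<open>Sets of dimension at most one: no projection to two coordinates fills a
  rectangle\<close>

definition thin :: "nat \<Rightarrow> (nat \<Rightarrow> 'a) set \<Rightarrow> bool" where
  "thin n X \<longleftrightarrow> (\<forall>i j a b c d. i < j \<and> j < n \<and> a < b \<and> c < d \<longrightarrow>
     (\<exists>u v. a < u \<and> u < b \<and> c < v \<and> v < d \<and> \<not> (\<exists>x\<in>X. x i = u \<and> x j = v)))"

lemma infinite_coordinate:
  assumes X: "X \<subseteq> cpow n" and inj: "inj_on g X" and "infinite X"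
  shows "\<exists>i<n. infinite ((\<lambda>x. x i) ` X)"
proof (rule ccontr)
  assume "\<not> ?thesis"
  then have "finite (PiE {..<n} (\<lambda>i. (\<lambda>x. x i) ` X))" by (intro finite_PiE) auto
  moreover have "X \<subseteq> PiE {..<n} (\<lambda>i. (\<lambda>x. x i) ` X)"
    using X by (auto simp: cpow_def PiE_iff)
  ultimately show False using assms(3) finite_subset by blast
qed

text \<open>Induction on the number of coordinates. The projection \<open>Y\<close> of
  \<open>X\<close> along the last coordinate is embedded in the line by \<open>g\<close>; the pairs
  \<open>(g (r x), x n)\<close> then form a plane set \<open>A\<close> without a rectangle, which is
  embedded in the line in turn.\<close>

theorem thin_embedding:
  assumes "definable M n X" "bounded_in_power n X" "thin n X"
  shows "\<exists>g a b. dterm M (\<lambda>s. g (restrict s {..<n})) \<and> inj_on g X \<and> (\<forall>x\<in>X. a \<le> g x \<and> g x \<le> b)"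
  using assms
proof (induction n arbitrary: X)
  case 0
  have "X \<subseteq> {\<lambda>_. undefined}" using "0.prems"(1) by (auto simp: definable_iff_dpred cpow_def)
  then have "inj_on (\<lambda>_. 0::'a) X" by (auto simp: inj_on_def)
  then show ?case by (intro exI[of _ "\<lambda>_. 0"] exI[of _ 0]) (auto intro: dterm_const)
next
  case (Suc n)
  define r where "r x = restrict x {..<n}" for x :: "nat \<Rightarrow> 'a"
  define Y where "Y = r ` X"
  have X: "X \<subseteq> cpow (Suc n)" using Suc.prems(1) by (simp add: definable_iff_dpred)
  obtain lo hi where lohi: "\<And>x i. x \<in> X \<Longrightarrow> i < Suc n \<Longrightarrow> lo \<le> x i \<and> x i \<le> hi"
    using Suc.prems(2) unfolding bounded_in_power_def by blast
  have r_upd: "restrict (\<lambda>i. if i < n then x i else x n) {..<Suc n} = x" if "x \<in> cpow (Suc n)" for x :: "nat \<Rightarrow> 'a"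
    using that by (auto simp: cpow_def PiE_iff extensional_def fun_eq_iff less_Suc_eq)
  have Yex: "r s \<in> Y \<longleftrightarrow> (\<exists>a. restrict (\<lambda>i. if i < n then s i else a) {..<Suc n} \<in> X)" for s
  proof
    assume "r s \<in> Y"
    then obtain x where "x \<in> X" "r s = r x" by (auto simp: Y_def)
    then have "s i = x i" if "i < n" for i using that unfolding r_def by (metis lessThan_iff restrict_apply')
    then have "restrict (\<lambda>i. if i < n then s i else x n) {..<Suc n} = restrict (\<lambda>i. if i < n then x i else x n) {..<Suc n}"
      by (auto simp: fun_eq_iff)
    also have "\<dots> = x" using X \<open>x \<in> X\<close> by (intro r_upd) auto
    finally have "restrict (\<lambda>i. if i < n then s i else x n) {..<Suc n} \<in> X" using \<open>x \<in> X\<close> by simp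
    then show "\<exists>a. restrict (\<lambda>i. if i < n then s i else a) {..<Suc n} \<in> X" by blast
  next
    assume "\<exists>a. restrict (\<lambda>i. if i < n then s i else a) {..<Suc n} \<in> X"
    then obtain a where a: "restrict (\<lambda>i. if i < n then s i else a) {..<Suc n} \<in> X" by blast
    have "r s = r (restrict (\<lambda>i. if i < n then s i else a) {..<Suc n})" by (auto simp: r_def fun_eq_iff)
    then show "r s \<in> Y" unfolding Y_def using a by blast
  qed
  have Ydef: "definable M n Y"
    unfolding definable_iff_dpred
  proof
    show "Y \<subseteq> cpow n" by (auto simp: Y_def r_def restrict_cpow)
    have "dpred M (\<lambda>s. \<exists>a. restrict (\<lambda>i. if i < n then s i else a) {..<Suc n} \<in> X)"
      by (rule dpred_ex, rule dpred_mem[OF Suc.prems(1)], intro dintros)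
    then show "dpred M (\<lambda>s. restrict s {..<n} \<in> Y)"
      using Yex by (simp add: r_def)
  qed
  have "bounded_in_power n Y"
    unfolding bounded_in_power_def Y_def r_def using lohi by (intro exI[of _ lo] exI[of _ hi]) auto
  moreover have "thin n Y"
    unfolding thin_def
  proof (intro allI impI)
    fix i j a b c d assume *: "i < j \<and> j < n \<and> (a::'a) < b \<and> (c::'a) < d"
    then obtain u v where uv: "a < u" "u < b" "c < v" "v < d" "\<not> (\<exists>x\<in>X. x i = u \<and> x j = v)"
      using Suc.prems(3)[unfolded thin_def, THEN spec[of _ i], THEN spec[of _ j], THEN spec[of _ a], THEN spec[of _ b],
          THEN spec[of _ c], THEN spec[of _ d]] by auto
    then have "\<not> (\<exists>x\<in>Y. x i = u \<and> x j = v)" using * by (auto simp: Y_def r_def)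
    then show "\<exists>u v. a < u \<and> u < b \<and> c < v \<and> v < d \<and> \<not> (\<exists>x\<in>Y. x i = u \<and> x j = v)" using uv by blast
  qed
  ultimately have "\<exists>g a b. dterm M (\<lambda>s. g (restrict s {..<n})) \<and> inj_on g Y \<and> (\<forall>x\<in>Y. a \<le> g x \<and> g x \<le> b)"
    by (rule Suc.IH[OF Ydef])
  then obtain g ga gb where g: "dterm M (\<lambda>s. g (restrict s {..<n}))" "inj_on g Y" "\<forall>x\<in>Y. ga \<le> g x \<and> g x \<le> gb"
    by (elim exE conjE) (rule that)
  define A where "A t y \<longleftrightarrow> (\<exists>x\<in>cpow (Suc n). x \<in> X \<and> g (r x) = t \<and> x n = y)" for t y
  have "dpred M (\<lambda>s. restrict s {..<Suc n} \<in> X)" using Suc.prems(1) by (simp add: definable_iff_dpred)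
  moreover have "r (restrict s {..<Suc n}) = restrict s {..<n}" for s by (auto simp: r_def fun_eq_iff)
  ultimately have A: "dpred M (\<lambda>s. A (s 0) (s 1))" unfolding A_def
    by (intro dpred_ex_cpow) (simp, intro dintros g(1), assumption)
  have A_iff: "A t y \<longleftrightarrow> (\<exists>x\<in>X. g (r x) = t \<and> x n = y)" for t y using X by (auto simp: A_def)
  have "plane_thin A"
  proof (rule plane_thin_if_no_box[OF A])
    show "min lo ga \<le> t \<and> t \<le> max hi gb \<and> min lo ga \<le> y \<and> y \<le> max hi gb" if "A t y" for t y
      using that lohi[of _ n] g(3) by (auto simp: A_iff Y_def min_le_iff_disj le_max_iff_disj)
    show "\<not> (\<exists>a b c d. a < b \<and> c < d \<and> (\<forall>x y. a < x \<and> x < b \<and> c < y \<and> y < d \<longrightarrow> A x y))"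
    proof (intro notI, elim exE conjE)
      fix a b c d :: 'a assume ab: "a < b" "c < d" and box: "\<forall>x y. a < x \<and> x < b \<and> c < y \<and> y < d \<longrightarrow> A x y"
      obtain w where w: "c < w" "w < d" using dense ab by blast
      define V where "V = {z \<in> Y. a < g z \<and> g z < b}"
      have onto: "\<exists>z\<in>V. g z = u" if "a < u" "u < b" for u
        using box w that unfolding A_iff V_def Y_def by blast
      then have "{a<..<b} \<subseteq> g ` V" by (auto simp: image_iff) (metis)
      then have "infinite V" using interval_infinite[OF ab(1)] finite_subset by blast
      moreover have "V \<subseteq> cpow n" "inj_on g V" using Ydef g(2) inj_on_subset
        by (auto simp: V_def definable_iff_dpred inj_on_def)
      \<comment> \<open>\<open>g\<close> maps the part \<open>V\<close> of \<open>Y\<close> onto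
        \<open>(a, b)\<close>, so \<open>V\<close> is infinite and some coordinate \<open>i\<close>
        takes an interval \<open>(p, q)\<close> of values on it. For \<open>z\<close> in
        \<open>V\<close> the rectangle in \<open>A\<close> provides points of \<open>X\<close> above
        \<open>z\<close> with any last coordinate in \<open>(c, d)\<close>; so the projection of
        \<open>X\<close> to the coordinates \<open>i\<close> and \<open>n\<close> fills
        \<open>(p, q)\<close> times \<open>(c, d)\<close>.\<close>
      ultimately obtain i where i: "i < n" "infinite ((\<lambda>x. x i) ` V)" using infinite_coordinate by blast
      have "dset M {v. \<exists>z\<in>cpow n. z \<in> Y \<and> a < g z \<and> g z < b \<and> z i = v}"
      proof (intro dsetI dpred_ex_cpow)
        have "dpred M (\<lambda>s. restrict s {..<n} \<in> Y)" using Ydef by (simp add: definable_iff_dpred)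
        then show "dpred M (\<lambda>s. restrict s {..<n} \<in> Y \<and> a < g (restrict s {..<n}) \<and> g (restrict s {..<n}) < b \<and>
          restrict s {..<n} i = s (n + 0))" using i(1) by simp (intro dintros g(1), assumption)
      qed
      moreover have "{v. \<exists>z\<in>cpow n. z \<in> Y \<and> a < g z \<and> g z < b \<and> z i = v} = (\<lambda>x. x i) ` V"
        using \<open>V \<subseteq> cpow n\<close> by (auto simp: V_def)
      ultimately obtain p q where pq: "p < q" "{p<..<q} \<subseteq> (\<lambda>x. x i) ` V"
        using infinite_contains_interval i by metis
      obtain u v where uv: "p < u" "u < q" "c < v" "v < d" "\<not> (\<exists>x\<in>X. x i = u \<and> x n = v)"
        using Suc.prems(3)[unfolded thin_def, THEN spec[of _ i], THEN spec[of _ n], THEN spec[of _ p], THEN spec[of _ q],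
            THEN spec[of _ c], THEN spec[of _ d]] i(1) pq(1) ab(2) by auto
      obtain z where z: "z \<in> V" "z i = u" using pq uv by (auto simp: subset_iff image_iff)
      then have "A (g z) v" using box uv by (auto simp: V_def)
      then obtain x where x: "x \<in> X" "g (r x) = g z" "x n = v" by (auto simp: A_iff)
      then have "r x = z" using g(2) z(1) by (auto simp: inj_on_def V_def Y_def)
      then have "x i = u" using z i(1) by (auto simp: r_def)
      with x uv(5) show False by blast
    qed
  qed
  then obtain G a b where G: "dterm M (\<lambda>s. G (s 0) (s 1))"
    "\<forall>x y x' y'. A x y \<and> A x' y' \<and> G x y = G x' y' \<longrightarrow> x = x' \<and> y = y'"
    "\<forall>x y. A x y \<longrightarrow> a \<le> G x y \<and> G x y \<le> b"
    unfolding plane_thin_def by (elim exE conjE) (rule that)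
  define f where "f x = G (g (r x)) (x n)" for x
  have AX: "A (g (r x)) (x n)" if "x \<in> X" for x using that by (auto simp: A_iff)
  show ?case
  proof (intro exI conjI)
    have "f (restrict s {..<Suc n}) = G (g (restrict s {..<n})) (s n)" for s
      using \<open>\<And>s. r (restrict s {..<Suc n}) = restrict s {..<n}\<close> by (simp add: f_def)
    moreover have "dterm M (\<lambda>s. G (g (restrict s {..<n})) (s n))"
      by (rule dterm_binary[OF G(1) g(1) dterm_var])
    ultimately show "dterm M (\<lambda>s. f (restrict s {..<Suc n}))" by simp
    show "\<forall>x\<in>X. a \<le> f x \<and> f x \<le> b" using G(3) AX by (auto simp: f_def)
    show "inj_on f X"
    proof (rule inj_onI)
      fix x y assume xy: "x \<in> X" "y \<in> X" "f x = f y"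
      then have eq: "g (r x) = g (r y)" "x n = y n" using G(2) AX by (metis f_def)+
      then have "r x = r y" using g(2) xy by (auto simp: inj_on_def Y_def)
      then have "x i = y i" if "i < n" for i using that unfolding r_def by (metis lessThan_iff restrict_apply')
      then have "restrict (\<lambda>i. if i < n then x i else x n) {..<Suc n} = restrict (\<lambda>i. if i < n then y i else y n) {..<Suc n}"
        using eq(2) by (auto simp: fun_eq_iff)
      then show "x = y" using r_upd[of x] r_upd[of y] xy X by auto
    qed
  qed
qed

end

section \<open>Definable Hausdorff topologies on a bounded subset of the line\<close>

text \<open>A member \<open>b\<close> of \<open>cpow m\<close> stands for the basic open set \<open>{w. R b w}\<close>.\<close>

locale line_basis = omin M
  for M :: "('a::{linordered_group_add, linorder_topology}, 'f, 'r) fo_struct" +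
  fixes L :: "'a set" and m :: nat and R :: "(nat \<Rightarrow> 'a) \<Rightarrow> 'a \<Rightarrow> bool" and lo hi :: 'a
  assumes dset_L: "dset M L" and L_bounds: "\<And>x. x \<in> L \<Longrightarrow> lo \<le> x \<and> x \<le> hi"
    and basis_sub: "\<And>b w. b \<in> cpow m \<Longrightarrow> R b w \<Longrightarrow> w \<in> L"
    and basis_cover: "\<And>w. w \<in> L \<Longrightarrow> \<exists>b\<in>cpow m. R b w"
    and basis_Int: "\<And>b c w. b \<in> cpow m \<Longrightarrow> c \<in> cpow m \<Longrightarrow> R b w \<Longrightarrow> R c w \<Longrightarrow>
      \<exists>e\<in>cpow m. R e w \<and> (\<forall>v. R e v \<longrightarrow> R b v \<and> R c v)"
    and basis_Hausdorff: "\<And>x y. x \<in> L \<Longrightarrow> y \<in> L \<Longrightarrow> x \<noteq> y \<Longrightarrow>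
      \<exists>b\<in>cpow m. \<exists>c\<in>cpow m. R b x \<and> R c y \<and> \<not> (\<exists>w. R b w \<and> R c w)"
    and basis_dpred: "dpred M (\<lambda>s. R (restrict s {..<m}) (s m))"
begin

section \<open>Convergence of germs and good points\<close>

lemma dpred_R:
  assumes "\<And>i. dterm M (u i)" "dterm M t"
  shows "dpred M (\<lambda>s. R (restrict (\<lambda>i. u i s) {..<m}) (t s))"
proof -
  have "dpred M (\<lambda>s. R (restrict (\<lambda>i. (if i < m then u i else t) s) {..<m}) ((if m < m then u m else t) s))"
    by (rule dpred_comp[OF basis_dpred, of "\<lambda>i. if i < m then u i else t"]) (use assms in auto)
  moreover have "restrict (\<lambda>i. (if i < m then u i else t) s) {..<m} = restrict (\<lambda>i. u i s) {..<m}" for s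
    by (auto simp: fun_eq_iff)
  ultimately show ?thesis by simp
qed

lemma dpred_R_const: "b \<in> cpow m \<Longrightarrow> dterm M t \<Longrightarrow> dpred M (\<lambda>s. R b (t s))"
  using dpred_R[of "\<lambda>i s. b i" t] by (simp add: dterm_const restrict_cpow)

text \<open>The germ of the line at \<open>z\<close> on the side \<open>d\<close> converges to
  \<open>y\<close> in the new topology, where \<open>z\<close> need not lie in \<open>L\<close> and
  may differ from \<open>y\<close>. For \<open>y\<close> outside \<open>L\<close> the condition is
  vacuous, which is why \<open>y \<in> L\<close> is assumed separately where it matters.\<close>

definition conv :: "bool \<Rightarrow> 'a \<Rightarrow> 'a \<Rightarrow> bool" where
  "conv d z y \<longleftrightarrow> (\<forall>b\<in>cpow m. R b y \<longrightarrow> eventually (R b) (germ d z))"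

definition good :: "'a \<Rightarrow> bool" where
  "good z \<longleftrightarrow> (\<forall>b\<in>cpow m. R b z \<longrightarrow> (\<exists>c d. c < z \<and> z < d \<and> (\<forall>w. c < w \<and> w < d \<longrightarrow> R b w)))"

lemma dpred_conv: "dterm M t \<Longrightarrow> dterm M u \<Longrightarrow> dpred M (\<lambda>s. conv d (t s) (u s))"
proof (rule dpred_binary[where P = "conv d"])
  show "dpred M (\<lambda>s. conv d (s 0) (s 1))"
    unfolding conv_def
    by (intro dpred_all_cpow dpred_imp dpred_germ dpred_R dterm_var)
qed

lemma conv_unique:
  assumes "x \<in> L" "y \<in> L" "conv d z x" "conv d z y"
  shows "x = y"
proof (rule ccontr)
  assume "x \<noteq> y"
  then obtain b c where bc: "b \<in> cpow m" "c \<in> cpow m" "R b x" "R c y" "\<not> (\<exists>w. R b w \<and> R c w)"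
    using basis_Hausdorff assms by meson
  then have "eventually (R b) (germ d z)" "eventually (R c) (germ d z)"
    using assms unfolding conv_def by blast+
  from eventually_germ_ex[OF eventually_conj[OF this]] show False using bc by blast
qed

lemma germ_near:
  assumes "u < z" "z < v"
  shows "eventually (\<lambda>w. u < w \<and> w < v) (germ d (z::'a))"
proof (cases d)
  case True
  have "eventually (\<lambda>w. u < w \<and> w < v) (germ True z)"
    unfolding eventually_germ_True using assms by (intro exI[of _ v]) auto
  with True show ?thesis by simp
next
  case False
  have "eventually (\<lambda>w. u < w \<and> w < v) (germ False z)"
    unfolding eventually_germ_False using assms by (intro exI[of _ u]) auto
  with False show ?thesis by simp
qed

lemma good_conv: "good z \<Longrightarrow> conv d z z"
  unfolding good_def conv_def using germ_near by (metis (mono_tags, lifting) eventually_mono)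

lemma conv_good:
  assumes "conv True z z" "conv False z z"
  shows "good z"
  unfolding good_def
proof (intro ballI impI)
  fix b assume b: "b \<in> cpow m" "R b z"
  then obtain c d where "c < z" "z < d" "\<forall>w. z < w \<and> w < d \<longrightarrow> R b w" "\<forall>w. c < w \<and> w < z \<longrightarrow> R b w"
    using assms unfolding conv_def eventually_germ_True eventually_germ_False by meson
  then show "\<exists>c d. c < z \<and> z < d \<and> (\<forall>w. c < w \<and> w < d \<longrightarrow> R b w)"
    using b(2) by (metis linorder_less_linear)
qed

text \<open>A form of compactness of closed bounded intervals: if all neighbourhoods of \<open>y\<close> meet \<open>A\<close>
  outside of \<open>y\<close>, then the supremum of the infima of these intersections is a point at which one
  of the two one-sided germs lies in \<open>A\<close> and converges to \<open>y\<close>.\<close>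

lemma accumulation:
  assumes A: "dset M A" and bnd: "\<And>w. w \<in> A \<Longrightarrow> l \<le> w \<and> w \<le> h" and "y \<in> L"
    and meets: "\<And>b. b \<in> cpow m \<Longrightarrow> R b y \<Longrightarrow> \<exists>w\<in>A. w \<noteq> y \<and> R b w"
  shows "\<exists>d z. conv d z y \<and> eventually (\<lambda>w. w \<in> A) (germ d z)"
proof -
  \<comment> \<open>The lower bounds, up to \<open>h\<close>, of the traces on \<open>A\<close> of
    punctured neighbourhoods of \<open>y\<close>.\<close>
  define Z where "Z = {v. v \<le> h \<and> (\<exists>b\<in>cpow m. R b y \<and> (\<forall>w. w \<in> A \<and> w \<noteq> y \<and> R b w \<longrightarrow> v \<le> w))}"
  have "dset M Z" unfolding Z_def
    by (intro dsetI dpred_conj dpred_ex_cpow dpred_all dpred_imp dsetD[OF A] dpred_neg dpred_eq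
        dpred_le dterm_var dterm_const dpred_R)
  obtain b1 where b1: "b1 \<in> cpow m" "R b1 y" using basis_cover \<open>y \<in> L\<close> by blast
  then have "l \<in> Z" using meets[OF b1] bnd unfolding Z_def by fastforce
  have "\<exists>s. (\<forall>x\<in>Z. x \<le> s) \<and> (\<forall>y<s. \<exists>x\<in>Z. y < x)"
  proof (rule sup[OF \<open>dset M Z\<close>])
    show "x \<le> h" if "x \<in> Z" for x using that by (simp add: Z_def)
  qed (use \<open>l \<in> Z\<close> in blast)
  then obtain z where z: "\<forall>x\<in>Z. x \<le> z" "\<forall>u<z. \<exists>x\<in>Z. u < x" by blast
  \<comment> \<open>A neighbourhood witnessing an element of \<open>Z\<close> above \<open>u\<close>
    keeps the points above \<open>u\<close>; since \<open>v\<close> is not in \<open>Z\<close>, each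
    neighbourhood also has points of \<open>A\<close> below \<open>v\<close>.\<close>
  have near: "\<exists>w\<in>A. w \<noteq> y \<and> R b w \<and> u < w \<and> w < v" if b: "b \<in> cpow m" "R b y" and uv: "u < z" "z < v" for b u v
  proof -
    obtain x where x: "x \<in> Z" "u < x" using z uv by blast
    then obtain c where c: "c \<in> cpow m" "R c y" "\<forall>w. w \<in> A \<and> w \<noteq> y \<and> R c w \<longrightarrow> x \<le> w"
      by (auto simp: Z_def)
    obtain e where e: "e \<in> cpow m" "R e y" "\<forall>v. R e v \<longrightarrow> R b v \<and> R c v"
      using basis_Int[OF b(1) c(1) b(2) c(2)] by blast
    have "\<exists>w\<in>A. w \<noteq> y \<and> R e w \<and> w < v"
    proof (cases "v \<le> h")
      case False
      then show ?thesis using meets[OF e(1,2)] bnd by (meson le_less_trans not_le_imp_less)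
    next
      case True
      have "v \<notin> Z" using z(1) uv by auto
      then show ?thesis using True e unfolding Z_def by (auto simp: not_le)
    qed
    then show ?thesis using e(3) c(3) x(2) by (meson less_le_trans)
  qed
  show ?thesis
  proof (rule ccontr)
    assume no: "\<not> ?thesis"
    \<comment> \<open>If no germ is as desired, then on either side of \<open>z\<close> some
      neighbourhood of \<open>y\<close> has no point of \<open>A\<close> close to \<open>z\<close>:
      either the germ avoids \<open>A\<close> or it avoids the neighbourhood. By the Hausdorff
      property or because \<open>z\<close> is not in \<open>L\<close>, a further one,
      \<open>b4\<close>, excludes \<open>z\<close> itself unless it equals \<open>y\<close>. Their
      intersection contradicts \<open>near\<close>.\<close>
    have side: "\<exists>b\<in>cpow m. R b y \<and> eventually (\<lambda>w. \<not> (R b w \<and> w \<in> A)) (germ d z)" for d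
    proof (cases "conv d z y")
      case True
      then have "\<not> eventually (\<lambda>w. w \<in> A) (germ d z)" using no by blast
      then have "eventually (\<lambda>w. w \<notin> A) (germ d z)" using germ_dichotomy_set[OF A] by blast
      then have "eventually (\<lambda>w. \<not> (R b1 w \<and> w \<in> A)) (germ d z)" by (rule eventually_mono) simp
      with b1 show ?thesis by blast
    next
      case False
      then obtain b where b: "b \<in> cpow m" "R b y" "\<not> eventually (R b) (germ d z)"
        unfolding conv_def by blast
      have "eventually (\<lambda>w. \<not> R b w) (germ d z)"
        using germ_dichotomy[OF dpred_R_const[OF b(1) dterm_var[of M 0]], of d z] b(3) by blast
      then have "eventually (\<lambda>w. \<not> (R b w \<and> w \<in> A)) (germ d z)" by (rule eventually_mono) simp
      with b show ?thesis by blast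
    qed
    obtain b2 where b2: "b2 \<in> cpow m" "R b2 y" "eventually (\<lambda>w. \<not> (R b2 w \<and> w \<in> A)) (germ True z)"
      using side by blast
    obtain b3 where b3: "b3 \<in> cpow m" "R b3 y" "eventually (\<lambda>w. \<not> (R b3 w \<and> w \<in> A)) (germ False z)"
      using side by blast
    obtain v where v: "z < v" "\<forall>w. z < w \<and> w < v \<longrightarrow> \<not> (R b2 w \<and> w \<in> A)"
      using b2(3) unfolding eventually_germ_True by blast
    obtain u where u: "u < z" "\<forall>w. u < w \<and> w < z \<longrightarrow> \<not> (R b3 w \<and> w \<in> A)"
      using b3(3) unfolding eventually_germ_False by blast
    obtain b4 where b4: "b4 \<in> cpow m" "R b4 y" "z = y \<or> \<not> R b4 z"
    proof (cases "z \<in> L \<and> z \<noteq> y")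
      case True
      then show thesis using basis_Hausdorff[of z y] \<open>y \<in> L\<close> that by blast
    next
      case False
      then show thesis using b1 basis_sub[of b1 z] that by blast
    qed
    obtain b5 where b5: "b5 \<in> cpow m" "R b5 y" "\<forall>v. R b5 v \<longrightarrow> R b2 v \<and> R b3 v"
      using basis_Int[OF b2(1) b3(1) b2(2) b3(2)] by blast
    obtain b6 where b6: "b6 \<in> cpow m" "R b6 y" "\<forall>v. R b6 v \<longrightarrow> R b4 v \<and> R b5 v"
      using basis_Int[OF b4(1) b5(1) b4(2) b5(2)] by blast
    obtain w where w: "w \<in> A" "w \<noteq> y" "R b6 w" "u < w" "w < v"
      using near[OF b6(1,2) u(1) v(1)] by blast
    then have "R b2 w" "R b3 w" "R b4 w" using b5 b6 by blast+
    then show False using w u(2) v(2) b4(3) by (metis linorder_less_linear)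
  qed
qed

text \<open>Neighbourhoods can be tested on germs: a definable set that is left by all germs
  converging to \<open>y\<close> does not accumulate at \<open>y\<close>. The results on small
  neighbourhoods and on continuity below are obtained in this way.\<close>

lemma neighbourhood_inside:
  assumes A: "dset M A" and "A \<subseteq> L" and "y \<in> L" "y \<notin> A"
    and germs: "\<And>d z. conv d z y \<Longrightarrow> eventually (\<lambda>w. w \<notin> A) (germ d z)"
  shows "\<exists>b\<in>cpow m. R b y \<and> (\<forall>w. R b w \<longrightarrow> w \<notin> A)"
proof (rule ccontr)
  assume no: "\<not> ?thesis"
  have "\<exists>d z. conv d z y \<and> eventually (\<lambda>w. w \<in> A) (germ d z)"
  proof (rule accumulation[OF A _ \<open>y \<in> L\<close>])
    show "lo \<le> w \<and> w \<le> hi" if "w \<in> A" for w using that L_bounds \<open>A \<subseteq> L\<close> by blast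
    show "\<exists>w\<in>A. w \<noteq> y \<and> R b w" if b: "b \<in> cpow m" "R b y" for b
    proof -
      obtain w where "R b w" "w \<in> A" using no b by blast
      moreover from this have "w \<noteq> y" using \<open>y \<notin> A\<close> by auto
      ultimately show ?thesis by blast
    qed
  qed
  then show False using germs eventually_germ_contra by blast
qed

text \<open>An interval of such points \<open>z\<close> would be disjoint from \<open>A\<close>,
  although germs at its points lie in \<open>A\<close>.\<close>

lemma boundary_finite:
  assumes "dset M A"
  shows "finite {z. z \<notin> A \<and> eventually (\<lambda>w. w \<in> A) (germ d z)}"
proof (rule finite_if_no_interval)
  show "dset M {z. z \<notin> A \<and> eventually (\<lambda>w. w \<in> A) (germ d z)}"
    by (intro dsetI dpred_conj dpred_neg dsetD[OF assms] dpred_germ dterm_var)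
  fix a b :: 'a assume "a < b"
  show "\<exists>x. a < x \<and> x < b \<and> x \<notin> {z. z \<notin> A \<and> eventually (\<lambda>w. w \<in> A) (germ d z)}"
  proof (cases "\<exists>x. a < x \<and> x < b \<and> x \<in> A")
    case False
    obtain x where x: "a < x" "x < b" using dense \<open>a < b\<close> by blast
    have "eventually (\<lambda>w. w \<notin> A) (germ d x)"
      by (rule eventually_mono[OF germ_near[OF x]]) (use False in blast)
    then have "\<not> eventually (\<lambda>w. w \<in> A) (germ d x)" using eventually_germ_contra by blast
    then show ?thesis using x by blast
  qed auto
qed

section \<open>Cofinitely many good points\<close>

lemma conv_eventually_L:
  assumes "conv d z y" "y \<in> L"
  shows "eventually (\<lambda>w. w \<in> L) (germ d z)"
proof -
  obtain b where b: "b \<in> cpow m" "R b y" using basis_cover assms(2) by blast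
  then have "eventually (R b) (germ d z)" using assms(1) by (auto simp: conv_def)
  then show ?thesis by (rule eventually_mono) (use b basis_sub in blast)
qed

text \<open>The germs at a good point converge to that point and by uniqueness to no other. This
  leaves the bad points and the end points of \<open>L\<close> outside of \<open>L\<close>.\<close>

lemma foreign_finite:
  assumes "finite {z \<in> L. \<not> good z}"
  shows "finite {z. \<exists>y\<in>L. y \<noteq> z \<and> conv d z y}"
proof (rule finite_subset)
  show "finite ({z \<in> L. \<not> good z} \<union> {z. z \<notin> L \<and> eventually (\<lambda>w. w \<in> L) (germ d z)})"
    using assms boundary_finite[OF dset_L] by blast
  show "{z. \<exists>y\<in>L. y \<noteq> z \<and> conv d z y} \<subseteq> {z \<in> L. \<not> good z} \<union> {z. z \<notin> L \<and> eventually (\<lambda>w. w \<in> L) (germ d z)}"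
    using conv_eventually_L good_conv conv_unique by blast
qed

text \<open>The second conjunct makes the neighbourhoods of \<open>y\<close> arbitrarily small, see
  \<open>small_neighbourhood\<close> below.\<close>

lemma cofinitely_affine:
  assumes "finite {z \<in> L. \<not> good z}"
  shows "\<exists>P. finite P \<and> (\<forall>y\<in>L - P. good y \<and> (\<forall>d z. conv d z y \<longrightarrow> z = y))"
proof -
  define E where "E d = {z. \<exists>y\<in>L. y \<noteq> z \<and> conv d z y}" for d
  \<comment> \<open>The limits of foreign germs. Each germ has at most one limit, so
    \<open>T d\<close> is finite along with the set \<open>E d\<close> of base points.\<close>
  define T where "T d = {y \<in> L. \<exists>z\<in>E d. conv d z y}" for d
  have "finite (T d)" for d
  proof -
    have "T d \<subseteq> (\<lambda>z. SOME y. y \<in> L \<and> conv d z y) ` E d"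
    proof
      fix y assume "y \<in> T d"
      then obtain z where z: "y \<in> L" "z \<in> E d" "conv d z y" by (auto simp: T_def)
      have "(SOME y. y \<in> L \<and> conv d z y) \<in> L \<and> conv d z (SOME y. y \<in> L \<and> conv d z y)"
        by (rule someI[of _ y]) (use z in blast)
      then have "y = (SOME y. y \<in> L \<and> conv d z y)" using z conv_unique by blast
      then show "y \<in> (\<lambda>z. SOME y. y \<in> L \<and> conv d z y) ` E d" using z(2) by blast
    qed
    then show ?thesis using foreign_finite[OF assms, of d] finite_surj by (auto simp: E_def)
  qed
  moreover have "good y \<and> (\<forall>d z. conv d z y \<longrightarrow> z = y)"
    if y: "y \<in> L - ({z \<in> L. \<not> good z} \<union> T True \<union> T False)" for y
  proof -
    have "z = y" if "conv d z y" for d z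
    proof (rule ccontr)
      assume "z \<noteq> y"
      moreover have "y \<in> L" using y by blast
      ultimately have "z \<in> E d" using that by (auto simp: E_def)
      then have "y \<in> T d" using that \<open>y \<in> L\<close> by (auto simp: T_def)
      then show False using y by (cases d) auto
    qed
    then show ?thesis using y by blast
  qed
  ultimately show ?thesis
    using assms by (intro exI[of _ "{z \<in> L. \<not> good z} \<union> T True \<union> T False"]) blast
qed

lemma small_neighbourhood:
  assumes "y \<in> L" "\<And>d z. conv d z y \<Longrightarrow> z = y" "c < y" "y < d"
  shows "\<exists>b\<in>cpow m. R b y \<and> (\<forall>w. R b w \<longrightarrow> c < w \<and> w < d)"
proof -
  have "dset M (L - {c<..<d})" by (intro dset_Diff dset_L dset_interval)
  then have "\<exists>b\<in>cpow m. R b y \<and> (\<forall>w. R b w \<longrightarrow> w \<notin> L - {c<..<d})"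
  proof (rule neighbourhood_inside)
    fix e z assume "conv e z y"
    then have "z = y" by (rule assms(2))
    then show "eventually (\<lambda>w. w \<notin> L - {c<..<d}) (germ e z)"
      using germ_near[OF assms(3,4), of e] by (auto elim: eventually_mono)
  qed (use assms in auto)
  then show ?thesis using basis_sub by fastforce
qed

text \<open>A bad point is bad on one of its sides, so an interval of points is bad on a common side
  \<open>d\<close>. The sets \<open>S\<close> are half-lines that become relatively clopen on a
  suitable subinterval: one half is open because of the order, the other because neighbourhoods can
  be cut off on the side \<open>d\<close>.\<close>

lemma totally_disconnected_interval:
  assumes "infinite {z \<in> L. \<not> good z}"
  obtains p q where "p < q" "{p<..<q} \<subseteq> L"
    "\<And>x y. p < x \<Longrightarrow> x < y \<Longrightarrow> y < q \<Longrightarrow> \<exists>S. dset M S \<and> x \<in> S \<and> y \<notin> S \<and>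
      (\<forall>w. p < w \<and> w < q \<longrightarrow> (\<exists>b\<in>cpow m. R b w \<and> (\<forall>v. R b v \<and> p < v \<and> v < q \<longrightarrow> (v \<in> S \<longleftrightarrow> w \<in> S))))"
proof -
  define B where "B d = {z \<in> L. \<exists>b\<in>cpow m. R b z \<and> eventually (\<lambda>w. \<not> R b w) (germ d z)}" for d
  have "dset M (B d)" for d unfolding B_def
    by (intro dsetI dpred_conj dsetD[OF dset_L] dpred_ex_cpow dpred_germ dpred_neg dpred_R dterm_var)
  have "{z \<in> L. \<not> good z} \<subseteq> B True \<union> B False"
  proof
    fix z assume "z \<in> {z \<in> L. \<not> good z}"
    then obtain d where "z \<in> L" "\<not> conv d z z" using conv_good by blast
    then obtain b where b: "b \<in> cpow m" "R b z" "\<not> eventually (R b) (germ d z)" by (auto simp: conv_def)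
    then have "eventually (\<lambda>w. \<not> R b w) (germ d z)"
      using germ_dichotomy[OF dpred_R_const[OF b(1) dterm_var[of M 0]], of d z] by blast
    then have "z \<in> B d" using b \<open>z \<in> L\<close> by (auto simp: B_def)
    then show "z \<in> B True \<union> B False" by (cases d) auto
  qed
  then obtain d where "infinite (B d)" using assms by (meson finite_UnI finite_subset)
  then obtain a b where ab: "a < b" "{a<..<b} \<subseteq> B d"
    using infinite_contains_interval[OF \<open>dset M (B d)\<close>] by blast
  \<comment> \<open>The limit of the germ at \<open>z\<close> is either \<open>z\<close> or at least
    \<open>e\<close> away from \<open>z\<close>. Each germ has at most one limit, so such an
    \<open>e\<close> exists, and it can be chosen uniformly on a subinterval for both sides.\<close>
  define Q where "Q d z e \<longleftrightarrow> (\<forall>y. y \<in> L \<and> y \<noteq> z \<and> conv d z y \<longrightarrow> y + e \<le> z \<or> z + e \<le> y)" for d z e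
  have Qd: "dpred M (\<lambda>s. Q d (s 0) (s 1))" for d unfolding Q_def
    by (intro dintros dsetD[OF dset_L] dpred_conv)
  have Qanti: "Q d z v" if "v \<le> u" "Q d z u" for d z u v
  proof -
    have "y + v \<le> y + u" for y using that by simp
    then show ?thesis using that(2) unfolding Q_def by (meson order_trans)
  qed
  have Qex: "\<exists>u\<in>{0<..}. Q d z u" for d z
  proof (cases "\<exists>y. y \<in> L \<and> y \<noteq> z \<and> conv d z y")
    case True
    then obtain y where y: "y \<in> L" "y \<noteq> z" "conv d z y" by blast
    obtain e where e: "e > 0" "\<forall>u\<in>{y,z}. \<forall>u'\<in>{y,z}. u < u' \<longrightarrow> u + e \<le> u'"
      using finite_gap[of "{y,z}"] by auto
    have "y + e \<le> z \<or> z + e \<le> y" using e y(2) by (cases y z rule: linorder_cases) auto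
    then have "Q d z e" unfolding Q_def using conv_unique y by blast
    then show ?thesis using e by auto
  next
    case False
    then show ?thesis using ex_pos unfolding Q_def by auto
  qed
  obtain a1 b1 e1 where 1: "a \<le> a1" "a1 < b1" "b1 \<le> b" "e1 \<in> {0<..}" "\<And>z. a1 < z \<Longrightarrow> z < b1 \<Longrightarrow> Q True z e1"
    by (rule uniform_parameter[OF Qd dset_interval(2)[of M 0] ab(1)]) (use Qanti Qex in auto)
  obtain a2 b2 e2 where 2: "a1 \<le> a2" "a2 < b2" "b2 \<le> b1" "e2 \<in> {0<..}" "\<And>z. a2 < z \<Longrightarrow> z < b2 \<Longrightarrow> Q False z e2"
    by (rule uniform_parameter[OF Qd dset_interval(2)[of M 0] 1(2)]) (use Qanti Qex in auto)
  define e where "e = min e1 e2"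
  have "e > 0" using 1 2 by (simp add: e_def)
  have Qe: "Q d z e" if "a2 < z" "z < b2" for d z
    using Qanti[of e e1 True z] Qanti[of e e2 False z] 1(5)[of z] 2 that by (cases d) (auto simp: e_def)
  \<comment> \<open>The interval \<open>(p, q)\<close> is shorter than \<open>e\<close>, hence too
    short to contain a foreign limit of one of its own germs.\<close>
  obtain p where p: "a2 < p" "p < b2" using dense 2 by blast
  then have "p < min b2 (p + e)" using \<open>e > 0\<close> gadd_less_left[of p 0 e] by simp
  then obtain q where "p < q \<and> q < min b2 (p + e)" using dense by blast
  then have q: "p < q" "q < b2" "q < p + e" by auto
  have "a < p" "q < b" using 1(1,3) 2(1,3) p q by order+
  then have "{p<..<q} \<subseteq> {a<..<b}" by auto
  then have sub: "{p<..<q} \<subseteq> B d" using ab(2) by blast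
  have fine: "\<exists>b\<in>cpow m. R b y \<and> (\<forall>w. R b w \<and> p < w \<and> w < q \<longrightarrow> c < w \<and> w < c')"
    if y: "p < y" "y < q" and c: "c < y" "y < c'" for y c c'
  proof -
    have "y \<in> L" using sub y by (auto simp: B_def)
    have "dset M (L \<inter> {p<..<q} - {c<..<c'})" by (intro dset_Diff dset_Int dset_L dset_interval)
    then have "\<exists>b\<in>cpow m. R b y \<and> (\<forall>w. R b w \<longrightarrow> w \<notin> L \<inter> {p<..<q} - {c<..<c'})"
    proof (rule neighbourhood_inside)
      fix f z assume conv: "conv f z y"
      show "eventually (\<lambda>w. w \<notin> L \<inter> {p<..<q} - {c<..<c'}) (germ f z)"
      proof (cases "z = y")
        case True
        then show ?thesis using germ_near[OF c, of f] by (auto elim: eventually_mono)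
      next
        case False
        \<comment> \<open>The germs at \<open>p\<close> and \<open>q\<close> may point into the
          interval, so the end points belong to the last case; \<open>Qe\<close> covers them because
          both lie strictly between \<open>a2\<close> and \<open>b2\<close>.\<close>
        consider "z < p" | "q < z" | "p \<le> z" "z \<le> q" by force
        then show ?thesis
        proof cases
          case 1
          obtain u where "u < z" using ex_lt by blast
          then show ?thesis using germ_near[OF _ 1, of u f] by (auto elim: eventually_mono)
        next
          case 2
          obtain u where "z < u" using ex_gt by blast
          then show ?thesis using germ_near[OF 2, of u f] by (auto elim: eventually_mono)
        next
          case 3
          then have "Q f z e" using Qe p q by auto
          then have "y + e \<le> z \<or> z + e \<le> y" using conv False \<open>y \<in> L\<close> by (auto simp: Q_def)
          moreover have "q < y + e" using q(3) y(1) by (metis gadd_less_right less_trans)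
          moreover have "q < z + e" using q(3) 3(1) by (metis gadd_le_right less_le_trans)
          ultimately show ?thesis using 3 y by auto
        qed
      qed
    qed (use \<open>y \<in> L\<close> c in auto)
    then show ?thesis using basis_sub by fastforce
  qed
  \<comment> \<open>Badness on the side \<open>d\<close> removes the points just beside
    \<open>y\<close> on that side, and \<open>fine\<close> removes the distant ones.\<close>
  have half: "\<exists>b\<in>cpow m. R b y \<and> (\<forall>w. R b w \<and> p < w \<and> w < q \<longrightarrow> (if d then w \<le> y else y \<le> w))"
    if y: "p < y" "y < q" for y
  proof -
    have "y \<in> B d" using sub y by auto
    then obtain b where b: "b \<in> cpow m" "R b y" "eventually (\<lambda>w. \<not> R b w) (germ d y)" by (auto simp: B_def)
    have "\<exists>c c'. c < y \<and> y < c' \<and> (\<forall>w. c < w \<and> w < c' \<and> R b w \<longrightarrow> (if d then w \<le> y else y \<le> w))"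
    proof (cases d)
      case True
      then have "eventually (\<lambda>w. \<not> R b w) (germ True y)" using b(3) by simp
      then obtain c' where "y < c'" "\<forall>w. y < w \<and> w < c' \<longrightarrow> \<not> R b w"
        unfolding eventually_germ_True by blast
      then show ?thesis using True ex_lt[of y] not_le by metis
    next
      case False
      then have "eventually (\<lambda>w. \<not> R b w) (germ False y)" using b(3) by simp
      then obtain c where "c < y" "\<forall>w. c < w \<and> w < y \<longrightarrow> \<not> R b w"
        unfolding eventually_germ_False by blast
      then show ?thesis using False ex_gt[of y] not_le by metis
    qed
    then obtain c c' where c: "c < y" "y < c'" "\<forall>w. c < w \<and> w < c' \<and> R b w \<longrightarrow> (if d then w \<le> y else y \<le> w)"
      by (elim exE conjE) (rule that)
    obtain b' where b': "b' \<in> cpow m" "R b' y" "\<forall>w. R b' w \<and> p < w \<and> w < q \<longrightarrow> c < w \<and> w < c'"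
      using fine[OF y c(1,2)] by blast
    obtain f where f: "f \<in> cpow m" "R f y" "\<forall>v. R f v \<longrightarrow> R b v \<and> R b' v"
      using basis_Int[OF b(1) b'(1) b(2) b'(2)] by blast
    then show ?thesis using b'(3) c(3) by blast
  qed
  show thesis
  proof (rule that[OF \<open>p < q\<close>])
    show "{p<..<q} \<subseteq> L" using sub by (auto simp: B_def)
    fix x y assume xy: "p < x" "x < y" "y < q"
    \<comment> \<open>If neighbourhoods can be cut off on the right, the cut is placed just after
      \<open>x\<close>, otherwise just before \<open>y\<close>.\<close>
    define S where "S = (if d then {w. w \<le> x} else {w. w < y})"
    have "dset M S" unfolding S_def by (cases d) (auto intro!: dsetI dintros)
    moreover have "\<exists>b\<in>cpow m. R b w \<and> (\<forall>v. R b v \<and> p < v \<and> v < q \<longrightarrow> (v \<in> S \<longleftrightarrow> w \<in> S))"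
      if w: "p < w" "w < q" for w
    proof -
      obtain u u' where "u < w" "w < u'" using ex_lt ex_gt by blast
      consider "d" "w \<le> x" | "d" "x < w" | "\<not> d" "w < y" | "\<not> d" "y \<le> w" by force
      then show ?thesis
      proof cases
        case 1
        then show ?thesis using half[OF w] unfolding S_def by fastforce
      next
        case 2
        then show ?thesis using fine[OF w 2(2) \<open>w < u'\<close>] unfolding S_def by fastforce
      next
        case 3
        then show ?thesis using fine[OF w \<open>u < w\<close> 3(2)] unfolding S_def by fastforce
      next
        case 4
        then show ?thesis using half[OF w] unfolding S_def by fastforce
      qed
    qed
    moreover have "x \<in> S" "y \<notin> S" using xy by (auto simp: S_def)
    ultimately show "\<exists>S. dset M S \<and> x \<in> S \<and> y \<notin> S \<and>
      (\<forall>w. p < w \<and> w < q \<longrightarrow> (\<exists>b\<in>cpow m. R b w \<and> (\<forall>v. R b v \<and> p < v \<and> v < q \<longrightarrow> (v \<in> S \<longleftrightarrow> w \<in> S))))"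
      by (intro exI[of _ S]) blast
  qed
qed

end

section \<open>Embedding into an affine space\<close>

context omin
begin

section \<open>Continuous definable functions of one variable\<close>

lemma dterm_max: "dterm M t \<Longrightarrow> dterm M u \<Longrightarrow> dterm M (\<lambda>s. max (t s) (u s))"
  unfolding max_def by (intro dterm_if dpred_le)

lemma cont_const: "cont (\<lambda>y. k) x"
  unfolding cont_def using ex_lt[of x] ex_gt[of x] by blast

lemma cont_shift: "cont (\<lambda>y. y - k) x"
  unfolding cont_def
proof (intro allI impI)
  fix u v assume "u < x - k \<and> x - k < v"
  then have "u + k < x" "x < v + k" by (simp_all add: og.less_diff_eq og.diff_less_eq)
  then show "\<exists>c d. c < x \<and> x < d \<and> (\<forall>y. c < y \<and> y < d \<longrightarrow> u < y - k \<and> y - k < v)"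
    by (intro exI[of _ "u + k"] exI[of _ "v + k"]) (simp add: og.less_diff_eq og.diff_less_eq)
qed

lemma diff_less_swap: "k - y < v \<longleftrightarrow> k - v < y" "u < k - y \<longleftrightarrow> y < k - u" for k y u v :: 'a
  by (auto simp: og.less_diff_eq og.diff_less_eq og.add.commute)

lemma cont_reflect: "cont (\<lambda>y. k - y) x"
  unfolding cont_def
proof (intro allI impI)
  fix u v assume "u < k - x \<and> k - x < v"
  then have "k - v < x" "x < k - u" using diff_less_swap by blast+
  then show "\<exists>c d. c < x \<and> x < d \<and> (\<forall>y. c < y \<and> y < d \<longrightarrow> u < k - y \<and> k - y < v)"
    using diff_less_swap by blast
qed

lemma cont_both:
  assumes f: "cont f x" and g: "cont g x" and u: "u < f x" "f x < v" "u' < g x" "g x < v'"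
  shows "\<exists>c d. c < x \<and> x < d \<and> (\<forall>y. c < y \<and> y < d \<longrightarrow> u < f y \<and> f y < v \<and> u' < g y \<and> g y < v')"
proof -
  obtain c d where cd: "c < x" "x < d" "\<forall>y. c < y \<and> y < d \<longrightarrow> u < f y \<and> f y < v"
    using f[unfolded cont_def, THEN spec[of _ u], THEN spec[of _ v]] u by auto
  obtain c' d' where cd': "c' < x" "x < d'" "\<forall>y. c' < y \<and> y < d' \<longrightarrow> u' < g y \<and> g y < v'"
    using g[unfolded cont_def, THEN spec[of _ u'], THEN spec[of _ v']] u by auto
  show ?thesis
    by (rule exI[of _ "max c c'"], rule exI[of _ "min d d'"]) (use cd cd' in auto)
qed

lemma cont_min:
  assumes "cont f x" "cont g x"
  shows "cont (\<lambda>y. min (f y) (g y)) x"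
  unfolding cont_def
proof (intro allI impI)
  fix u v assume uv: "u < min (f x) (g x) \<and> min (f x) (g x) < v"
  \<comment> \<open>Only one of the two functions has to be below \<open>v\<close>;
    \<open>v'\<close> is a harmless upper bound for the other.\<close>
  obtain v' where v': "max (f x) (g x) < v'" using ex_gt by blast
  have "u < f x" "u < g x" using uv by auto
  moreover have "f x < (if f x < v then v else v')" "g x < (if g x < v then v else v')" using v' by auto
  ultimately obtain c d where cd: "c < x" "x < d" "\<forall>y. c < y \<and> y < d \<longrightarrow> u < f y \<and> f y < (if f x < v then v else v')
      \<and> u < g y \<and> g y < (if g x < v then v else v')"
    using cont_both[OF assms] by metis
  have "f x < v \<or> g x < v" using uv by (simp add: min_less_iff_disj)
  with cd(3) have "\<forall>y. c < y \<and> y < d \<longrightarrow> u < min (f y) (g y) \<and> min (f y) (g y) < v"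
    by (auto simp: min_less_iff_disj)
  with cd show "\<exists>c d. c < x \<and> x < d \<and> (\<forall>y. c < y \<and> y < d \<longrightarrow> u < min (f y) (g y) \<and> min (f y) (g y) < v)"
    by blast
qed

lemma cont_max:
  assumes "cont f x" "cont g x"
  shows "cont (\<lambda>y. max (f y) (g y)) x"
  unfolding cont_def
proof (intro allI impI)
  fix u v assume uv: "u < max (f x) (g x) \<and> max (f x) (g x) < v"
  obtain u' where u': "u' < min (f x) (g x)" using ex_lt by blast
  have "f x < v" "g x < v" using uv by auto
  moreover have "(if u < f x then u else u') < f x" "(if u < g x then u else u') < g x" using u' by auto
  ultimately obtain c d where cd: "c < x" "x < d" "\<forall>y. c < y \<and> y < d \<longrightarrow> (if u < f x then u else u') < f y \<and> f y < v
      \<and> (if u < g x then u else u') < g y \<and> g y < v"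
    using cont_both[OF assms] by metis
  have "u < f x \<or> u < g x" using uv by (simp add: less_max_iff_disj)
  with cd(3) have "\<forall>y. c < y \<and> y < d \<longrightarrow> u < max (f y) (g y) \<and> max (f y) (g y) < v"
    by (auto simp: less_max_iff_disj)
  with cd show "\<exists>c d. c < x \<and> x < d \<and> (\<forall>y. c < y \<and> y < d \<longrightarrow> u < max (f y) (g y) \<and> max (f y) (g y) < v)"
    by blast
qed

lemma cont_local:
  assumes "cont h x" "c < x" "x < d" "\<And>y. c < y \<Longrightarrow> y < d \<Longrightarrow> f y = h y"
  shows "cont f x"
  unfolding cont_def
proof (intro allI impI)
  fix u v assume "u < f x \<and> f x < v"
  then obtain a b where "a < x" "x < b" "\<forall>y. a < y \<and> y < b \<longrightarrow> u < h y \<and> h y < v"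
    using assms(1)[unfolded cont_def, THEN spec[of _ u], THEN spec[of _ v]] assms(4)[OF assms(2,3)] by auto
  then show "\<exists>c d. c < x \<and> x < d \<and> (\<forall>y. c < y \<and> y < d \<longrightarrow> u < f y \<and> f y < v)"
    by (intro exI[of _ "max a c"] exI[of _ "min b d"]) (use assms in auto)
qed

lemma Min_insert_step:
  assumes "finite S"
  shows "Min (insert (k::'a) (f ` insert a S)) = min (f a) (Min (insert k (f ` S)))"
proof -
  have "insert k (f ` insert a S) = insert (f a) (insert k (f ` S))" by auto
  then show ?thesis using assms by simp
qed

lemma cont_Min:
  assumes "finite S" "\<And>z. z \<in> S \<Longrightarrow> cont (\<lambda>y. f z y) x"
  shows "cont (\<lambda>y. Min (insert k ((\<lambda>z. f z y) ` S))) x"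
  using assms
proof (induction rule: finite_induct)
  case empty then show ?case by (simp add: cont_const)
next
  case (insert a S)
  then show ?case unfolding Min_insert_step[OF insert.hyps(1)] by (intro cont_min) auto
qed

lemma dterm_Min:
  assumes "finite S" "\<And>z. z \<in> S \<Longrightarrow> dterm M (\<lambda>s. f z (s 0))"
  shows "dterm M (\<lambda>s. Min (insert k ((\<lambda>z. f z (s 0)) ` S)))"
  using assms
proof (induction rule: finite_induct)
  case empty then show ?case by (simp add: dterm_const)
next
  case (insert a S)
  then show ?case unfolding Min_insert_step[OF insert.hyps(1)] by (intro dterm_min) auto
qed

lemma finite_uniform_pos:
  assumes "finite S" "\<And>z. z \<in> S \<Longrightarrow> \<exists>r>0. Q z r" "\<And>z r r'. Q z r \<Longrightarrow> 0 < r' \<Longrightarrow> r' \<le> r \<Longrightarrow> Q z r'"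
  shows "\<exists>r::'a>0. \<forall>z\<in>S. Q z r"
  using assms(1,2)
proof (induction rule: finite_induct)
  case empty then show ?case using ex_pos by blast
next
  case (insert a S)
  then obtain r r' where r: "0 < r" "\<forall>z\<in>S. Q z r" "0 < r'" "Q a r'" by blast
  then have "0 < min r r'" "min r r' \<le> r" "min r r' \<le> r'" by auto
  then have "\<forall>z\<in>insert a S. Q z (min r r')" using r assms(3) by blast
  then show ?case using \<open>0 < min r r'\<close> by blast
qed

text \<open>Boundedness excludes rays, so all intervals of a decomposition have end points in M.
  These and the isolated points make up \<open>Q\<close>, which need not be contained in
  \<open>A\<close>.\<close>

lemma decompose_bounded:
  assumes "dset M A" "\<And>x. x \<in> A \<Longrightarrow> l \<le> x \<and> x \<le> h"
  shows "\<exists>Q. finite Q \<and> (\<forall>x\<in>A - Q. \<exists>a\<in>Q. \<exists>b\<in>Q. a < x \<and> x < b \<and> {a<..<b} \<subseteq> A)"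
proof -
  have "(\<forall>x\<in>A. l \<le> x \<and> x \<le> h) \<longrightarrow>
    (\<exists>Q. finite Q \<and> (\<forall>x\<in>A - Q. \<exists>a\<in>Q. \<exists>b\<in>Q. a < x \<and> x < b \<and> {a<..<b} \<subseteq> A))"
    using assms(1)
  proof (induction rule: dset_induct)
    case empty
    show ?case by (intro impI exI[of _ "{}"]) auto
  next
    case (point p)
    show ?case by (intro impI exI[of _ "{p}"]) auto
  next
    case (interval I)
    show ?case
    proof
      assume bnd: "\<forall>x\<in>I. l \<le> x \<and> x \<le> h"
      have "\<exists>y>a. y > h" for a using ex_gt[of "max a h"] by auto
      moreover have "\<exists>y<b. y < l" for b using ex_lt[of "min b l"] by auto
      ultimately have "\<not> {a<..} \<subseteq> I" "\<not> {..<b} \<subseteq> I" for a b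
        using bnd by (meson greaterThan_iff lessThan_iff leD subsetD)+
      then have "\<exists>a b. I = {a<..<b}"
        using interval unfolding open_intervals_def by blast
      then obtain a b where "I = {a<..<b}" by blast
      then show "\<exists>Q. finite Q \<and> (\<forall>x\<in>I - Q. \<exists>a\<in>Q. \<exists>b\<in>Q. a < x \<and> x < b \<and> {a<..<b} \<subseteq> I)"
        by (intro exI[of _ "{a,b}"]) auto
    qed
  next
    case (union A B)
    show ?case
    proof
      assume "\<forall>x\<in>A \<union> B. l \<le> x \<and> x \<le> h"
      then have "\<forall>x\<in>A. l \<le> x \<and> x \<le> h" "\<forall>x\<in>B. l \<le> x \<and> x \<le> h" by auto
      note AB = mp[OF union.IH(1) this(1)] mp[OF union.IH(2) this(2)]
      obtain Q where Q: "finite Q" "\<forall>x\<in>A - Q. \<exists>a\<in>Q. \<exists>b\<in>Q. a < x \<and> x < b \<and> {a<..<b} \<subseteq> A"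
        using AB(1) by (elim exE conjE) (rule that)
      obtain Q' where Q': "finite Q'" "\<forall>x\<in>B - Q'. \<exists>a\<in>Q'. \<exists>b\<in>Q'. a < x \<and> x < b \<and> {a<..<b} \<subseteq> B"
        using AB(2) by (elim exE conjE) (rule that)
      from Q Q' show "\<exists>Q. finite Q \<and> (\<forall>x\<in>A \<union> B - Q. \<exists>a\<in>Q. \<exists>b\<in>Q. a < x \<and> x < b \<and> {a<..<b} \<subseteq> A \<union> B)"
        by (intro exI[of _ "Q \<union> Q'"]) (simp, blast)
    qed
  qed
  then show ?thesis using assms(2) by blast
qed

text \<open>The distance to the complement of \<open>(s, t)\<close>: it rises with slope one up to
  the midpoint and falls with slope minus one behind it, so that it is expressible in the ordered
  group.\<close>

definition tent :: "'a \<Rightarrow> 'a \<Rightarrow> 'a \<Rightarrow> 'a" where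
  "tent s t y = max 0 (min (y - s) (t - y))"

lemma cont_tent: "cont (tent s t) x"
  unfolding tent_def[abs_def] by (intro cont_max cont_min cont_const cont_shift cont_reflect)

lemma dterm_tent: "dterm M (\<lambda>r. tent s t (r 0))"
  unfolding tent_def by (intro dterm_max dterm_min dterm_minus dterm_var dterm_const)

lemma tent_pos: "0 < tent s t y \<longleftrightarrow> s < y \<and> y < t"
  by (auto simp: tent_def less_max_iff_disj og.diff_gt_0_iff_gt)

lemma tent_zero: "\<not> (s < y \<and> y < t) \<Longrightarrow> tent s t y = 0"
  using tent_pos[of s t y] by (auto simp: tent_def max_def)

lemma tent_left:
  assumes "c - a = b - c" "a < y" "y < (c::'a)"
  shows "tent a b y = y - a"
proof -
  have "y - a < c - a" by (rule og.diff_strict_right_mono) fact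
  moreover have "b - c < b - y" by (rule og.diff_strict_left_mono) fact
  ultimately have "y - a < b - y" unfolding assms(1) by (rule less_trans)
  moreover have "0 < y - a" using assms by (simp add: og.diff_gt_0_iff_gt)
  ultimately show ?thesis by (auto simp: tent_def max_def min_def)
qed

lemma tent_right:
  assumes "c - a = b - c" "c < y" "y < (b::'a)"
  shows "tent a b y = b - y"
proof -
  have "c - a < y - a" by (rule og.diff_strict_right_mono) fact
  moreover have "b - y < b - c" by (rule og.diff_strict_left_mono) fact
  ultimately have "b - y < y - a" unfolding assms(1) by (rule_tac less_trans)
  moreover have "0 < b - y" using assms by (simp add: og.diff_gt_0_iff_gt)
  ultimately show ?thesis by (auto simp: tent_def max_def min_def)
qed

lemma midpoint:
  assumes "a < (b::'a)"
  shows "\<exists>c. a < c \<and> c < b \<and> c - a = b - c"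
proof -
  obtain h where h: "h > 0" "h + h = b - a" using half_pos[of "b - a"] assms by (auto simp: og.diff_gt_0_iff_gt)
  have "b = a + h + h" using h(2) by (metis add.assoc og.add.commute og.diff_add_cancel)
  then have "a + h - a = b - (a + h)" by (simp add: og.add.commute)
  moreover have "a < a + h" "a + h < b"
    using h(1) gadd_less_left[of a 0 h] gadd_less_left[of "a + h" 0 h] \<open>b = a + h + h\<close> by auto
  ultimately show ?thesis by blast
qed

end

section \<open>Functions on the line with the new topology\<close>

context line_basis
begin

text \<open>Continuity at \<open>x\<close> need only be checked along the germs that converge to
  \<open>x\<close>: \<open>neighbourhood_inside\<close> is applied to the set where the bounds
  fail.\<close>

lemma continuous_via_germs:
  assumes "dterm M (\<lambda>s. g (s 0))" "x \<in> L" "u < g x" "g x < v"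
    and "\<And>d z. conv d z x \<Longrightarrow> eventually (\<lambda>w. u < g w \<and> g w < v) (germ d z)"
  shows "\<exists>b\<in>cpow m. R b x \<and> (\<forall>w. R b w \<longrightarrow> u < g w \<and> g w < v)"
proof -
  have "dset M (L \<inter> {w. \<not> (u < g w \<and> g w < v)})"
    by (intro dset_Int dset_L dsetI dintros assms(1))
  then have "\<exists>b\<in>cpow m. R b x \<and> (\<forall>w. R b w \<longrightarrow> w \<notin> L \<inter> {w. \<not> (u < g w \<and> g w < v)})"
  proof (rule neighbourhood_inside)
    fix d z assume "conv d z x"
    from assms(5)[OF this] show "eventually (\<lambda>w. w \<notin> L \<inter> {w. \<not> (u < g w \<and> g w < v)}) (germ d z)"
      by (rule eventually_mono) auto
  qed (use assms in auto)
  then show ?thesis using basis_sub by blast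
qed

lemma cont_germ:
  assumes "cont g z" "u < g z" "g z < v"
  shows "eventually (\<lambda>w. u < g w \<and> g w < v) (germ d z)"
proof -
  obtain a b where "a < z" "z < b" "\<forall>y. a < y \<and> y < b \<longrightarrow> u < g y \<and> g y < v"
    using assms(1)[unfolded cont_def, THEN spec[of _ u], THEN spec[of _ v]] assms(2,3) by auto
  then show ?thesis using germ_near[of a z b d] by (auto elim: eventually_mono)
qed

text \<open>\<open>S\<close> is a neighbourhood of \<open>x\<close> in the initial topology that
  \<open>F\<close> induces on \<open>L\<close>; for finite \<open>F\<close> the bounds
  \<open>u\<close> and \<open>v\<close> are the corners of a box in the target of the evaluation
  map.\<close>

definition separates :: "('a \<Rightarrow> 'a) set \<Rightarrow> 'a \<Rightarrow> 'a set \<Rightarrow> bool" where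
  "separates F x S \<longleftrightarrow> (\<exists>u v. (\<forall>g\<in>F. u g < g x \<and> g x < v g) \<and>
     (\<forall>w\<in>L. (\<forall>g\<in>F. u g < g w \<and> g w < v g) \<longrightarrow> w \<in> S))"

lemma separates_basic:
  assumes "g \<in> F" "u < g x" "g x < v" "\<And>w. w \<in> L \<Longrightarrow> u < g w \<Longrightarrow> g w < v \<Longrightarrow> w \<in> S"
  shows "separates F x S"
proof -
  define u' where "u' f = (if f = g then u else SOME a. a < f x)" for f
  define v' where "v' f = (if f = g then v else SOME a. f x < a)" for f
  have "u' f < f x" "f x < v' f" for f
    using assms(2,3) someI_ex[OF ex_lt[of "f x"]] someI_ex[OF ex_gt[of "f x"]] by (auto simp: u'_def v'_def)
  moreover have "w \<in> S" if "w \<in> L" "\<forall>f\<in>F. u' f < f w \<and> f w < v' f" for w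
    using that assms(1) assms(4)[of w] by (auto simp: u'_def v'_def)
  ultimately show ?thesis unfolding separates_def by blast
qed

lemma separates_Int:
  assumes "separates F x S" "separates F x T"
  shows "separates F x (S \<inter> T)"
proof -
  obtain u v where 1: "\<forall>g\<in>F. u g < g x \<and> g x < v g" "\<forall>w\<in>L. (\<forall>g\<in>F. u g < g w \<and> g w < v g) \<longrightarrow> w \<in> S"
    using assms(1) unfolding separates_def by blast
  obtain u' v' where 2: "\<forall>g\<in>F. u' g < g x \<and> g x < v' g" "\<forall>w\<in>L. (\<forall>g\<in>F. u' g < g w \<and> g w < v' g) \<longrightarrow> w \<in> T"
    using assms(2) unfolding separates_def by blast
  show ?thesis unfolding separates_def
    by (rule exI[of _ "\<lambda>g. max (u g) (u' g)"], rule exI[of _ "\<lambda>g. min (v g) (v' g)"]) (use 1 2 in auto)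
qed

lemma separates_mono: "separates F x S \<Longrightarrow> (\<And>w. w \<in> L \<Longrightarrow> w \<in> S \<Longrightarrow> w \<in> T) \<Longrightarrow> separates F x T"
  unfolding separates_def by (elim exE conjE) (intro exI conjI, assumption, blast)

text \<open>The space is a graph with finitely many vertices, the points of \<open>Q\<close> in \<open>L\<close>, whose edges are
  intervals. The tent functions embed the edges; midpoints are added to the vertices in order to
  tell apart the two halves of an edge. For a vertex \<open>p\<close> the function \<open>vert p\<close> is the distance to
  \<open>p\<close> along the germs converging to \<open>p\<close>, truncated at a small constant \<open>k\<close>.\<close>

theorem embedding:
  assumes "finite {z \<in> L. \<not> good z}"
  shows "\<exists>F. finite F \<and> (\<forall>g\<in>F. dterm M (\<lambda>s. g (s 0))) \<and>
    (\<forall>g\<in>F. \<forall>x\<in>L. \<forall>u v. u < g x \<and> g x < v \<longrightarrow> (\<exists>b\<in>cpow m. R b x \<and> (\<forall>w. R b w \<longrightarrow> u < g w \<and> g w < v))) \<and>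
    (\<forall>x\<in>L. \<forall>b\<in>cpow m. R b x \<longrightarrow> separates F x {w. R b w})"
proof -
  obtain P where P: "finite P" "\<forall>y\<in>L - P. good y \<and> (\<forall>d z. conv d z y \<longrightarrow> z = y)"
    using cofinitely_affine[OF assms] by blast
  have "dset M (L - P)" by (intro dset_Diff dset_L dset_finite P(1))
  from decompose_bounded[OF this, of lo hi] L_bounds
  obtain Q0 where Q0: "finite Q0" "\<forall>x\<in>L - P - Q0. \<exists>a\<in>Q0. \<exists>b\<in>Q0. a < x \<and> x < b \<and> {a<..<b} \<subseteq> L - P"
    by blast
  define E where "E d = {z. \<exists>y\<in>L. y \<noteq> z \<and> conv d z y}" for d
  \<comment> \<open>Besides the end points of the edges, the exceptional points and the base points
    of foreign germs are made vertices, so that germs at all other points can only converge to their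
    own base point.\<close>
  define Q1 where "Q1 = Q0 \<union> P \<union> E True \<union> E False"
  have "finite Q1" unfolding Q1_def E_def using Q0(1) P(1) foreign_finite[OF assms] by blast
  define edge where "edge a b \<longleftrightarrow> a \<in> Q1 \<and> b \<in> Q1 \<and> a < b \<and> {a<..<b} \<subseteq> L - P" for a b
  have in_edge: "\<exists>a b. edge a b \<and> a < x \<and> x < b" if x: "x \<in> L - Q1" for x
  proof -
    have "x \<in> L - P - Q0" using x by (auto simp: Q1_def)
    with Q0(2) obtain a b where ab: "a \<in> Q0" "b \<in> Q0" "a < x" "x < b" "{a<..<b} \<subseteq> L - P" by blast
    then have "edge a b" unfolding edge_def Q1_def by auto
    with ab show ?thesis by blast
  qed
  define mid where "mid a b = (SOME c. a < c \<and> c < b \<and> c - a = b - c)" for a b :: 'a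
  have mid: "a < mid a b" "mid a b < b" "mid a b - a = b - mid a b" if "a < b" for a b
    using someI_ex[OF midpoint[OF that]] unfolding mid_def by blast+
  define Q where "Q = Q1 \<union> (\<lambda>(a, b). mid a b) ` (Q1 \<times> Q1)"
  have "finite Q" using \<open>finite Q1\<close> by (simp add: Q_def)
  have "Q1 \<subseteq> Q" by (auto simp: Q_def)
  have own: "conv d z y \<Longrightarrow> y \<in> L \<Longrightarrow> z \<notin> Q \<Longrightarrow> z = y" for d z y
    by (cases d) (auto simp: Q_def Q1_def E_def)
  have own': "conv d z y \<Longrightarrow> y \<in> L \<Longrightarrow> y \<notin> P \<Longrightarrow> z = y" for d z y
    using P(2) by blast
  have "P \<subseteq> Q" by (auto simp: Q_def Q1_def)
  obtain e where e: "e > 0" "\<forall>y\<in>Q. \<forall>y'\<in>Q. y < y' \<longrightarrow> y + e \<le> y'"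
    using finite_gap[OF \<open>finite Q\<close>] by blast
  \<comment> \<open>Since \<open>k\<close> is smaller than every gap of \<open>Q\<close>, a distance
    measured from one point of \<open>Q\<close> exceeds \<open>k\<close> at all the others.\<close>
  obtain k where k: "0 < k" "k < e" using dense e(1) by blast
  have gap: "y + k < y'" if "y \<in> Q" "y' \<in> Q" "y < y'" for y y'
    using e(2) that k(2) gadd_less_left[of y k e] by (meson less_le_trans)
  \<comment> \<open>One-sided distances to a base point \<open>z\<close>, with the default
    \<open>k\<close> on the other side and at \<open>z\<close> itself; \<open>c0\<close> supplies
    the value 0 at the vertex, which need not be a base point of any germ that converges to it. The
    minimum with \<open>k\<close> truncates all of them.\<close>
  define cR where "cR z y = (if z < y then y - z else k)" for z y
  define cL where "cL z y = (if y < z then z - y else k)" for z y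
  define c0 where "c0 p y = (if y = p then 0 else k)" for p y :: 'a
  define Z where "Z d p = {z. conv d z p}" for d p
  have Z_sub: "Z d p \<subseteq> Q" if "p \<in> Q \<inter> L" for d p using own that by (auto simp: Z_def)
  then have Z_fin: "finite (Z d p)" if "p \<in> Q \<inter> L" for d p using that \<open>finite Q\<close> finite_subset by meson
  define vert where "vert p y = min (c0 p y) (min (Min (insert k ((\<lambda>z. cR z y) ` Z True p)))
      (Min (insert k ((\<lambda>z. cL z y) ` Z False p))))" for p y
  have vert_less: "vert p y < r \<longleftrightarrow> c0 p y < r \<or> k < r \<or> (\<exists>z\<in>Z True p. cR z y < r) \<or> (\<exists>z\<in>Z False p. cL z y < r)"
    if "p \<in> Q \<inter> L" for p y r
    using Z_fin[OF that] by (auto simp: vert_def min_less_iff_disj Min_less_iff)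
  have vert_ge: "r \<le> vert p y \<longleftrightarrow> r \<le> c0 p y \<and> r \<le> k \<and> (\<forall>z\<in>Z True p. r \<le> cR z y) \<and> (\<forall>z\<in>Z False p. r \<le> cL z y)"
    if "p \<in> Q \<inter> L" for p y r
    using vert_less[OF that, of y r] by (auto simp: not_less[symmetric])
  have vert_nonneg: "0 \<le> vert p y" if "p \<in> Q \<inter> L" for p y
    using vert_ge[OF that, of 0 y] k(1) by (auto simp: c0_def cR_def cL_def)
  have vert_le: "vert p y \<le> k" for p y
    by (auto simp: vert_def c0_def k(1) min_le_iff_disj) (use k(1) in auto)
  have vert_self: "vert p p = 0" if "p \<in> Q \<inter> L" for p
    using vert_nonneg[OF that, of p] by (auto simp: vert_def c0_def min_def)
  have dterm_vert: "dterm M (\<lambda>s. vert p (s 0))" if "p \<in> Q \<inter> L" for p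
    unfolding vert_def c0_def cR_def cL_def
    by (intro dterm_min dterm_Min dterm_if dpred_eq dpred_less dterm_minus dterm_var dterm_const Z_fin[OF that])
  have cont_vert: "cont (vert p) x" if "p \<in> Q \<inter> L" "x \<notin> Q" for p x
  proof -
    have "cont (c0 p) x"
    proof (cases "x < p")
      case True
      obtain u where "u < x" using ex_lt by blast
      show ?thesis by (rule cont_local[OF cont_const \<open>u < x\<close> True, of _ k]) (auto simp: c0_def)
    next
      case False
      then have "p < x" using that by (cases p x rule: linorder_cases) auto
      obtain u where "x < u" using ex_gt by blast
      show ?thesis by (rule cont_local[OF cont_const \<open>p < x\<close> \<open>x < u\<close>, of _ k]) (auto simp: c0_def)
    qed
    moreover have "cont (cR z) x" if "z \<in> Q" for z
    proof (cases "x < z")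
      case True
      obtain u where "u < x" using ex_lt by blast
      show ?thesis by (rule cont_local[OF cont_const \<open>u < x\<close> True, of _ k]) (auto simp: cR_def)
    next
      case False
      then have "z < x" using that \<open>x \<notin> Q\<close> by (cases z x rule: linorder_cases) auto
      obtain u where "x < u" using ex_gt by blast
      show ?thesis by (rule cont_local[OF cont_shift \<open>z < x\<close> \<open>x < u\<close>, of _ z]) (auto simp: cR_def)
    qed
    moreover have "cont (cL z) x" if "z \<in> Q" for z
    proof (cases "x < z")
      case True
      obtain u where "u < x" using ex_lt by blast
      show ?thesis by (rule cont_local[OF cont_reflect \<open>u < x\<close> True, of _ z]) (auto simp: cL_def)
    next
      case False
      then have "z < x" using that \<open>x \<notin> Q\<close> by (cases z x rule: linorder_cases) auto
      obtain u where "x < u" using ex_gt by blast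
      show ?thesis by (rule cont_local[OF cont_const \<open>z < x\<close> \<open>x < u\<close>, of _ k]) (auto simp: cL_def)
    qed
    ultimately show ?thesis unfolding vert_def[abs_def]
      using Z_sub[OF that(1)] by (intro cont_min cont_Min Z_fin[OF that(1)]) auto
  qed
  \<comment> \<open>At \<open>p\<close> itself one of the distances tends to 0 along each converging
    germ. At a point outside of \<open>Q\<close> the function is continuous in the order. At another
    vertex the value is \<open>k\<close>, and it stays \<open>k\<close> along the germ, because a
    germ converging to \<open>x\<close> does not converge to \<open>p\<close>.\<close>
  have vert_germ: "eventually (\<lambda>w. u < vert p w \<and> vert p w < v) (germ d z)"
    if p: "p \<in> Q \<inter> L" and x: "x \<in> L" and conv: "conv d z x" and uv: "u < vert p x" "vert p x < v" for p x d z u v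
  proof (cases "x = p")
    case True
    have "u < 0" "0 < v" using uv True vert_self[OF p] by auto
    have "eventually (\<lambda>w. vert p w < v) (germ d z)"
    proof (cases d)
      case True
      then have "z \<in> Z True p" using conv \<open>x = p\<close> by (simp add: Z_def)
      have "eventually (\<lambda>w. z < w \<and> w < z + v) (germ True z)"
        unfolding eventually_germ_True using \<open>0 < v\<close> gadd_less_left[of z 0 v] by (intro exI[of _ "z + v"]) simp
      then have "eventually (\<lambda>w. vert p w < v) (germ True z)"
      proof (rule eventually_mono)
        fix w assume "z < w \<and> w < z + v"
        then have "cR z w < v" by (simp add: cR_def og.diff_less_eq og.add.commute)
        then show "vert p w < v" using vert_less[OF p] \<open>z \<in> Z True p\<close> by blast
      qed
      then show ?thesis using True by simp
    next
      case False
      then have "z \<in> Z False p" using conv \<open>x = p\<close> by (simp add: Z_def)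
      have "eventually (\<lambda>w. z - v < w \<and> w < z) (germ False z)"
        unfolding eventually_germ_False using \<open>0 < v\<close> by (intro exI[of _ "z - v"]) (simp add: og.diff_less_eq)
      then have "eventually (\<lambda>w. vert p w < v) (germ False z)"
      proof (rule eventually_mono)
        fix w assume "z - v < w \<and> w < z"
        then have "cL z w < v" by (simp add: cL_def diff_less_swap[of z w v])
        then show "vert p w < v" using vert_less[OF p] \<open>z \<in> Z False p\<close> by blast
      qed
      then show ?thesis using False by simp
    qed
    then show ?thesis
      by (rule eventually_mono) (use vert_nonneg[OF p] \<open>u < 0\<close> less_le_trans in blast)
  next
    case False
    show ?thesis
    proof (cases "z \<in> Q")
      case False
      then have "z = x" using own conv x by blast
      then show ?thesis using cont_germ[OF cont_vert[OF p False]] uv by simp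
    next
      case True
      have "x \<in> Q"
      proof (rule ccontr)
        assume "x \<notin> Q"
        then have "x \<notin> P" using \<open>P \<subseteq> Q\<close> by blast
        then show False using own'[OF conv x] True \<open>x \<notin> Q\<close> by blast
      qed
      have far: "k \<le> cR y w" if "y + k \<le> w \<or> w \<le> y" for y w
        using that by (auto simp: cR_def og.le_diff_eq og.add.commute)
      have far': "k \<le> cL y w" if "w + k \<le> y \<or> y \<le> w" for y w
        using that by (auto simp: cL_def og.le_diff_eq og.add.commute)
      have "k \<le> vert p x"
        unfolding vert_ge[OF p]
      proof (intro conjI ballI)
        show "k \<le> c0 p x" using \<open>x \<noteq> p\<close> by (simp add: c0_def)
        show "k \<le> cR y x" if "y \<in> Z True p" for y
          using that Z_sub[OF p] \<open>x \<in> Q\<close> gap[of y x] by (intro far) fastforce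
        show "k \<le> cL y x" if "y \<in> Z False p" for y
          using that Z_sub[OF p] \<open>x \<in> Q\<close> gap[of x y] by (intro far') fastforce
      qed simp
      then have "vert p x = k" using vert_le[of p x] by (rule_tac antisym)
      have "eventually (\<lambda>w. k \<le> c0 p w) (germ d z)"
      proof -
        have "eventually (\<lambda>w. w \<noteq> p) (germ d z)"
        proof (cases z p rule: linorder_cases)
          case equal
          have "eventually (\<lambda>w. w \<noteq> p) (germ True p)" "eventually (\<lambda>w. w \<noteq> p) (germ False p)"
            unfolding eventually_germ_True eventually_germ_False using ex_gt[of p] ex_lt[of p] by auto
          then show ?thesis using equal by (cases d) auto
        next
          case less
          obtain u where "u < z" using ex_lt by blast
          show ?thesis by (rule eventually_mono[OF germ_near[OF \<open>u < z\<close> less]]) auto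
        next
          case greater
          obtain u where "z < u" using ex_gt by blast
          show ?thesis by (rule eventually_mono[OF germ_near[OF greater \<open>z < u\<close>]]) auto
        qed
        then show ?thesis by (rule eventually_mono) (simp add: c0_def)
      qed
      moreover have "eventually (\<lambda>w. \<forall>y\<in>Z True p. k \<le> cR y w) (germ d z)"
      proof (intro eventually_ball_finite ballI Z_fin[OF p])
        fix y assume y: "y \<in> Z True p"
        then have "y \<in> Q" using Z_sub[OF p] by blast
        show "eventually (\<lambda>w. k \<le> cR y w) (germ d z)"
        proof (cases z y rule: linorder_cases)
          case less
          obtain u where "u < z" using ex_lt by blast
          show ?thesis by (rule eventually_mono[OF germ_near[OF \<open>u < z\<close> less]]) (auto intro: far)
        next
          case greater
          obtain u where "z < u" using ex_gt by blast
          show ?thesis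
            by (rule eventually_mono[OF germ_near[OF gap[OF \<open>y \<in> Q\<close> True greater] \<open>z < u\<close>]]) (auto intro: far)
        next
          case equal
          \<comment> \<open>The right-hand germ at \<open>z\<close> converges to \<open>p\<close>,
            so a germ at \<open>z\<close> that converges to \<open>x\<close> must be the left-hand
            one; there \<open>cR\<close> has its default value \<open>k\<close>.\<close>
          have "\<not> d"
          proof
            assume "d"
            then have "conv True z x" "conv True z p" using conv y equal by (auto simp: Z_def)
            then show False using conv_unique x p \<open>x \<noteq> p\<close> by blast
          qed
          moreover have "eventually (\<lambda>w. k \<le> cR y w) (germ False z)"
          proof -
            obtain u where "u < z" using ex_lt by blast
            then show ?thesis unfolding eventually_germ_False using equal
              by (intro exI[of _ u] conjI allI impI far) auto
          qed
          ultimately show ?thesis by simp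
        qed
      qed
      moreover have "eventually (\<lambda>w. \<forall>y\<in>Z False p. k \<le> cL y w) (germ d z)"
      proof (intro eventually_ball_finite ballI Z_fin[OF p])
        fix y assume y: "y \<in> Z False p"
        then have "y \<in> Q" using Z_sub[OF p] by blast
        show "eventually (\<lambda>w. k \<le> cL y w) (germ d z)"
        proof (cases z y rule: linorder_cases)
          case less
          have "z < y - k" using gap[OF True \<open>y \<in> Q\<close> less] by (simp add: og.less_diff_eq)
          obtain u where "u < z" using ex_lt by blast
          show ?thesis
          proof (rule eventually_mono[OF germ_near[OF \<open>u < z\<close> \<open>z < y - k\<close>]])
            fix w assume "u < w \<and> w < y - k"
            then have "w + k \<le> y" by (simp add: og.less_diff_eq less_imp_le)
            then show "k \<le> cL y w" by (intro far') simp
          qed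
        next
          case greater
          obtain u where "z < u" using ex_gt by blast
          show ?thesis by (rule eventually_mono[OF germ_near[OF greater \<open>z < u\<close>]]) (auto intro: far')
        next
          case equal
          have "d"
          proof (rule ccontr)
            assume "\<not> d"
            then have "conv False z x" "conv False z p" using conv y equal by (auto simp: Z_def)
            then show False using conv_unique x p \<open>x \<noteq> p\<close> by blast
          qed
          moreover have "eventually (\<lambda>w. k \<le> cL y w) (germ True z)"
          proof -
            obtain u where "z < u" using ex_gt by blast
            then show ?thesis unfolding eventually_germ_True using equal
              by (intro exI[of _ u] conjI allI impI far') auto
          qed
          ultimately show ?thesis by simp
        qed
      qed
      ultimately have "eventually (\<lambda>w. k \<le> vert p w) (germ d z)"
        unfolding vert_ge[OF p] by (auto simp: eventually_conj_iff)
      then show ?thesis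
        by (rule eventually_mono) (use uv \<open>vert p x = k\<close> vert_le[of p] in \<open>auto intro: less_le_trans le_less_trans\<close>)
    qed
  qed
  \<comment> \<open>At exceptional points the tent vanishes; a germ converging to such a point
    cannot be based in \<open>(s, t)\<close>, whose points are good and hence the limits of their
    own germs. At other points germ and limit have the same base.\<close>
  have tent_germ: "eventually (\<lambda>w. u < tent s t w \<and> tent s t w < v) (germ d z)"
    if st: "{s<..<t} \<subseteq> L - P" and x: "x \<in> L" and conv: "conv d z x" and uv: "u < tent s t x" "tent s t x < v"
    for s t x d z u v
  proof -
    have "tent s t z = tent s t x"
    proof (cases "x \<in> P")
      case False
      then show ?thesis using own'[OF conv x] by simp
    next
      case True
      then have x0: "tent s t x = 0" using st by (intro tent_zero) auto
      have "\<not> (s < z \<and> z < t)"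
      proof
        assume "s < z \<and> z < t"
        then have "z \<in> L - P" using st by auto
        then have "conv d z z" using P(2) good_conv by blast
        then have "z = x" using conv_unique[OF _ x _ conv] \<open>z \<in> L - P\<close> by blast
        then show False using True \<open>z \<in> L - P\<close> by blast
      qed
      then show ?thesis using x0 tent_zero by simp
    qed
    then show ?thesis using cont_germ[OF cont_tent] uv by simp
  qed
  define F where "F = vert ` (Q \<inter> L) \<union> (\<lambda>(s, t). tent s t) ` {(s, t) \<in> Q \<times> Q. {s<..<t} \<subseteq> L - P}"
  have tentF: "tent s t \<in> F" if "s \<in> Q" "t \<in> Q" "{s<..<t} \<subseteq> L - P" for s t
    using that by (auto simp: F_def)
  have "finite F"
  proof -
    have "finite {(s, t) \<in> Q \<times> Q. {s<..<t} \<subseteq> L - P}"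
      by (rule finite_subset[of _ "Q \<times> Q"]) (use \<open>finite Q\<close> in auto)
    then show ?thesis unfolding F_def using \<open>finite Q\<close> by blast
  qed
  moreover have "dterm M (\<lambda>s. g (s 0))" if "g \<in> F" for g
    using that dterm_vert dterm_tent by (auto simp: F_def)
  moreover have "\<exists>b\<in>cpow m. R b x \<and> (\<forall>w. R b w \<longrightarrow> u < g w \<and> g w < v)"
    if "g \<in> F" "x \<in> L" "u < g x \<and> g x < v" for g x u v
  proof (rule continuous_via_germs)
    fix d z assume conv: "conv d z x"
    consider p where "p \<in> Q \<inter> L" "g = vert p" | s t where "{s<..<t} \<subseteq> L - P" "g = tent s t"
      using \<open>g \<in> F\<close> by (auto simp: F_def)
    then show "eventually (\<lambda>w. u < g w \<and> g w < v) (germ d z)"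
    proof cases
      case (1 p)
      then show ?thesis using vert_germ[OF 1(1) \<open>x \<in> L\<close> conv, of u v] \<open>u < g x \<and> g x < v\<close> by simp
    next
      case (2 s t)
      then show ?thesis using tent_germ[OF 2(1) \<open>x \<in> L\<close> conv, of u v] \<open>u < g x \<and> g x < v\<close> by simp
    qed
  qed (use that \<open>\<And>g. g \<in> F \<Longrightarrow> dterm M (\<lambda>s. g (s 0))\<close> in auto)
  moreover have "separates F x {w. R b w}" if x: "x \<in> L" and b: "b \<in> cpow m" "R b x" for x b
  proof (cases "x \<in> Q")
    case True
    then have p: "x \<in> Q \<inter> L" using x by blast
    \<comment> \<open>A neighbourhood of a vertex contains an initial piece of each of the finitely
      many germs converging to it; a common length for these pieces is determined for each
      side.\<close>
    have "\<exists>r>0. \<forall>z\<in>Z True x. \<forall>y. z < y \<and> y < z + r \<longrightarrow> R b y"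
    proof (rule finite_uniform_pos[OF Z_fin[OF p]])
      fix z assume "z \<in> Z True x"
      then have "eventually (R b) (germ True z)" using b by (auto simp: Z_def conv_def)
      then obtain c where c: "z < c" "\<forall>y. z < y \<and> y < c \<longrightarrow> R b y" unfolding eventually_germ_True by blast
      have "z + (c - z) = c" by (metis og.add.commute og.diff_add_cancel)
      then show "\<exists>r>0. \<forall>y. z < y \<and> y < z + r \<longrightarrow> R b y"
        using c by (intro exI[of _ "c - z"]) (simp add: og.diff_gt_0_iff_gt)
    next
      fix z r r' assume *: "\<forall>y. z < y \<and> y < z + r \<longrightarrow> R b y" "r' \<le> r"
      have "z + r' \<le> z + r" using *(2) by simp
      then show "\<forall>y. z < y \<and> y < z + r' \<longrightarrow> R b y" using *(1) less_le_trans by blast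
    qed
    then obtain r1 where r1: "r1 > 0" "\<forall>z\<in>Z True x. \<forall>y. z < y \<and> y < z + r1 \<longrightarrow> R b y" by blast
    have "\<exists>r>0. \<forall>z\<in>Z False x. \<forall>y. z - r < y \<and> y < z \<longrightarrow> R b y"
    proof (rule finite_uniform_pos[OF Z_fin[OF p]])
      fix z assume "z \<in> Z False x"
      then have "eventually (R b) (germ False z)" using b by (auto simp: Z_def conv_def)
      then obtain c where c: "c < z" "\<forall>y. c < y \<and> y < z \<longrightarrow> R b y" unfolding eventually_germ_False by blast
      have "z - (z - c) = c" by (metis add_diff_cancel og.add.commute og.diff_add_cancel)
      then show "\<exists>r>0. \<forall>y. z - r < y \<and> y < z \<longrightarrow> R b y"
        using c by (intro exI[of _ "z - c"]) (simp add: og.diff_gt_0_iff_gt)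
    next
      fix z r r' assume *: "\<forall>y. z - r < y \<and> y < z \<longrightarrow> R b y" "r' \<le> r"
      have "z - r \<le> z - r'" using *(2) by (rule og.diff_left_mono)
      then show "\<forall>y. z - r' < y \<and> y < z \<longrightarrow> R b y" using *(1) le_less_trans by blast
    qed
    then obtain r2 where r2: "r2 > 0" "\<forall>z\<in>Z False x. \<forall>y. z - r2 < y \<and> y < z \<longrightarrow> R b y" by blast
    \<comment> \<open>\<open>r \<le> k\<close> ensures that a value below \<open>r\<close> is a
      genuine distance and not the default \<open>k\<close>.\<close>
    define r where "r = min k (min r1 r2)"
    have r: "0 < r" "r \<le> k" "r \<le> r1" "r \<le> r2" using k(1) r1(1) r2(1) by (auto simp: r_def min_le_iff_disj)
    obtain u :: 'a where "u < 0" using ex_lt by blast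
    show ?thesis
    proof (rule separates_basic[of "vert x" F u x r])
      show "vert x \<in> F" using p by (auto simp: F_def)
      show "u < vert x x" "vert x x < r" using vert_self[OF p] \<open>u < 0\<close> r by auto
      fix w assume "w \<in> L" "vert x w < r"
      then consider "c0 x w < r" | z where "z \<in> Z True x" "cR z w < r" | z where "z \<in> Z False x" "cL z w < r"
        using vert_less[OF p] r(2) by (meson leD)
      then show "w \<in> {w. R b w}"
      proof cases
        case 1
        then have "w = x" using r(2) by (auto simp: c0_def split: if_splits)
        then show ?thesis using b by simp
      next
        case (2 z)
        then have "z < w" using r(2) by (auto simp: cR_def split: if_splits)
        moreover have "w - z < r1" using 2(2) r(3) \<open>z < w\<close> by (auto simp: cR_def)
        then have "w < z + r1" by (simp add: og.diff_less_eq og.add.commute)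
        ultimately show ?thesis using r1(2) 2(1) by blast
      next
        case (3 z)
        then have "w < z" using r(2) by (auto simp: cL_def split: if_splits)
        moreover have "z - w < r2" using 3(2) r(4) \<open>w < z\<close> by (auto simp: cL_def)
        then have "z - r2 < w" by (simp add: diff_less_swap[of z w])
        ultimately show ?thesis using r2(2) 3(1) by blast
      qed
    qed
  next
    case False
    then have "x \<in> L - Q1" using x \<open>Q1 \<subseteq> Q\<close> by blast
    then obtain a c where edge: "edge a c" and ac: "a < x" "x < c" using in_edge by blast
    then have acQ: "a \<in> Q" "c \<in> Q" "a < c" and sub: "{a<..<c} \<subseteq> L - P"
      using \<open>Q1 \<subseteq> Q\<close> by (auto simp: edge_def)
    define h where "h = mid a c"
    have h: "a < h" "h < c" "h - a = c - h" using mid[OF \<open>a < c\<close>] by (auto simp: h_def)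
    have "h \<in> Q" using edge by (auto simp: h_def Q_def edge_def)
    have "good x" using sub ac P(2) by auto
    then obtain l l' where l: "l < x" "x < l'" "\<forall>w. l < w \<and> w < l' \<longrightarrow> R b w"
      using b unfolding good_def by blast
    have F1: "tent a c \<in> F" using acQ sub by (intro tentF)
    \<comment> \<open>The condition that selects the right half of the edge is positivity of the
      tent over that half; \<open>B\<close> is a harmless upper bound. On the half so selected
      \<open>tent a c\<close> is a translation or a reflection and locates the point.\<close>
    obtain B where B: "tent a h x < B" "tent h c x < B" using ex_gt[of "max (tent a h x) (tent h c x)"] by auto
    have "x \<noteq> h" using False \<open>h \<in> Q\<close> by blast
    then consider "x < h" | "h < x" by force
    then show ?thesis
    proof cases
      case 1
      have "{a<..<h} \<subseteq> {a<..<c}" using h(2) by auto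
      then have "tent a h \<in> F" by (intro tentF acQ \<open>h \<in> Q\<close>) (use sub in blast)
      then have s1: "separates F x {a<..<h}"
        by (rule separates_basic[of _ _ 0 _ B]) (use 1 ac B in \<open>auto simp: tent_pos\<close>)
      have s2: "separates F x {w. l - a < tent a c w \<and> tent a c w < l' - a}"
      proof (rule separates_basic[OF F1, of "l - a" _ "l' - a"])
        show "l - a < tent a c x" "tent a c x < l' - a"
          unfolding tent_left[OF h(3) ac(1) 1] using l by (auto intro: og.diff_strict_right_mono)
      qed auto
      show ?thesis
      proof (rule separates_mono[OF separates_Int[OF s1 s2]])
        fix w assume "w \<in> {a<..<h} \<inter> {w. l - a < tent a c w \<and> tent a c w < l' - a}"
        then have "a < w" "w < h" "l - a < tent a c w" "tent a c w < l' - a" by auto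
        then have "l - a < w - a" "w - a < l' - a" using tent_left[OF h(3)] by auto
        then have "l < w" "w < l'" by (simp_all add: og.less_diff_eq og.diff_less_eq)
        then show "w \<in> {w. R b w}" using l(3) by blast
      qed
    next
      case 2
      have "{h<..<c} \<subseteq> {a<..<c}" using h(1) by auto
      then have "tent h c \<in> F" by (intro tentF acQ \<open>h \<in> Q\<close>) (use sub in blast)
      then have s1: "separates F x {h<..<c}"
        by (rule separates_basic[of _ _ 0 _ B]) (use 2 ac B in \<open>auto simp: tent_pos\<close>)
      have s2: "separates F x {w. c - l' < tent a c w \<and> tent a c w < c - l}"
      proof (rule separates_basic[OF F1, of "c - l'" _ "c - l"])
        show "c - l' < tent a c x" "tent a c x < c - l"
          unfolding tent_right[OF h(3) 2 ac(2)] using l by (auto intro: og.diff_strict_left_mono)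
      qed auto
      show ?thesis
      proof (rule separates_mono[OF separates_Int[OF s1 s2]])
        fix w assume "w \<in> {h<..<c} \<inter> {w. c - l' < tent a c w \<and> tent a c w < c - l}"
        then have "h < w" "w < c" "c - l' < tent a c w" "tent a c w < c - l" by auto
        then have "c - l' < c - w" "c - w < c - l" using tent_right[OF h(3)] by auto
        then have "l < w" "w < l'" by (meson leD leI og.diff_left_mono)+
        then show "w \<in> {w. R b w}" using l(3) by blast
      qed
    qed
  qed
  ultimately show ?thesis by (intro exI[of _ F]) blast
qed

end

section \<open>Definably connected components\<close>

lemma dpred_ball: "(\<And>i. i < k \<Longrightarrow> dpred M (P i)) \<Longrightarrow> dpred M (\<lambda>s. \<forall>i<k. P i s)" for k :: nat
proof (induction k)
  case 0 then show ?case by (simp add: dpred_const)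
next
  case (Suc k)
  then have "dpred M (\<lambda>s. P k s \<and> (\<forall>i<k. P i s))" by (intro dpred_conj) auto
  then show ?case by (simp add: All_less_Suc)
qed

lemma definable_sub: "definable M n X \<Longrightarrow> X \<subseteq> cpow n"
  by (simp add: definable_iff_dpred)

lemma definable_dpred: "definable M n X \<Longrightarrow> dpred M (\<lambda>s. restrict s {..<n} \<in> X)"
  by (simp add: definable_iff_dpred)

lemma definable_Un: "definable M n X \<Longrightarrow> definable M n Y \<Longrightarrow> definable M n (X \<union> Y)"
  unfolding definable_iff_dpred by (auto intro: dpred_disj)

lemma definable_Int: "definable M n X \<Longrightarrow> definable M n Y \<Longrightarrow> definable M n (X \<inter> Y)"
  unfolding definable_iff_dpred by (auto intro: dpred_conj)

lemma definable_empty: "definable M n {}"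
  unfolding definable_iff_dpred by (simp add: dpred_const)

lemma definable_Union: "finite \<D> \<Longrightarrow> (\<And>D. D \<in> \<D> \<Longrightarrow> definable M n D) \<Longrightarrow> definable M n (\<Union>\<D>)"
  by (induction rule: finite_induct) (auto intro: definable_empty definable_Un)

lemma definably_connected_Un:
  assumes D: "definable M n D" "definably_connected M n \<tau> D"
    and E: "definable M n E" "definably_connected M n \<tau> E" and "D \<inter> E \<noteq> {}"
  shows "definably_connected M n \<tau> (D \<union> E)"
  unfolding definably_connected_def
proof
  assume "\<exists>U W. definable M n U \<and> definable M n W \<and> U \<noteq> {} \<and> W \<noteq> {} \<and>
    openin (subtopology \<tau> (D \<union> E)) U \<and> openin (subtopology \<tau> (D \<union> E)) W \<and> U \<inter> W = {} \<and> U \<union> W = D \<union> E"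
  then obtain U W where UW: "definable M n U" "definable M n W" "U \<noteq> {}" "W \<noteq> {}"
    "openin (subtopology \<tau> (D \<union> E)) U" "openin (subtopology \<tau> (D \<union> E)) W" "U \<inter> W = {}" "U \<union> W = D \<union> E"
    by (elim exE conjE) (rule that)
  have sub: "openin (subtopology \<tau> C) (V \<inter> C)" if "openin (subtopology \<tau> (D \<union> E)) V" "C \<subseteq> D \<union> E" for V C
    using that unfolding openin_subtopology by blast
  have one: "C \<subseteq> U \<or> C \<subseteq> W" if C: "definable M n C" "definably_connected M n \<tau> C" "C \<subseteq> D \<union> E" for C
  proof (rule ccontr)
    assume "\<not> ?thesis"
    then have "U \<inter> C \<noteq> {}" "W \<inter> C \<noteq> {}" using C(3) UW(8) by auto
    moreover have "(U \<inter> C) \<inter> (W \<inter> C) = {}" "(U \<inter> C) \<union> (W \<inter> C) = C" using UW(7,8) C(3) by auto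
    moreover have "definable M n (U \<inter> C)" "definable M n (W \<inter> C)" using UW C by (auto intro: definable_Int)
    moreover note sub[OF UW(5) C(3)] sub[OF UW(6) C(3)]
    ultimately have "\<not> definably_connected M n \<tau> C"
      unfolding definably_connected_def not_not by (intro exI conjI)
    then show False using C(2) by blast
  qed
  have "D \<subseteq> U \<or> D \<subseteq> W" "E \<subseteq> U \<or> E \<subseteq> W" using one D E by auto
  then show False using UW(3,4,7,8) \<open>D \<inter> E \<noteq> {}\<close> by blast
qed

lemma definably_connected_subtopology:
  "C \<subseteq> Y \<Longrightarrow> definably_connected M n (subtopology \<tau> Y) C \<longleftrightarrow> definably_connected M n \<tau> C"
  by (simp add: definably_connected_def subtopology_subtopology Int_absorb1)

text \<open>The components are the unions of the maximal connected subfamilies.\<close>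

lemma finitely_many_componentsI:
  assumes fin: "finite \<D>" and D: "\<And>D. D \<in> \<D> \<Longrightarrow> D \<noteq> {} \<and> definable M n D \<and> definably_connected M n \<tau> D"
    and Y: "\<Union>\<D> = Y"
  shows "finitely_many_components M n \<tau> Y"
proof -
  define conn where "conn \<C> \<longleftrightarrow> \<C> \<subseteq> \<D> \<and> \<C> \<noteq> {} \<and> definably_connected M n \<tau> (\<Union>\<C>)" for \<C>
  have conn_fin: "finite \<C>" if "conn \<C>" for \<C> using that fin finite_subset by (auto simp: conn_def)
  have conn_def': "definable M n (\<Union>\<C>)" if "conn \<C>" for \<C>
    using that D conn_fin[OF that] by (intro definable_Union) (auto simp: conn_def)
  define max where "max \<C> \<longleftrightarrow> conn \<C> \<and> (\<forall>\<C>'. conn \<C>' \<and> \<C> \<subseteq> \<C>' \<longrightarrow> \<C>' = \<C>)" for \<C>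
  \<comment> \<open>As the members of \<open>\<D>\<close> cover \<open>Y\<close>, a connected set
    together with all members that it meets is just the union of these members, so it is absorbed by
    a connected subfamily.\<close>
  have swallow: "\<exists>\<C>. conn \<C> \<and> E \<subseteq> \<Union>\<C> \<and> {D\<in>\<D>. D \<inter> E \<noteq> {}} \<subseteq> \<C>"
    if E: "E \<noteq> {}" "E \<subseteq> Y" "definable M n E" "definably_connected M n \<tau> E" for E
  proof -
    have grow: "definable M n (E \<union> \<Union>\<F>) \<and> definably_connected M n \<tau> (E \<union> \<Union>\<F>)"
      if "finite \<F>" "\<F> \<subseteq> {D\<in>\<D>. D \<inter> E \<noteq> {}}" for \<F>
      using that
    proof (induction rule: finite_induct)
      case empty then show ?case using E by simp
    next
      case (insert F \<F>)
      then have "(E \<union> \<Union>\<F>) \<inter> F \<noteq> {}" "F \<in> \<D>" by auto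
      then have "definably_connected M n \<tau> ((E \<union> \<Union>\<F>) \<union> F)" "definable M n ((E \<union> \<Union>\<F>) \<union> F)"
        using insert D[of F] by (auto intro!: definably_connected_Un definable_Un)
      moreover have "(E \<union> \<Union>\<F>) \<union> F = E \<union> \<Union>(insert F \<F>)" by auto
      ultimately show ?case by simp
    qed
    let ?\<C> = "{D\<in>\<D>. D \<inter> E \<noteq> {}}"
    have "E \<subseteq> \<Union>?\<C>" using E(2) Y by blast
    then have "E \<union> \<Union>?\<C> = \<Union>?\<C>" "?\<C> \<noteq> {}" using E(1) by auto
    then have "conn ?\<C>" using grow[of ?\<C>] fin unfolding conn_def by auto
    then show ?thesis using \<open>E \<subseteq> \<Union>?\<C>\<close> by blast
  qed
  \<comment> \<open>Maximality among subfamilies becomes maximality among all definable connected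
    subsets of \<open>Y\<close>.\<close>
  have max_eq: "\<Union>\<C> = E" if m: "max \<C>" and E: "\<Union>\<C> \<subseteq> E" "E \<subseteq> Y" "definable M n E" "definably_connected M n \<tau> E" for \<C> E
  proof -
    have c: "conn \<C>" using m by (simp add: max_def)
    then have ne: "\<Union>\<C> \<noteq> {}" using D by (auto simp: conn_def)
    then have "E \<noteq> {}" using E by blast
    from swallow[OF this E(2,3,4)] obtain \<C>' where \<C>': "conn \<C>'" "E \<subseteq> \<Union>\<C>'" "{D\<in>\<D>. D \<inter> E \<noteq> {}} \<subseteq> \<C>'"
      by blast
    have "\<C> \<subseteq> \<C>'"
    proof
      fix C assume "C \<in> \<C>"
      then have "C \<in> \<D>" "C \<noteq> {}" "C \<subseteq> E" using c D E(1) by (auto simp: conn_def)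
      then show "C \<in> \<C>'" using \<C>'(3) by blast
    qed
    then have "\<C>' = \<C>" using m \<C>'(1) by (simp add: max_def)
    then show ?thesis using \<C>'(2) E(1) by blast
  qed
  have above: "\<exists>\<C>. max \<C> \<and> \<C>0 \<subseteq> \<C>" if "conn \<C>0" for \<C>0
  proof -
    have "finite {\<C>. conn \<C> \<and> \<C>0 \<subseteq> \<C>}"
      by (rule finite_subset[of _ "Pow \<D>"]) (use fin in \<open>auto simp: conn_def\<close>)
    moreover have "\<C>0 \<in> {\<C>. conn \<C> \<and> \<C>0 \<subseteq> \<C>}" using that by simp
    ultimately obtain \<C> where \<C>: "\<C> \<in> {\<C>. conn \<C> \<and> \<C>0 \<subseteq> \<C>}"
      "\<forall>\<C>'\<in>{\<C>. conn \<C> \<and> \<C>0 \<subseteq> \<C>}. \<C> \<subseteq> \<C>' \<longrightarrow> \<C>' = \<C>"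
      using finite_has_maximal2[of "{\<C>. conn \<C> \<and> \<C>0 \<subseteq> \<C>}" \<C>0] by (metis (lifting))
    have "max \<C>" unfolding max_def
    proof (intro conjI allI impI)
      show "conn \<C>" using \<C>(1) by simp
      fix \<C>' assume "conn \<C>' \<and> \<C> \<subseteq> \<C>'"
      then show "\<C>' = \<C>" using \<C> by auto
    qed
    then show ?thesis using \<C>(1) by blast
  qed
  have comp: "definably_connected_component M n \<tau> Y (\<Union>\<C>)" if m: "max \<C>" for \<C>
  proof -
    have c: "conn \<C>" using m by (simp add: max_def)
    have "\<Union>\<C> \<subseteq> Y" using c Y by (auto simp: conn_def)
    have unique: "D = \<Union>\<C>" if "\<Union>\<C> \<subseteq> D \<and> D \<subseteq> Y \<and> definable M n D \<and> definably_connected M n (subtopology \<tau> Y) D" for D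
      using max_eq[OF m, of D] that definably_connected_subtopology[of D Y M n \<tau>] by blast
    have connected: "definably_connected M n (subtopology \<tau> Y) (\<Union>\<C>)"
      using c \<open>\<Union>\<C> \<subseteq> Y\<close> by (simp add: conn_def definably_connected_subtopology)
    show ?thesis
      unfolding definably_connected_component_def
    proof (intro conjI allI impI)
      show "\<Union>\<C> \<subseteq> Y" by (rule \<open>\<Union>\<C> \<subseteq> Y\<close>)
      show "definable M n (\<Union>\<C>)" by (rule conn_def'[OF c])
      show "definably_connected M n (subtopology \<tau> Y) (\<Union>\<C>)" by (rule connected)
    qed (rule unique)
  qed
  define \<K> where "\<K> = Union ` {\<C>. max \<C>}"
  have "finite \<K>" unfolding \<K>_def
  proof (rule finite_imageI, rule finite_subset)
    show "{\<C>. max \<C>} \<subseteq> Pow \<D>" by (auto simp: max_def conn_def)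
  qed (use fin in simp)
  moreover have "\<forall>C\<in>\<K>. definably_connected_component M n \<tau> Y C" using comp by (auto simp: \<K>_def)
  moreover have "pairwise disjnt \<K>"
  proof (rule pairwiseI)
    fix A B assume AB: "A \<in> \<K>" "B \<in> \<K>" "A \<noteq> B"
    then obtain \<C> \<C>' where \<C>: "max \<C>" "A = \<Union>\<C>" "max \<C>'" "B = \<Union>\<C>'" by (auto simp: \<K>_def)
    then have c: "conn \<C>" "conn \<C>'" by (auto simp: max_def)
    show "disjnt A B"
    proof (rule ccontr)
      assume "\<not> disjnt A B"
      then have "A \<inter> B \<noteq> {}" by (simp add: disjnt_def)
      have dc: "definably_connected M n \<tau> A" "definably_connected M n \<tau> B" "A \<union> B \<subseteq> Y"
        using c Y unfolding \<C> by (auto simp: conn_def)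
      have d: "definable M n A" "definable M n B" using conn_def'[OF c(1)] conn_def'[OF c(2)] \<C> by auto
      have "definably_connected M n \<tau> (A \<union> B)"
        by (rule definably_connected_Un[OF d(1) dc(1) d(2) dc(2) \<open>A \<inter> B \<noteq> {}\<close>])
      moreover have "definable M n (A \<union> B)" using d by (rule definable_Un)
      moreover note dc(3)
      ultimately have "A = A \<union> B" "B = A \<union> B" using max_eq[OF \<C>(1)] max_eq[OF \<C>(3)] \<C> by auto
      then show False using AB(3) by blast
    qed
  qed
  moreover have "\<Union>\<K> = Y"
  proof
    show "\<Union>\<K> \<subseteq> Y" using Y by (auto simp: \<K>_def max_def conn_def)
    show "Y \<subseteq> \<Union>\<K>"
    proof
      fix y assume "y \<in> Y"
      then obtain D0 where D0: "D0 \<in> \<D>" "y \<in> D0" using Y by blast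
      then have "conn {D0}" using D by (auto simp: conn_def)
      then obtain \<C> where "max \<C>" "{D0} \<subseteq> \<C>" using above by blast
      then show "y \<in> \<Union>\<K>" using D0 by (auto simp: \<K>_def)
    qed
  qed
  ultimately show ?thesis unfolding finitely_many_components_def by blast
qed

section \<open>The affine topology\<close>

lemma topspace_affine: "X \<subseteq> cpow n \<Longrightarrow> topspace (affine_topology n X) = X"
  unfolding affine_topology_def cpow_def by (auto simp: PiE_iff)

context omin
begin

lemma open_contains_interval:
  assumes "open U" "(y::'a) \<in> U"
  shows "\<exists>u v. u < y \<and> y < v \<and> {u<..<v} \<subseteq> U"
proof -
  obtain a b :: 'a where "a < y" "y < b" using ex_lt ex_gt by blast
  obtain v where v: "y < v" "{y..<v} \<subseteq> U" using open_right[OF assms \<open>y < b\<close>] by blast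
  obtain u where u: "u < y" "{u<..y} \<subseteq> U" using open_left[OF assms \<open>a < y\<close>] by blast
  have "{u<..<v} \<subseteq> {u<..y} \<union> {y..<v}" by auto
  then show ?thesis using u v by blast
qed

lemma open_open_intervals: "I \<in> open_intervals \<Longrightarrow> open (I :: 'a set)"
  unfolding open_intervals_def by (auto intro: open_lessThan open_greaterThan open_greaterThanLessThan)

text \<open>Boxes may have unbounded sides or be given by other intervals; around \<open>x\<close>
  they are shrunk to boxes with corners \<open>u\<close> and \<open>v\<close>. In this form affine
  neighbourhoods can be handled by their corners alone.\<close>

lemma box_basis:
  assumes "X \<subseteq> cpow n" "x \<in> X"
  shows "(\<exists>B\<in>open_boxes n. x \<in> B \<and> B \<inter> X \<subseteq> W) \<longleftrightarrow>
    (\<exists>u v. (\<forall>i<n. u i < x i \<and> x i < v i) \<and> (\<forall>y\<in>X. (\<forall>i<n. u i < y i \<and> y i < (v i :: 'a)) \<longrightarrow> y \<in> W))"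
proof
  assume "\<exists>B\<in>open_boxes n. x \<in> B \<and> B \<inter> X \<subseteq> W"
  then obtain I where I: "\<forall>i<n. I i \<in> open_intervals" "x \<in> PiE {..<n} I" "PiE {..<n} I \<inter> X \<subseteq> W"
    unfolding open_boxes_def by blast
  have "\<exists>u v. i < n \<longrightarrow> u < x i \<and> x i < v \<and> {u<..<v} \<subseteq> I i" for i
    using open_contains_interval[of "I i" "x i"] open_open_intervals I(1,2) by (auto simp: PiE_iff)
  then obtain u v where uv: "\<And>i. i < n \<Longrightarrow> u i < x i \<and> x i < v i \<and> {u i<..<v i} \<subseteq> I i" by metis
  have inW: "y \<in> W" if y: "y \<in> X" "\<forall>i<n. u i < y i \<and> y i < v i" for y
  proof -
    have "y i \<in> I i" if "i < n" for i using uv[OF that] y(2) that by auto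
    moreover have "y \<in> cpow n" using assms(1) that(1) by blast
    ultimately have "y \<in> PiE {..<n} I" by (auto simp: cpow_def PiE_iff)
    then show ?thesis using I(3) that(1) by blast
  qed
  then show "\<exists>u v. (\<forall>i<n. u i < x i \<and> x i < v i) \<and> (\<forall>y\<in>X. (\<forall>i<n. u i < y i \<and> y i < v i) \<longrightarrow> y \<in> W)"
    by (intro exI conjI ballI allI impI) (use uv in blast, use uv in blast, rule inW)
next
  assume "\<exists>u v. (\<forall>i<n. u i < x i \<and> x i < v i) \<and> (\<forall>y\<in>X. (\<forall>i<n. u i < y i \<and> y i < v i) \<longrightarrow> y \<in> W)"
  then obtain u v where uv: "\<forall>i<n. u i < x i \<and> x i < v i" "\<forall>y\<in>X. (\<forall>i<n. u i < y i \<and> y i < v i) \<longrightarrow> y \<in> W" by blast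
  let ?B = "PiE {..<n} (\<lambda>i. {u i<..<v i})"
  have "?B \<in> open_boxes n" unfolding open_boxes_def open_intervals_def by blast
  moreover have "x \<in> ?B" using uv(1) assms by (auto simp: cpow_def PiE_iff)
  moreover have "?B \<inter> X \<subseteq> W" using uv(2) by (auto simp: PiE_iff)
  ultimately show "\<exists>B\<in>open_boxes n. x \<in> B \<and> B \<inter> X \<subseteq> W" by blast
qed

lemma openin_affine:
  assumes "X \<subseteq> cpow n"
  shows "openin (affine_topology n X) W \<longleftrightarrow> W \<subseteq> X \<and>
    (\<forall>x\<in>W. \<exists>u v. (\<forall>i<n. u i < x i \<and> x i < v i) \<and> (\<forall>y\<in>X. (\<forall>i<n. u i < y i \<and> y i < (v i :: 'a)) \<longrightarrow> y \<in> W))"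
proof
  assume W: "openin (affine_topology n X) W"
  then obtain O' where O': "openin (product_topology (\<lambda>_. euclidean) {..<n}) O'" "W = O' \<inter> X"
    unfolding affine_topology_def openin_subtopology by blast
  show "W \<subseteq> X \<and> (\<forall>x\<in>W. \<exists>u v. (\<forall>i<n. u i < x i \<and> x i < v i) \<and> (\<forall>y\<in>X. (\<forall>i<n. u i < y i \<and> y i < v i) \<longrightarrow> y \<in> W))"
  proof (intro conjI ballI)
    show "W \<subseteq> X" using O' by blast
    fix x assume x: "x \<in> W"
    then have "x \<in> O'" using O' by blast
    from O'(1)[unfolded openin_product_topology_alt, rule_format, OF this]
    obtain U where "finite {i \<in> {..<n}. U i \<noteq> topspace euclidean}" and U: "\<forall>i\<in>{..<n}. openin euclidean (U i)" "x \<in> PiE {..<n} U" "PiE {..<n} U \<subseteq> O'"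
      by (elim exE conjE) (rule that)
    have "\<exists>u v. i < n \<longrightarrow> u < x i \<and> x i < v \<and> {u<..<v} \<subseteq> U i" for i
      using open_contains_interval[of "U i" "x i"] U(1,2) by (auto simp: PiE_iff)
    then obtain u v where uv: "\<And>i. i < n \<Longrightarrow> u i < x i \<and> x i < v i \<and> {u i<..<v i} \<subseteq> U i" by metis
    have inW: "y \<in> W" if y: "y \<in> X" "\<forall>i<n. u i < y i \<and> y i < v i" for y
    proof -
      have "y i \<in> U i" if "i < n" for i using uv[OF that] y(2) that by auto
      moreover have "y \<in> cpow n" using assms(1) that(1) by blast
      ultimately have "y \<in> PiE {..<n} U" by (auto simp: cpow_def PiE_iff)
      then show ?thesis using U(3) that(1) O'(2) by blast
    qed
    then show "\<exists>u v. (\<forall>i<n. u i < x i \<and> x i < v i) \<and> (\<forall>y\<in>X. (\<forall>i<n. u i < y i \<and> y i < v i) \<longrightarrow> y \<in> W)"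
      by (intro exI conjI ballI allI impI) (use uv in blast, use uv in blast, rule inW)
  qed
next
  assume W: "W \<subseteq> X \<and>
    (\<forall>x\<in>W. \<exists>u v. (\<forall>i<n. u i < x i \<and> x i < v i) \<and> (\<forall>y\<in>X. (\<forall>i<n. u i < y i \<and> y i < v i) \<longrightarrow> y \<in> W))"
  show "openin (affine_topology n X) W"
  proof (subst openin_subopen, intro ballI)
    fix x assume x: "x \<in> W"
    then obtain u v where uv: "\<forall>i<n. u i < x i \<and> x i < v i" "\<forall>y\<in>X. (\<forall>i<n. u i < y i \<and> y i < v i) \<longrightarrow> y \<in> W"
      using W by blast
    let ?B = "PiE {..<n} (\<lambda>i. {u i<..<v i})"
    have "openin (product_topology (\<lambda>_. euclidean) {..<n}) ?B"
      by (simp add: openin_PiE open_greaterThanLessThan)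
    then have "openin (affine_topology n X) (?B \<inter> X)" unfolding affine_topology_def openin_subtopology by blast
    moreover have "x \<in> ?B \<inter> X" using uv(1) x W assms by (auto simp: cpow_def PiE_iff)
    moreover have "?B \<inter> X \<subseteq> W" using uv(2) by (auto simp: PiE_iff)
    ultimately show "\<exists>T. openin (affine_topology n X) T \<and> x \<in> T \<and> T \<subseteq> W" by blast
  qed
qed

lemma Hausdorff_affine:
  assumes "X \<subseteq> cpow n"
  shows "Hausdorff_space (affine_topology n (X :: (nat \<Rightarrow> 'a) set))"
proof -
  show ?thesis
    unfolding Hausdorff_space_def topspace_affine[OF assms]
  proof (intro allI impI)
    fix x y assume xy: "x \<in> X \<and> y \<in> X \<and> x \<noteq> y"
    then obtain i where i: "x i \<noteq> y i" by (auto simp: fun_eq_iff)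
    then have "i < n" using xy assms unfolding cpow_def PiE_iff extensional_def
      by (metis (no_types, lifting) lessThan_iff mem_Collect_eq subsetD PiE_arb cpow_def)
    have half: "openin (affine_topology n X) {z \<in> X. z i < c}" "openin (affine_topology n X) {z \<in> X. c < z i}" for c
    proof -
      have "\<exists>u v. (\<forall>i<n. u i < z i \<and> z i < v i) \<and> (\<forall>y\<in>X. (\<forall>i<n. u i < y i \<and> y i < v i) \<longrightarrow> y \<in> {z \<in> X. z i < c})"
        if z: "z i < c" for z
      proof -
        have "\<exists>u v. u < z j \<and> z j < v" for j using ex_lt ex_gt by blast
        then obtain u v where uv: "\<And>j. u j < z j \<and> z j < v j" by metis
        have "\<forall>j<n. u j < z j \<and> z j < (v(i := c)) j" using uv z by auto
        moreover have "\<forall>y\<in>X. (\<forall>j<n. u j < y j \<and> y j < (v(i := c)) j) \<longrightarrow> y \<in> {z \<in> X. z i < c}"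
          using \<open>i < n\<close> by (auto dest: spec[of _ i])
        ultimately show ?thesis by blast
      qed
      then show "openin (affine_topology n X) {z \<in> X. z i < c}" unfolding openin_affine[OF assms] by blast
      have "\<exists>u v. (\<forall>i<n. u i < z i \<and> z i < v i) \<and> (\<forall>y\<in>X. (\<forall>i<n. u i < y i \<and> y i < v i) \<longrightarrow> y \<in> {z \<in> X. c < z i})"
        if z: "c < z i" for z
      proof -
        have "\<exists>u v. u < z j \<and> z j < v" for j using ex_lt ex_gt by blast
        then obtain u v where uv: "\<And>j. u j < z j \<and> z j < v j" by metis
        have "\<forall>j<n. (u(i := c)) j < z j \<and> z j < v j" using uv z by auto
        moreover have "\<forall>y\<in>X. (\<forall>j<n. (u(i := c)) j < y j \<and> y j < v j) \<longrightarrow> y \<in> {z \<in> X. c < z i}"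
          using \<open>i < n\<close> by (auto dest: spec[of _ i])
        ultimately show ?thesis by blast
      qed
      then show "openin (affine_topology n X) {z \<in> X. c < z i}" unfolding openin_affine[OF assms] by blast
    qed
    consider "x i < y i" | "y i < x i" using i by force
    then show "\<exists>U V. openin (affine_topology n X) U \<and> openin (affine_topology n X) V \<and> x \<in> U \<and> y \<in> V \<and> disjnt U V"
    proof cases
      case 1
      then obtain c where "x i < c" "c < y i" using dense by blast
      then show ?thesis using half[of c] xy
        by (intro exI[of _ "{z \<in> X. z i < c}"] exI[of _ "{z \<in> X. c < z i}"]) (auto simp: disjnt_iff)
    next
      case 2
      then obtain c where "y i < c" "c < x i" using dense by blast
      then show ?thesis using half[of c] xy
        by (intro exI[of _ "{z \<in> X. c < z i}"] exI[of _ "{z \<in> X. z i < c}"]) (auto simp: disjnt_iff)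
    qed
  qed
qed

end

section \<open>Transfer to the line\<close>

text \<open>A coordinate \<open>g\<close> on \<open>X\<close>, definable but a priori discontinuous;
  its image in the line carries the topologies to be compared.\<close>

locale chart = omin M
  for M :: "('a::{linordered_group_add, linorder_topology}, 'f, 'r) fo_struct" +
  fixes n :: nat and X :: "(nat \<Rightarrow> 'a) set" and g :: "(nat \<Rightarrow> 'a) \<Rightarrow> 'a" and lo hi :: 'a
  assumes definable_X: "definable M n X" and dterm_g: "dterm M (\<lambda>s. g (restrict s {..<n}))"
    and inj_g: "inj_on g X" and g_bounds: "\<And>x. x \<in> X \<Longrightarrow> lo \<le> g x \<and> g x \<le> hi"
begin

section \<open>The coordinate and its inverse\<close>

definition L :: "'a set" where "L = g ` X"
definition h :: "'a \<Rightarrow> nat \<Rightarrow> 'a" where "h = inv_into X g"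

lemma X_sub: "X \<subseteq> cpow n"
  using definable_X by (rule definable_sub)

lemma h_g [simp]: "x \<in> X \<Longrightarrow> h (g x) = x"
  by (simp add: h_def inj_g)

lemma h_in: "w \<in> L \<Longrightarrow> h w \<in> X"
  by (auto simp: L_def)

lemma g_h: "w \<in> L \<Longrightarrow> g (h w) = w"
  by (auto simp: L_def)

lemma g_in: "x \<in> X \<Longrightarrow> g x \<in> L"
  by (simp add: L_def)

lemma dset_image:
  assumes "definable M n D"
  shows "dset M (g ` (D \<inter> X))"
proof -
  have "dset M {w. \<exists>x\<in>cpow n. x \<in> D \<and> x \<in> X \<and> g x = w}"
    using definable_dpred[OF assms] definable_dpred[OF definable_X] dterm_g
    by (intro dsetI dpred_ex_cpow dpred_conj dpred_eq dterm_var)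
  moreover have "{w. \<exists>x\<in>cpow n. x \<in> D \<and> x \<in> X \<and> g x = w} = g ` (D \<inter> X)"
    using X_sub by auto
  ultimately show ?thesis by simp
qed

lemma dset_L: "dset M L"
  using dset_image[OF definable_X] by (simp add: L_def)

lemma definable_preimage:
  assumes "definable M n D" "dset M S"
  shows "definable M n {x \<in> X. x \<in> D \<and> g x \<in> S}"
  unfolding definable_iff_dpred
proof
  show "{x \<in> X. x \<in> D \<and> g x \<in> S} \<subseteq> cpow n" using X_sub by auto
  have "dpred M (\<lambda>s. restrict s {..<n} \<in> X \<and> restrict s {..<n} \<in> D \<and> g (restrict s {..<n}) \<in> S)"
    by (intro dpred_conj definable_dpred definable_X assms(1) dsetD[OF assms(2) dterm_g])
  then show "dpred M (\<lambda>s. restrict s {..<n} \<in> {x \<in> X. x \<in> D \<and> g x \<in> S})" by simp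
qed

text \<open>The graph of the inverse is obtained by quantifying over \<open>X\<close>; the value 0
  outside of \<open>L\<close> makes the function total.\<close>

lemma h_coordinate_dterm:
  assumes "i < n"
  shows "dterm M (\<lambda>s. if s 0 \<in> L then h (s 0) i else 0)"
proof (rule dterm_graphI)
  have "dpred M (\<lambda>s. (s 1 \<notin> L \<and> s 0 = 0) \<or> (\<exists>x\<in>cpow n. x \<in> X \<and> g x = s 1 \<and> x i = s 0))"
    using definable_dpred[OF definable_X] dterm_g \<open>i < n\<close>
    by (intro dpred_disj dpred_conj dpred_neg dsetD[OF dset_L] dpred_eq dterm_var dterm_const dpred_ex_cpow)
      (simp_all add: dterm_var)
  moreover have "(s 1 \<notin> L \<and> s 0 = 0) \<or> (\<exists>x\<in>cpow n. x \<in> X \<and> g x = s 1 \<and> x i = s 0) \<longleftrightarrow>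
    s 0 = (if s (Suc 0) \<in> L then h (s (Suc 0)) i else 0)" for s
  proof (cases "s (Suc 0) \<in> L")
    case True
    then obtain y where y: "y \<in> X" "s (Suc 0) = g y" by (auto simp: L_def)
    have "x = y" if "x \<in> X" "g x = g y" for x using inj_g that y by (auto simp: inj_on_def)
    then have "(\<exists>x\<in>cpow n. x \<in> X \<and> g x = s 1 \<and> x i = s 0) \<longleftrightarrow> y i = s 0"
      using y X_sub by (metis One_nat_def subsetD)
    then show ?thesis using y True by auto
  next
    case False
    then have "x \<in> X \<Longrightarrow> g x \<noteq> s (Suc 0)" for x unfolding L_def by (metis imageI)
    then show ?thesis using False by auto
  qed
  ultimately show "dpred M (\<lambda>s. s 0 = (if s (Suc 0) \<in> L then h (s (Suc 0)) i else 0))" by simp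
qed

text \<open>A Hausdorff topology on \<open>X\<close> with a uniformly definable basis. It is
  instantiated both with the given topology and with the affine one.\<close>

definition basis_of :: "(nat \<Rightarrow> 'a) topology \<Rightarrow> nat \<Rightarrow> ((nat \<Rightarrow> 'a) \<Rightarrow> (nat \<Rightarrow> 'a) \<Rightarrow> bool) \<Rightarrow> bool" where
  "basis_of \<sigma> m R \<longleftrightarrow> topspace \<sigma> = X \<and> Hausdorff_space \<sigma> \<and> (\<forall>b\<in>cpow m. openin \<sigma> {x \<in> cpow n. R b x}) \<and>
     (\<forall>W x. openin \<sigma> W \<and> x \<in> W \<longrightarrow> (\<exists>b\<in>cpow m. R b x \<and> (\<forall>y\<in>cpow n. R b y \<longrightarrow> y \<in> W))) \<and>
     dpred M (\<lambda>s. R (restrict (\<lambda>i. s (n + i)) {..<m}) (restrict s {..<n}))"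

definition on_line :: "((nat \<Rightarrow> 'a) \<Rightarrow> (nat \<Rightarrow> 'a) \<Rightarrow> bool) \<Rightarrow> (nat \<Rightarrow> 'a) \<Rightarrow> 'a \<Rightarrow> bool" where
  "on_line R b w \<longleftrightarrow> (\<exists>x\<in>X. R b x \<and> g x = w)"

text \<open>Goodness without reference to a basis: \<open>L\<close> contains an interval around
  \<open>z\<close>, and \<open>h\<close> is continuous at \<open>z\<close> from the order topology
  to \<open>\<sigma>\<close>.\<close>

definition good_at :: "(nat \<Rightarrow> 'a) topology \<Rightarrow> 'a \<Rightarrow> bool" where
  "good_at \<sigma> z \<longleftrightarrow> (\<forall>W. openin \<sigma> W \<and> h z \<in> W \<longrightarrow>
     (\<exists>c d. c < z \<and> z < d \<and> (\<forall>w. c < w \<and> w < d \<longrightarrow> w \<in> L \<and> h w \<in> W)))"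

lemma on_line_iff: "on_line R b w \<longleftrightarrow> w \<in> L \<and> R b (h w)"
  by (auto simp: on_line_def L_def)

lemma basis_ofD:
  assumes "basis_of \<sigma> m R"
  shows "topspace \<sigma> = X" "Hausdorff_space \<sigma>" "\<And>b. b \<in> cpow m \<Longrightarrow> openin \<sigma> {x \<in> cpow n. R b x}"
    "\<And>W x. openin \<sigma> W \<Longrightarrow> x \<in> W \<Longrightarrow> \<exists>b\<in>cpow m. R b x \<and> (\<forall>y\<in>cpow n. R b y \<longrightarrow> y \<in> W)"
    "dpred M (\<lambda>s. R (restrict (\<lambda>i. s (n + i)) {..<m}) (restrict s {..<n}))"
  using assms unfolding basis_of_def by blast+

lemma basis_of_sub: "basis_of \<sigma> m R \<Longrightarrow> b \<in> cpow m \<Longrightarrow> x \<in> cpow n \<Longrightarrow> R b x \<Longrightarrow> x \<in> X"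
  using basis_ofD(1,3) openin_subset by blast

lemma line_basis_on_line:
  assumes B: "basis_of \<sigma> m R"
  shows "line_basis M L m (on_line R) lo hi"
proof
  note B' = basis_ofD[OF B]
  have hc: "h w \<in> cpow n" if "w \<in> L" for w using h_in[OF that] X_sub by blast
  show "dset M L" by (rule dset_L)
  show "lo \<le> x \<and> x \<le> hi" if "x \<in> L" for x using that g_bounds by (auto simp: L_def)
  show "w \<in> L" if "on_line R b w" for b w using that by (simp add: on_line_iff)
  show "\<exists>b\<in>cpow m. on_line R b w" if "w \<in> L" for w
  proof -
    have "openin \<sigma> X" using B'(1) openin_topspace by metis
    from B'(4)[OF this h_in[OF that]] show ?thesis using that by (auto simp: on_line_iff)
  qed
  show "\<exists>e\<in>cpow m. on_line R e w \<and> (\<forall>v. on_line R e v \<longrightarrow> on_line R b v \<and> on_line R c v)"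
    if bc: "b \<in> cpow m" "c \<in> cpow m" "on_line R b w" "on_line R c w" for b c w
  proof -
    have "openin \<sigma> ({x \<in> cpow n. R b x} \<inter> {x \<in> cpow n. R c x})"
      using B'(3) bc by (intro openin_Int) auto
    moreover have "h w \<in> {x \<in> cpow n. R b x} \<inter> {x \<in> cpow n. R c x}"
      using bc hc by (auto simp: on_line_iff)
    ultimately obtain e where e: "e \<in> cpow m" "R e (h w)"
      "\<forall>y\<in>cpow n. R e y \<longrightarrow> y \<in> {x \<in> cpow n. R b x} \<inter> {x \<in> cpow n. R c x}"
      using B'(4) by blast
    have "on_line R b v \<and> on_line R c v" if "on_line R e v" for v
      using that e(3) hc by (auto simp: on_line_iff)
    moreover have "on_line R e w" using e(2) bc by (auto simp: on_line_iff)
    ultimately show ?thesis using e(1) by blast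
  qed
  show "\<exists>b\<in>cpow m. \<exists>c\<in>cpow m. on_line R b x \<and> on_line R c y \<and> \<not> (\<exists>w. on_line R b w \<and> on_line R c w)"
    if xy: "x \<in> L" "y \<in> L" "x \<noteq> y" for x y
  proof -
    have "h x \<noteq> h y" using xy g_h by metis
    then obtain U V where UV: "openin \<sigma> U" "openin \<sigma> V" "h x \<in> U" "h y \<in> V" "disjnt U V"
      using B'(2) h_in xy B'(1) unfolding Hausdorff_space_def by metis
    obtain b where b: "b \<in> cpow m" "R b (h x)" "\<forall>y\<in>cpow n. R b y \<longrightarrow> y \<in> U"
      using B'(4)[OF UV(1,3)] by blast
    obtain c where c: "c \<in> cpow m" "R c (h y)" "\<forall>y\<in>cpow n. R c y \<longrightarrow> y \<in> V"
      using B'(4)[OF UV(2,4)] by blast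
    have "\<not> (on_line R b w \<and> on_line R c w)" for w
      using b(3) c(3) hc[of w] UV(5) unfolding on_line_iff disjnt_iff by blast
    moreover have "on_line R b x" "on_line R c y" using b c xy by (simp_all add: on_line_iff)
    ultimately show ?thesis using b(1) c(1) by blast
  qed
  have "dpred M (\<lambda>s. \<exists>x\<in>cpow n. x \<in> X \<and> R (restrict s {..<m}) x \<and> g x = s m)"
    using definable_dpred[OF definable_X] dterm_g B'(5)
    by (intro dpred_ex_cpow dpred_conj dpred_eq dterm_var)
  moreover have "(\<exists>x\<in>cpow n. x \<in> X \<and> R (restrict s {..<m}) x \<and> g x = s m) \<longleftrightarrow> on_line R (restrict s {..<m}) (s m)" for s
    using X_sub by (auto simp: on_line_def)
  ultimately show "dpred M (\<lambda>s. on_line R (restrict s {..<m}) (s m))" by simp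
qed

lemma good_iff:
  assumes B: "basis_of \<sigma> m R" and "z \<in> L"
  shows "line_basis.good m (on_line R) z \<longleftrightarrow> good_at \<sigma> z"
proof -
  interpret T: line_basis M L m "on_line R" lo hi by (rule line_basis_on_line[OF B])
  note B' = basis_ofD[OF B]
  have hc: "h w \<in> cpow n" if "w \<in> L" for w using h_in[OF that] X_sub by blast
  show ?thesis
  proof
    assume g: "T.good z"
    show "good_at \<sigma> z" unfolding good_at_def
    proof (intro allI impI)
      fix W assume W: "openin \<sigma> W \<and> h z \<in> W"
      then obtain b where b: "b \<in> cpow m" "R b (h z)" "\<forall>y\<in>cpow n. R b y \<longrightarrow> y \<in> W" using B'(4) by blast
      then have "on_line R b z" using \<open>z \<in> L\<close> by (simp add: on_line_iff)
      then obtain c d where cd: "c < z" "z < d" "\<forall>w. c < w \<and> w < d \<longrightarrow> on_line R b w"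
        using g b(1) unfolding T.good_def by blast
      then have "\<forall>w. c < w \<and> w < d \<longrightarrow> w \<in> L \<and> h w \<in> W" using b(3) hc unfolding on_line_iff by blast
      then show "\<exists>c d. c < z \<and> z < d \<and> (\<forall>w. c < w \<and> w < d \<longrightarrow> w \<in> L \<and> h w \<in> W)" using cd by blast
    qed
  next
    assume g: "good_at \<sigma> z"
    show "T.good z" unfolding T.good_def
    proof (intro ballI impI)
      fix b assume b: "b \<in> cpow m" "on_line R b z"
      then have "openin \<sigma> {x \<in> cpow n. R b x} \<and> h z \<in> {x \<in> cpow n. R b x}"
        using B'(3) hc by (auto simp: on_line_iff)
      then obtain c d where cd: "c < z" "z < d" "\<forall>w. c < w \<and> w < d \<longrightarrow> w \<in> L \<and> h w \<in> {x \<in> cpow n. R b x}"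
        using g unfolding good_at_def by blast
      then have "\<forall>w. c < w \<and> w < d \<longrightarrow> on_line R b w" by (auto simp: on_line_iff)
      then show "\<exists>c d. c < z \<and> z < d \<and> (\<forall>w. c < w \<and> w < d \<longrightarrow> on_line R b w)" using cd by blast
    qed
  qed
qed

lemma good_set_eq:
  assumes "basis_of \<sigma> m R"
  shows "{z \<in> L. \<not> line_basis.good m (on_line R) z} = {z \<in> L. \<not> good_at \<sigma> z}"
  using good_iff[OF assms] by blast

text \<open>The parameters of a box are its lower corner followed by its upper corner.\<close>

definition box :: "(nat \<Rightarrow> 'a) \<Rightarrow> (nat \<Rightarrow> 'a) \<Rightarrow> bool" where
  "box b x \<longleftrightarrow> x \<in> X \<and> (\<forall>i<n. b i < x i \<and> x i < b (n + i))"

lemma affine_nbhd_box: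
  assumes "\<exists>u v. (\<forall>i<n. u i < x i \<and> x i < v i) \<and> (\<forall>y\<in>X. (\<forall>i<n. u i < y i \<and> y i < v i) \<longrightarrow> y \<in> W)" "x \<in> X"
  shows "\<exists>b\<in>cpow (n + n). box b x \<and> (\<forall>y\<in>cpow n. box b y \<longrightarrow> y \<in> W)"
proof -
  obtain u v where uv: "\<forall>i<n. u i < x i \<and> x i < v i" "\<forall>y\<in>X. (\<forall>i<n. u i < y i \<and> y i < v i) \<longrightarrow> y \<in> W"
    using assms(1) by blast
  define b where "b = restrict (\<lambda>i. if i < n then u i else v (i - n)) {..<n + n}"
  have "b \<in> cpow (n + n)" by (simp add: b_def restrict_cpow)
  moreover have "box b y \<longleftrightarrow> y \<in> X \<and> (\<forall>i<n. u i < y i \<and> y i < v i)" for y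
    by (auto simp: box_def b_def)
  ultimately show ?thesis using uv assms(2) by (intro bexI[of _ b]) auto
qed

text \<open>With boxes as basis the affine topology is itself a definable Hausdorff topology on the
  line, so the results on germs apply to it as well.\<close>

lemma basis_of_affine: "basis_of (affine_topology n X) (n + n) box"
  unfolding basis_of_def
proof (intro conjI ballI allI impI)
  show "topspace (affine_topology n X) = X" by (rule topspace_affine[OF X_sub])
  show "Hausdorff_space (affine_topology n X)" by (rule Hausdorff_affine[OF X_sub])
  show "openin (affine_topology n X) {x \<in> cpow n. box b x}" for b
    unfolding openin_affine[OF X_sub]
  proof (intro conjI ballI)
    show "{x \<in> cpow n. box b x} \<subseteq> X" by (auto simp: box_def)
    fix x assume "x \<in> {x \<in> cpow n. box b x}"
    then show "\<exists>u v. (\<forall>i<n. u i < x i \<and> x i < v i) \<and>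
      (\<forall>y\<in>X. (\<forall>i<n. u i < y i \<and> y i < v i) \<longrightarrow> y \<in> {x \<in> cpow n. box b x})"
      using X_sub by (intro exI[of _ b] exI[of _ "\<lambda>i. b (n + i)"]) (auto simp: box_def)
  qed
  show "\<exists>b\<in>cpow (n + n). box b x \<and> (\<forall>y\<in>cpow n. box b y \<longrightarrow> y \<in> W)"
    if "openin (affine_topology n X) W \<and> x \<in> W" for W x
    using that unfolding openin_affine[OF X_sub] by (intro affine_nbhd_box) auto
  have "dpred M (\<lambda>s. restrict s {..<n} \<in> X \<and> (\<forall>i<n. s (n + i) < s i \<and> s i < s (n + (n + i))))"
    using definable_dpred[OF definable_X] by (intro dpred_conj dpred_ball dpred_less dterm_var)
  moreover have "restrict s {..<n} \<in> X \<and> (\<forall>i<n. s (n + i) < s i \<and> s i < s (n + (n + i))) \<longleftrightarrow>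
    box (restrict (\<lambda>i. s (n + i)) {..<n + n}) (restrict s {..<n})" for s
    by (auto simp: box_def)
  ultimately show "dpred M (\<lambda>s. box (restrict (\<lambda>i. s (n + i)) {..<n + n}) (restrict s {..<n}))" by simp
qed

section \<open>Continuity of the inverse chart off a finite set\<close>

definition regular :: "'a \<Rightarrow> bool" where
  "regular z \<longleftrightarrow> (\<exists>c d. c < z \<and> z < d \<and> {c<..<d} \<subseteq> L)"

text \<open>At a point of \<open>L\<close> that is not interior to \<open>L\<close> one of the two
  germs lies outside of \<open>L\<close>, so \<open>boundary_finite\<close> for the complement of
  \<open>L\<close> applies. The affine basis serves to make that lemma accessible.\<close>

lemma regular_cofinite: "finite {z \<in> L. \<not> regular z}"
proof -
  interpret T: line_basis M L "n + n" "on_line box" lo hi by (rule line_basis_on_line[OF basis_of_affine])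
  have "dset M (- L)" using dset_L unfolding dset_def Compl_iff by (rule dpred_neg)
  then have fin: "finite {z. z \<notin> - L \<and> eventually (\<lambda>w. w \<in> - L) (germ d z)}" for d by (rule T.boundary_finite)
  have "{z \<in> L. \<not> regular z} \<subseteq> {z. z \<notin> - L \<and> eventually (\<lambda>w. w \<in> - L) (germ True z)} \<union>
    {z. z \<notin> - L \<and> eventually (\<lambda>w. w \<in> - L) (germ False z)}"
  proof
    fix z assume z: "z \<in> {z \<in> L. \<not> regular z}"
    have "\<not> (eventually (\<lambda>w. w \<in> L) (germ True z) \<and> eventually (\<lambda>w. w \<in> L) (germ False z))"
    proof
      assume "eventually (\<lambda>w. w \<in> L) (germ True z) \<and> eventually (\<lambda>w. w \<in> L) (germ False z)"
      then obtain c d where cd: "c < z" "z < d" "\<forall>w. z < w \<and> w < d \<longrightarrow> w \<in> L" "\<forall>w. c < w \<and> w < z \<longrightarrow> w \<in> L"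
        unfolding eventually_germ_True eventually_germ_False by blast
      have "w \<in> L" if "w \<in> {c<..<d}" for w using that cd z by (cases w z rule: linorder_cases) auto
      then have "regular z" unfolding regular_def using cd by blast
      then show False using z by blast
    qed
    then have "eventually (\<lambda>w. w \<notin> L) (germ True z) \<or> eventually (\<lambda>w. w \<notin> L) (germ False z)"
      using germ_dichotomy_set[OF dset_L] by blast
    then show "z \<in> {z. z \<notin> - L \<and> eventually (\<lambda>w. w \<in> - L) (germ True z)} \<union>
      {z. z \<notin> - L \<and> eventually (\<lambda>w. w \<in> - L) (germ False z)}" using z by auto
  qed
  then show ?thesis by (rule finite_subset) (intro finite_UnI fin)
qed

text \<open>Each coordinate of the composition of \<open>f\<close> with \<open>h\<close> is a
  definable function of one variable, hence continuous off a finite set. The lemma is used for the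
  identity and for a homeomorphism onto an affine set.\<close>

lemma coordinates_continuous:
  assumes f: "\<And>i. i < k \<Longrightarrow> dterm M (\<lambda>s. if s 0 \<in> L then f (h (s 0)) i else 0)"
  shows "finite {z \<in> L. \<not> (\<forall>u v. (\<forall>i<(k::nat). u i < f (h z) i \<and> f (h z) i < v i) \<longrightarrow>
    (\<exists>c d. c < z \<and> z < d \<and> (\<forall>w. c < w \<and> w < d \<longrightarrow> w \<in> L \<and> (\<forall>i<k. u i < f (h w) i \<and> f (h w) i < v i))))}"
    (is "finite {z \<in> L. \<not> ?C z}")
proof -
  define F where "F i w = (if w \<in> L then f (h w) i else 0)" for i w
  have fin: "finite {z. \<not> cont (F i) z}" if "i < k" for i
    by (rule continuous_cofinite) (use f[OF that] in \<open>simp add: F_def\<close>)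
  have "{z \<in> L. \<not> ?C z} \<subseteq> {z \<in> L. \<not> regular z} \<union> (\<Union>i<k. {z. \<not> cont (F i) z})"
  proof (rule subsetI, rule ccontr)
    fix z assume z: "z \<in> {z \<in> L. \<not> ?C z}" "z \<notin> {z \<in> L. \<not> regular z} \<union> (\<Union>i<k. {z. \<not> cont (F i) z})"
    then have "z \<in> L" "regular z" and cont: "\<And>i. i < k \<Longrightarrow> cont (F i) z" by auto
    then obtain a b where ab: "a < z" "z < b" "{a<..<b} \<subseteq> L" by (auto simp: regular_def)
    have "?C z"
    proof (intro allI impI)
      fix u v assume uv: "\<forall>i<k. u i < f (h z) i \<and> f (h z) i < v i"
      have "\<exists>c d. c < z \<and> z < d \<and> (\<forall>w. c < w \<and> w < d \<longrightarrow> w \<in> L \<and> (\<forall>i<j. u i < f (h w) i \<and> f (h w) i < v i))"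
        if "j \<le> k" for j
        using that
      proof (induction j)
        case 0
        have "\<forall>w. a < w \<and> w < b \<longrightarrow> w \<in> L" using ab(3) by auto
        then show ?case using ab(1,2) by (intro exI[of _ a] exI[of _ b]) simp
      next
        case (Suc j)
        then obtain c d where cd: "c < z" "z < d"
          "\<forall>w. c < w \<and> w < d \<longrightarrow> w \<in> L \<and> (\<forall>i<j. u i < f (h w) i \<and> f (h w) i < v i)" by auto
        have "u j < F j z \<and> F j z < v j" using uv Suc.prems \<open>z \<in> L\<close> by (simp add: F_def)
        with cont[of j] Suc.prems obtain c' d' where cd': "c' < z" "z < d'" "\<forall>w. c' < w \<and> w < d' \<longrightarrow> u j < F j w \<and> F j w < v j"
          unfolding cont_def by (metis Suc_le_eq)
        have "\<forall>w. max c c' < w \<and> w < min d d' \<longrightarrow> w \<in> L \<and> (\<forall>i<Suc j. u i < f (h w) i \<and> f (h w) i < v i)"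
          using cd(3) cd'(3) by (auto simp: F_def less_Suc_eq split: if_splits)
        moreover have "max c c' < z" "z < min d d'" using cd cd' by auto
        ultimately show ?case by blast
      qed
      then show "\<exists>c d. c < z \<and> z < d \<and> (\<forall>w. c < w \<and> w < d \<longrightarrow> w \<in> L \<and> (\<forall>i<k. u i < f (h w) i \<and> f (h w) i < v i))"
        by blast
    qed
    then show False using z(1) by blast
  qed
  then show ?thesis
    by (rule finite_subset) (use regular_cofinite fin in auto)
qed

lemma affine_good_cofinite: "finite {z \<in> L. \<not> good_at (affine_topology n X) z}"
proof (rule finite_subset[OF _ coordinates_continuous[where f = "\<lambda>x. x" and k = n]])
  show "dterm M (\<lambda>s. if s 0 \<in> L then h (s 0) i else 0)" if "i < n" for i using h_coordinate_dterm[OF that] .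
  show "{z \<in> L. \<not> good_at (affine_topology n X) z} \<subseteq> {z \<in> L. \<not> (\<forall>u v. (\<forall>i<n. u i < h z i \<and> h z i < v i) \<longrightarrow>
    (\<exists>c d. c < z \<and> z < d \<and> (\<forall>w. c < w \<and> w < d \<longrightarrow> w \<in> L \<and> (\<forall>i<n. u i < h w i \<and> h w i < v i))))}"
  proof (clarsimp simp only: mem_Collect_eq)
    fix z assume z: "z \<in> L" "\<not> good_at (affine_topology n X) z" and c: "\<forall>u v. (\<forall>i<n. u i < h z i \<and> h z i < v i) \<longrightarrow>
      (\<exists>c d. c < z \<and> z < d \<and> (\<forall>w. c < w \<and> w < d \<longrightarrow> w \<in> L \<and> (\<forall>i<n. u i < h w i \<and> h w i < v i)))"
    have "good_at (affine_topology n X) z" unfolding good_at_def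
    proof (intro allI impI)
      fix W assume W: "openin (affine_topology n X) W \<and> h z \<in> W"
      then obtain u v where uv: "\<forall>i<n. u i < h z i \<and> h z i < v i" "\<forall>y\<in>X. (\<forall>i<n. u i < y i \<and> y i < v i) \<longrightarrow> y \<in> W"
        unfolding openin_affine[OF X_sub] by blast
      then obtain c d where cd: "c < z" "z < d" "\<forall>w. c < w \<and> w < d \<longrightarrow> w \<in> L \<and> (\<forall>i<n. u i < h w i \<and> h w i < v i)"
        using c by blast
      have "\<forall>w. c < w \<and> w < d \<longrightarrow> w \<in> L \<and> h w \<in> W" using cd(3) uv(2) h_in by blast
      then show "\<exists>c d. c < z \<and> z < d \<and> (\<forall>w. c < w \<and> w < d \<longrightarrow> w \<in> L \<and> h w \<in> W)" using cd by blast
    qed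
    then show False using z by blast
  qed
qed

end

lemma definably_connected_singleton: "definably_connected M n \<tau> {x}"
  unfolding definably_connected_def
proof (intro notI, elim exE conjE)
  fix U W assume "U \<noteq> {}" "W \<noteq> {}" "U \<inter> W = {}" "U \<union> W = {x}"
  then have "U = {x}" "W = {x}" by auto
  then show False using \<open>U \<inter> W = {}\<close> by simp
qed

section \<open>The conditions in terms of good points\<close>

context chart
begin

text \<open>Off a finite set the chart is a local homeomorphism between the affine topology of
  \<open>X\<close> and the order topology of the line. One direction uses the continuity of
  \<open>h\<close> at affinely good points, the other the fact that an affine neighbourhood of
  almost every point has its image in a prescribed interval.\<close>

lemma affine_neighbourhoods_iff:
  assumes B: "basis_of \<tau> m R"
  shows "finite {x \<in> X. \<not> (\<forall>W. openin \<tau> W \<and> x \<in> W \<longrightarrow> (\<exists>B\<in>open_boxes n. x \<in> B \<and> B \<inter> X \<subseteq> W))} \<longleftrightarrow>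
    finite {z \<in> L. \<not> good_at \<tau> z}" (is "finite {x \<in> X. \<not> ?A x} \<longleftrightarrow> _")
proof
  assume fin: "finite {x \<in> X. \<not> ?A x}"
  have "{z \<in> L. \<not> good_at \<tau> z} \<subseteq> g ` {x \<in> X. \<not> ?A x} \<union> {z \<in> L. \<not> good_at (affine_topology n X) z}"
  proof (rule subsetI, rule ccontr)
    fix z assume z: "z \<in> {z \<in> L. \<not> good_at \<tau> z}"
      "z \<notin> g ` {x \<in> X. \<not> ?A x} \<union> {z \<in> L. \<not> good_at (affine_topology n X) z}"
    then have "z \<in> L" and ga: "good_at (affine_topology n X) z" by auto
    have A: "?A (h z)"
    proof (rule ccontr)
      assume "\<not> ?A (h z)"
      then have "g (h z) \<in> g ` {x \<in> X. \<not> ?A x}" using h_in[OF \<open>z \<in> L\<close>] by blast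
      then show False using z(2) g_h[OF \<open>z \<in> L\<close>] by simp
    qed
    have "good_at \<tau> z" unfolding good_at_def
    proof (intro allI impI)
      fix W assume W: "openin \<tau> W \<and> h z \<in> W"
      then have "\<exists>B\<in>open_boxes n. h z \<in> B \<and> B \<inter> X \<subseteq> W" using A by blast
      then obtain u v where uv: "\<forall>i<n. u i < h z i \<and> h z i < v i" "\<forall>y\<in>X. (\<forall>i<n. u i < y i \<and> y i < v i) \<longrightarrow> y \<in> W"
        unfolding box_basis[OF X_sub h_in[OF \<open>z \<in> L\<close>]] by blast
      have "openin (affine_topology n X) {y \<in> X. \<forall>i<n. u i < y i \<and> y i < v i}"
        unfolding openin_affine[OF X_sub] by auto
      moreover have "h z \<in> {y \<in> X. \<forall>i<n. u i < y i \<and> y i < v i}" using uv(1) h_in[OF \<open>z \<in> L\<close>] by simp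
      ultimately obtain c d where cd: "c < z" "z < d"
        "\<forall>w. c < w \<and> w < d \<longrightarrow> w \<in> L \<and> h w \<in> {y \<in> X. \<forall>i<n. u i < y i \<and> y i < v i}"
        using ga unfolding good_at_def by blast
      then have "\<forall>w. c < w \<and> w < d \<longrightarrow> w \<in> L \<and> h w \<in> W" using uv(2) by blast
      then show "\<exists>c d. c < z \<and> z < d \<and> (\<forall>w. c < w \<and> w < d \<longrightarrow> w \<in> L \<and> h w \<in> W)" using cd by blast
    qed
    then show False using z by blast
  qed
  then show "finite {z \<in> L. \<not> good_at \<tau> z}"
    by (rule finite_subset) (intro finite_UnI finite_imageI fin affine_good_cofinite)
next
  assume fin: "finite {z \<in> L. \<not> good_at \<tau> z}"
  interpret S: line_basis M L "n + n" "on_line box" lo hi by (rule line_basis_on_line[OF basis_of_affine])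
  have "finite {z \<in> L. \<not> S.good z}"
    using affine_good_cofinite unfolding good_set_eq[OF basis_of_affine] .
  then obtain P where P: "finite P" "\<forall>y\<in>L - P. S.good y \<and> (\<forall>d z. S.conv d z y \<longrightarrow> z = y)"
    using S.cofinitely_affine by blast
  have "{x \<in> X. \<not> ?A x} \<subseteq> h ` ({z \<in> L. \<not> good_at \<tau> z} \<union> P)"
  proof (rule subsetI, rule ccontr)
    fix x assume x: "x \<in> {x \<in> X. \<not> ?A x}" "x \<notin> h ` ({z \<in> L. \<not> good_at \<tau> z} \<union> P)"
    then have "x \<in> X" by blast
    have "g x \<notin> {z \<in> L. \<not> good_at \<tau> z} \<union> P"
      using x(2) h_g[OF \<open>x \<in> X\<close>] by (metis image_eqI)
    then have gx: "g x \<in> L" "good_at \<tau> (g x)" "g x \<notin> P" using g_in[OF \<open>x \<in> X\<close>] by auto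
    have "?A x"
    proof (intro allI impI)
      fix W assume "openin \<tau> W \<and> x \<in> W"
      then have "openin \<tau> W \<and> h (g x) \<in> W" using \<open>x \<in> X\<close> by simp
      then obtain c d where cd: "c < g x" "g x < d" "\<forall>w. c < w \<and> w < d \<longrightarrow> w \<in> L \<and> h w \<in> W"
        using gx(2) unfolding good_at_def by blast
      have "\<exists>b\<in>cpow (n + n). on_line box b (g x) \<and> (\<forall>w. on_line box b w \<longrightarrow> c < w \<and> w < d)"
        by (rule S.small_neighbourhood[OF gx(1) _ cd(1,2)]) (use P(2) gx in blast)
      then obtain b where b: "on_line box b (g x)" "\<forall>w. on_line box b w \<longrightarrow> c < w \<and> w < d" by blast
      have "y \<in> W" if "y \<in> X" "box b y" for y
      proof -
        have "on_line box b (g y)" using that g_in by (simp add: on_line_iff)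
        then have "h (g y) \<in> W" using b(2) cd(3) by blast
        then show ?thesis using that by simp
      qed
      moreover have "box b x" using b(1) \<open>x \<in> X\<close> by (simp add: on_line_iff)
      ultimately show "\<exists>B\<in>open_boxes n. x \<in> B \<and> B \<inter> X \<subseteq> W"
        unfolding box_basis[OF X_sub \<open>x \<in> X\<close>]
        by (intro exI[of _ b] exI[of _ "\<lambda>i. b (n + i)"]) (auto simp: box_def)
    qed
    then show False using x(1) by blast
  qed
  then show "finite {x \<in> X. \<not> ?A x}"
    by (rule finite_subset) (intro finite_imageI finite_UnI fin P(1))
qed

text \<open>The homeomorphism is the evaluation map of the finite family \<open>F\<close>: its
  members are continuous, and by \<open>separates\<close> they generate the topology.\<close>

lemma affine_if_cofinitely_good:
  assumes B: "basis_of \<tau> m R" and fin: "finite {z \<in> L. \<not> good_at \<tau> z}"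
  shows "\<exists>k Y. definable M k Y \<and> definably_homeomorphic M n \<tau> k (affine_topology k Y)"
proof -
  note B' = basis_ofD[OF B]
  interpret T: line_basis M L m "on_line R" lo hi by (rule line_basis_on_line[OF B])
  have "finite {z \<in> L. \<not> T.good z}" using fin unfolding good_set_eq[OF B] .
  from T.embedding[OF this] obtain F where F: "finite F" "\<forall>g\<in>F. dterm M (\<lambda>s. g (s 0))"
    "\<forall>g\<in>F. \<forall>x\<in>L. \<forall>u v. u < g x \<and> g x < v \<longrightarrow> (\<exists>b\<in>cpow m. on_line R b x \<and> (\<forall>w. on_line R b w \<longrightarrow> u < g w \<and> g w < v))"
    "\<forall>x\<in>L. \<forall>b\<in>cpow m. on_line R b x \<longrightarrow> T.separates F x {w. on_line R b w}"
    by (elim exE conjE) (rule that)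
  obtain gs where gs: "set gs = F" using finite_list[OF F(1)] by blast
  define k where "k = length gs"
  define f where "f x = restrict (\<lambda>i. (gs ! i) (g x)) {..<k}" for x
  have gsF: "gs ! i \<in> F" if "i < k" for i using that gs by (auto simp: k_def)
  define Y where "Y = f ` X"
  have Y_sub: "Y \<subseteq> cpow k" by (auto simp: Y_def f_def restrict_cpow)
  have dgs: "dterm M (\<lambda>s. (gs ! i) (g (restrict s {..<n})))" if "i < k" for i
    using dterm_unary[of M "gs ! i", OF _ dterm_g] F(2) gsF[OF that] by blast
  have "dpred M (\<lambda>s. \<exists>x\<in>cpow n. x \<in> X \<and> (\<forall>i<k. s i = (gs ! i) (g x)))"
    by (intro dpred_ex_cpow dpred_conj dpred_ball dpred_eq dterm_var dgs definable_dpred definable_X)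
  moreover have "(\<exists>x\<in>cpow n. x \<in> X \<and> (\<forall>i<k. s i = (gs ! i) (g x))) \<longleftrightarrow> restrict s {..<k} \<in> Y" for s
  proof -
    have "(\<forall>i<k. s i = (gs ! i) (g x)) \<longleftrightarrow> restrict s {..<k} = f x" for x
      by (auto simp: f_def fun_eq_iff)
    then show ?thesis using X_sub by (auto simp: Y_def)
  qed
  ultimately have "definable M k Y" using Y_sub by (simp add: definable_iff_dpred)
  moreover have "definable M (n + k) ((\<lambda>x. concat_tuple n x (f x)) ` X)"
    unfolding definable_iff_dpred
  proof
    show "(\<lambda>x. concat_tuple n x (f x)) ` X \<subseteq> cpow (n + k)"
      by (auto simp: cpow_def PiE_iff extensional_def concat_tuple_def f_def restrict_def split: if_splits)
    have "dpred M (\<lambda>s. restrict s {..<n} \<in> X \<and> (\<forall>i<k. s (n + i) = (gs ! i) (g (restrict s {..<n}))))"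
      by (intro dpred_conj dpred_ball dpred_eq dterm_var dgs definable_dpred definable_X)
    moreover have "restrict s {..<n} \<in> X \<and> (\<forall>i<k. s (n + i) = (gs ! i) (g (restrict s {..<n}))) \<longleftrightarrow>
      restrict s {..<n + k} \<in> (\<lambda>x. concat_tuple n x (f x)) ` X" (is "?l s \<longleftrightarrow> ?r s") for s
    proof
      assume l: "?l s"
      define r where "r = restrict s {..<n}"
      have r: "r \<in> X" "\<forall>i<k. s (n + i) = (gs ! i) (g r)" using l unfolding r_def by blast+
      have r_eq: "\<forall>i<n. r i = s i" by (simp add: r_def)
      have "restrict s {..<n + k} = concat_tuple n r (f r)"
      proof (rule ext)
        fix j
        consider "j < n" | i where "j = n + i" "i < k" | "n + k \<le> j"
          by (metis add_less_cancel_left le_add_diff_inverse not_less)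
        then show "restrict s {..<n + k} j = concat_tuple n r (f r) j"
        proof cases
          case 3
          then have "\<not> j < n" "\<not> j - n < k" by auto
          with 3 show ?thesis by (simp add: concat_tuple_def f_def)
        qed (use r r_eq in \<open>simp_all add: concat_tuple_def f_def\<close>)
      qed
      then show "?r s" using r(1) by blast
    next
      assume "?r s"
      then obtain x where x: "x \<in> X" "restrict s {..<n + k} = concat_tuple n x (f x)" by blast
      have s: "i < n + k \<Longrightarrow> s i = concat_tuple n x (f x) i" for i using x(2) by (metis lessThan_iff restrict_apply')
      have "restrict s {..<n} = restrict x {..<n}"
        using s by (auto simp: fun_eq_iff concat_tuple_def)
      also have "\<dots> = x" using x(1) X_sub by (auto intro: restrict_cpow)
      finally show "?l s" using x(1) s by (auto simp: concat_tuple_def f_def)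
    qed
    ultimately show "dpred M (\<lambda>s. restrict s {..<n + k} \<in> (\<lambda>x. concat_tuple n x (f x)) ` X)" by simp
  qed
  moreover have "homeomorphic_map \<tau> (affine_topology k Y) f"
  proof (rule bijective_open_imp_homeomorphic_map, unfold topspace_affine[OF Y_sub] B'(1))
    \<comment> \<open>Openness of \<open>f\<close> onto its image, stated with preimages. By the
      Hausdorff property it also implies that \<open>f\<close> is injective.\<close>
    have inside: "\<exists>u v. (\<forall>i<k. u i < f x i \<and> f x i < v i) \<and>
      (\<forall>y\<in>X. (\<forall>i<k. u i < f y i \<and> f y i < v i) \<longrightarrow> y \<in> W)" if W: "openin \<tau> W" "x \<in> W" for x W
    proof -
      have "x \<in> X" using W B'(1) openin_subset by blast
      obtain b where b: "b \<in> cpow m" "R b x" "\<forall>y\<in>cpow n. R b y \<longrightarrow> y \<in> W" using B'(4)[OF W] by blast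
      have "on_line R b (g x)" using b \<open>x \<in> X\<close> by (auto simp: on_line_def)
      then have "T.separates F (g x) {w. on_line R b w}" using F(4) b(1) g_in[OF \<open>x \<in> X\<close>] by blast
      then obtain u v where uv: "\<forall>e\<in>F. u e < e (g x) \<and> e (g x) < v e"
        "\<forall>w\<in>L. (\<forall>e\<in>F. u e < e w \<and> e w < v e) \<longrightarrow> w \<in> {w. on_line R b w}"
        unfolding T.separates_def by blast
      show ?thesis
      proof (intro exI conjI ballI impI allI)
        show "u (gs ! i) < f x i" "f x i < v (gs ! i)" if "i < k" for i
          using uv(1) gsF[OF that] that by (auto simp: f_def)
        fix y assume y: "y \<in> X" "\<forall>i<k. u (gs ! i) < f y i \<and> f y i < v (gs ! i)"
        have "u e < e (g y) \<and> e (g y) < v e" if "e \<in> F" for e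
        proof -
          have "e \<in> set gs" using that gs by simp
          then obtain i where "i < k" "e = gs ! i" unfolding k_def in_set_conv_nth by blast
          then show ?thesis using y(2) by (auto simp: f_def)
        qed
        then have "on_line R b (g y)" using uv(2) g_in[OF y(1)] by blast
        then have "R b y" using y(1) by (simp add: on_line_iff)
        then show "y \<in> W" using b(3) y(1) X_sub by blast
      qed
    qed
    show "inj_on f X"
    proof (rule inj_onI, rule ccontr)
      fix x y assume xy: "x \<in> X" "y \<in> X" "f x = f y" "x \<noteq> y"
      then obtain U V where UV: "openin \<tau> U" "openin \<tau> V" "x \<in> U" "y \<in> V" "disjnt U V"
        using B'(1,2) unfolding Hausdorff_space_def by metis
      from inside[OF UV(1,3)] have "y \<in> U" using xy by auto
      then show False using UV by (auto simp: disjnt_iff)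
    qed
    show "f ` X = Y" by (simp add: Y_def)
    show "continuous_map \<tau> (affine_topology k Y) f"
      unfolding continuous_map_def topspace_affine[OF Y_sub] B'(1)
    proof (intro conjI allI impI)
      show "f \<in> X \<rightarrow> Y" by (auto simp: Y_def)
      fix V assume V: "openin (affine_topology k Y) V"
      show "openin \<tau> {x \<in> X. f x \<in> V}"
      proof (subst openin_subopen, intro ballI)
        fix x assume x: "x \<in> {x \<in> X. f x \<in> V}"
        then obtain u v where uv: "\<forall>i<k. u i < f x i \<and> f x i < v i"
          "\<forall>y\<in>Y. (\<forall>i<k. u i < y i \<and> y i < v i) \<longrightarrow> y \<in> V"
          using V unfolding openin_affine[OF Y_sub] by blast
        have "\<exists>O'. openin \<tau> O' \<and> x \<in> O' \<and> (\<forall>y\<in>O'. \<forall>i<j. u i < f y i \<and> f y i < v i)" if "j \<le> k" for j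
          using that
        proof (induction j)
          case 0
          show ?case using x B'(1) by (intro exI[of _ X]) (metis (lifting) less_nat_zero_code mem_Collect_eq openin_topspace)
        next
          case (Suc j)
          then obtain O' where O': "openin \<tau> O'" "x \<in> O'" "\<forall>y\<in>O'. \<forall>i<j. u i < f y i \<and> f y i < v i" by auto
          have j: "u j < (gs ! j) (g x) \<and> (gs ! j) (g x) < v j" using uv(1) Suc.prems by (auto simp: f_def)
          have "g x \<in> L" using x g_in by blast
          then obtain b where b: "b \<in> cpow m" "on_line R b (g x)"
            "\<forall>w. on_line R b w \<longrightarrow> u j < (gs ! j) w \<and> (gs ! j) w < v j"
            using F(3)[rule_format, OF gsF \<open>g x \<in> L\<close> j] Suc.prems by auto
          have "openin \<tau> (O' \<inter> {y \<in> cpow n. R b y})" using O'(1) B'(3)[OF b(1)] by (rule openin_Int)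
          moreover have "x \<in> O' \<inter> {y \<in> cpow n. R b y}" using O'(2) b(2) x X_sub by (auto simp: on_line_iff)
          moreover have "u i < f y i \<and> f y i < v i" if y: "y \<in> O' \<inter> {y \<in> cpow n. R b y}" and i: "i < Suc j" for y i
          proof (cases "i < j")
            case True then show ?thesis using O'(3) y by blast
          next
            case False
            then have "i = j" using i by simp
            have "y \<in> X" using basis_of_sub[OF B b(1)] y by blast
            then have "on_line R b (g y)" using y by (auto simp: on_line_def)
            then show ?thesis using b(3) Suc.prems \<open>i = j\<close> by (auto simp: f_def)
          qed
          ultimately show ?case by blast
        qed
        then obtain O' where O': "openin \<tau> O'" "x \<in> O'" "\<forall>y\<in>O'. \<forall>i<k. u i < f y i \<and> f y i < v i" by blast
        have "O' \<subseteq> X" using O'(1) B'(1) openin_subset by blast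
        then have "O' \<subseteq> {x \<in> X. f x \<in> V}" using O'(3) uv(2) by (auto simp: Y_def)
        then show "\<exists>T. openin \<tau> T \<and> x \<in> T \<and> T \<subseteq> {x \<in> X. f x \<in> V}" using O' by blast
      qed
    qed
    show "open_map \<tau> (affine_topology k Y) f"
      unfolding open_map_def
    proof (intro allI impI)
      fix W assume W: "openin \<tau> W"
      then have "W \<subseteq> X" using B'(1) openin_subset by blast
      show "openin (affine_topology k Y) (f ` W)"
        unfolding openin_affine[OF Y_sub]
      proof (intro conjI ballI)
        show "f ` W \<subseteq> Y" using \<open>W \<subseteq> X\<close> by (auto simp: Y_def)
        fix y assume "y \<in> f ` W"
        then obtain x where x: "x \<in> W" "y = f x" by blast
        obtain u v where uv: "\<forall>i<k. u i < f x i \<and> f x i < v i"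
          "\<forall>y\<in>X. (\<forall>i<k. u i < f y i \<and> f y i < v i) \<longrightarrow> y \<in> W" using inside[OF W x(1)] by blast
        then show "\<exists>u v. (\<forall>i<k. u i < y i \<and> y i < v i) \<and> (\<forall>y\<in>Y. (\<forall>i<k. u i < y i \<and> y i < v i) \<longrightarrow> y \<in> f ` W)"
          using x(2) by (intro exI[of _ u] exI[of _ v]) (auto simp: Y_def)
      qed
    qed
  qed
  ultimately show ?thesis unfolding definably_homeomorphic_def B'(1) by blast
qed

text \<open>By \<open>coordinates_continuous\<close> the composition of the homeomorphism with
  \<open>h\<close> is continuous at all but finitely many points of \<open>L\<close>; since
  \<open>f\<close> is open and injective, continuity passes to \<open>h\<close> itself.\<close>

lemma cofinitely_good_if_affine:
  assumes B: "basis_of \<tau> m R" and Y: "definable M k Y"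
    and hom: "definably_homeomorphic M n \<tau> k (affine_topology k Y)"
  shows "finite {z \<in> L. \<not> good_at \<tau> z}"
proof -
  note B' = basis_ofD[OF B]
  note Y_sub = definable_sub[OF Y]
  obtain f where f: "homeomorphic_map \<tau> (affine_topology k Y) f"
    and graph: "definable M (n + k) ((\<lambda>x. concat_tuple n x (f x)) ` X)" (is "definable M _ ?G")
    using hom unfolding definably_homeomorphic_def B'(1) by blast
  have fX: "f ` X = Y" and inj: "inj_on f X" and "open_map \<tau> (affine_topology k Y) f"
    using f unfolding homeomorphic_eq_everything_map topspace_affine[OF Y_sub] B'(1) by auto
  have rr: "restrict (restrict s {..<n + k}) {..<n} = restrict s {..<n}" for s :: "nat \<Rightarrow> 'a" by auto
  have "dterm M (\<lambda>s. if s 0 \<in> L then f (h (s 0)) i else 0)" if "i < k" for i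
  proof (rule dterm_graphI)
    \<comment> \<open>The pair of \<open>x\<close> and \<open>f x\<close> occupies the first
      \<open>n + k\<close> variables; the value and the argument of the function come behind
      it.\<close>
    have "dpred M (\<lambda>s. restrict s {..<n + k} \<in> ?G \<and> g (restrict (restrict s {..<n + k}) {..<n}) = s (n + k + 1) \<and>
      restrict s {..<n + k} (n + i) = s (n + k + 0))"
      using definable_dpred[OF graph] dterm_g \<open>i < k\<close> unfolding rr
      by (intro dpred_conj dpred_eq dterm_var) (simp_all add: dterm_var)
    then have "dpred M (\<lambda>s. \<exists>p\<in>cpow (n + k). p \<in> ?G \<and> g (restrict p {..<n}) = s 1 \<and> p (n + i) = s 0)"
      by (rule dpred_ex_cpow)
    then have "dpred M (\<lambda>s. (s 1 \<notin> L \<and> s 0 = 0) \<or>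
        (\<exists>p\<in>cpow (n + k). p \<in> ?G \<and> g (restrict p {..<n}) = s 1 \<and> p (n + i) = s 0))"
      by (intro dpred_disj dpred_conj dpred_neg dsetD[OF dset_L] dpred_eq dterm_var dterm_const)
    moreover have "(s 1 \<notin> L \<and> s 0 = 0) \<or> (\<exists>p\<in>cpow (n + k). p \<in> ?G \<and> g (restrict p {..<n}) = s 1 \<and> p (n + i) = s 0) \<longleftrightarrow>
      s 0 = (if s (Suc 0) \<in> L then f (h (s (Suc 0))) i else 0)" for s :: "nat \<Rightarrow> 'a"
    proof -
      have "(\<exists>p\<in>cpow (n + k). p \<in> ?G \<and> g (restrict p {..<n}) = s 1 \<and> p (n + i) = s 0) \<longleftrightarrow>
        (\<exists>x\<in>X. g x = s 1 \<and> f x i = s 0)"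
      proof -
        have "restrict (concat_tuple n x (f x)) {..<n} = x" if "x \<in> X" for x
        proof -
          have "restrict (concat_tuple n x (f x)) {..<n} = restrict x {..<n}" by (auto simp: concat_tuple_def)
          also have "\<dots> = x" using that X_sub by (auto intro: restrict_cpow)
          finally show ?thesis .
        qed
        moreover have "concat_tuple n x (f x) (n + i) = f x i" for x by (simp add: concat_tuple_def)
        ultimately show ?thesis using definable_sub[OF graph] by (auto simp: subset_iff)
      qed
      also have "\<dots> \<longleftrightarrow> s 1 \<in> L \<and> f (h (s 1)) i = s 0"
      proof
        assume "\<exists>x\<in>X. g x = s 1 \<and> f x i = s 0"
        then obtain x where x: "x \<in> X" "g x = s 1" "f x i = s 0" by blast
        then show "s 1 \<in> L \<and> f (h (s 1)) i = s 0" using g_in[OF x(1)] h_g[OF x(1)] by simp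
      next
        assume "s 1 \<in> L \<and> f (h (s 1)) i = s 0"
        then show "\<exists>x\<in>X. g x = s 1 \<and> f x i = s 0" using h_in[of "s 1"] g_h[of "s 1"] by blast
      qed
      finally show ?thesis by auto
    qed
    ultimately show "dpred M (\<lambda>s. s 0 = (if s (Suc 0) \<in> L then f (h (s (Suc 0))) i else 0))" by simp
  qed
  note fin = coordinates_continuous[where k = k and f = f, OF this]
  show ?thesis
  proof (rule finite_subset[OF _ fin], rule subsetI, rule ccontr)
    fix z assume z: "z \<in> {z \<in> L. \<not> good_at \<tau> z}"
      and "z \<notin> {z \<in> L. \<not> (\<forall>u v. (\<forall>i<k. u i < f (h z) i \<and> f (h z) i < v i) \<longrightarrow>
        (\<exists>c d. c < z \<and> z < d \<and> (\<forall>w. c < w \<and> w < d \<longrightarrow> w \<in> L \<and> (\<forall>i<k. u i < f (h w) i \<and> f (h w) i < v i))))}"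
    then have "z \<in> L" and C: "\<forall>u v. (\<forall>i<k. u i < f (h z) i \<and> f (h z) i < v i) \<longrightarrow>
        (\<exists>c d. c < z \<and> z < d \<and> (\<forall>w. c < w \<and> w < d \<longrightarrow> w \<in> L \<and> (\<forall>i<k. u i < f (h w) i \<and> f (h w) i < v i)))"
      by blast+
    have "good_at \<tau> z" unfolding good_at_def
    proof (intro allI impI)
      fix W assume W: "openin \<tau> W \<and> h z \<in> W"
      then have "openin (affine_topology k Y) (f ` W)" "f (h z) \<in> f ` W"
        using \<open>open_map \<tau> (affine_topology k Y) f\<close> by (auto simp: open_map_def)
      then obtain u v where uv: "\<forall>i<k. u i < f (h z) i \<and> f (h z) i < v i"
        "\<forall>y\<in>Y. (\<forall>i<k. u i < y i \<and> y i < v i) \<longrightarrow> y \<in> f ` W"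
        unfolding openin_affine[OF Y_sub] by blast
      then obtain c d where cd: "c < z" "z < d"
        "\<forall>w. c < w \<and> w < d \<longrightarrow> w \<in> L \<and> (\<forall>i<k. u i < f (h w) i \<and> f (h w) i < v i)"
        using C by blast
      have "W \<subseteq> X" using W B'(1) openin_subset by blast
      have "h w \<in> W" if "c < w" "w < d" for w
      proof -
        have w: "w \<in> L" "\<forall>i<k. u i < f (h w) i \<and> f (h w) i < v i" using cd(3) that by auto
        then have "f (h w) \<in> f ` W" using uv(2) h_in fX by blast
        then show ?thesis using inj \<open>W \<subseteq> X\<close> h_in[OF w(1)] by (meson inj_on_image_mem_iff)
      qed
      then have "\<forall>w. c < w \<and> w < d \<longrightarrow> w \<in> L \<and> h w \<in> W" using cd(3) by blast
      then show "\<exists>c d. c < z \<and> z < d \<and> (\<forall>w. c < w \<and> w < d \<longrightarrow> w \<in> L \<and> h w \<in> W)" using cd by blast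
    qed
    then show False using z by blast
  qed
qed

text \<open>At good points relatively open sets contain order intervals. For a separation into
  \<open>U\<close> and \<open>W\<close>, membership in either is then locally constant in the order,
  and \<open>dichotomy_interval\<close> propagates it along the interval.\<close>

lemma interval_definably_connected:
  assumes "topspace \<tau> = X" and I: "{a<..<b} \<subseteq> L" "\<And>z. a < z \<Longrightarrow> z < b \<Longrightarrow> good_at \<tau> z"
  shows "definably_connected M n \<tau> (h ` {a<..<b})"
  unfolding definably_connected_def
proof
  let ?C = "h ` {a<..<b}"
  assume "\<exists>U W. definable M n U \<and> definable M n W \<and> U \<noteq> {} \<and> W \<noteq> {} \<and>
    openin (subtopology \<tau> ?C) U \<and> openin (subtopology \<tau> ?C) W \<and> U \<inter> W = {} \<and> U \<union> W = ?C"
  then obtain U W where UW: "definable M n U" "definable M n W" "U \<noteq> {}" "W \<noteq> {}"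
    "openin (subtopology \<tau> ?C) U" "openin (subtopology \<tau> ?C) W" "U \<inter> W = {}" "U \<union> W = ?C"
    by (elim exE conjE) (rule that)
  have CX: "?C \<subseteq> X" using I(1) h_in by auto
  have cases: "h z \<in> U \<and> h z \<notin> W \<or> h z \<in> W \<and> h z \<notin> U" if "a < z" "z < b" for z
    using UW(7,8) that by (metis IntI UnE empty_iff greaterThanLessThan_iff imageI)
  have nbhd: "\<exists>c d. c < z \<and> z < d \<and> (\<forall>w. c < w \<and> w < d \<and> a < w \<and> w < b \<longrightarrow> h w \<in> V)"
    if V: "openin (subtopology \<tau> ?C) V" "h z \<in> V" and z: "a < z" "z < b" for V z
  proof -
    obtain O' where O': "openin \<tau> O'" "V = O' \<inter> ?C" using V(1) unfolding openin_subtopology by blast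
    then obtain c d where "c < z" "z < d" "\<forall>w. c < w \<and> w < d \<longrightarrow> w \<in> L \<and> h w \<in> O'"
      using I(2)[OF z] V(2) unfolding good_at_def by blast
    then show ?thesis using O'(2) by (intro exI[of _ c] exI[of _ d]) auto
  qed
  have propagate: "h y \<in> V" if V: "V = U \<or> V = W" and xy: "a < x" "x \<le> y" "y < b" "h x \<in> V" for V x y
  proof -
    have Vs: "V \<subseteq> ?C" "definable M n V" using V UW by auto
    then have "V \<subseteq> X" using CX by blast
    have mem: "w \<in> g ` (V \<inter> X) \<longleftrightarrow> h w \<in> V" if "w \<in> L" for w
      using that \<open>V \<subseteq> X\<close> g_h h_in by (metis IntI Int_absorb2 h_g imageE imageI subsetD)
    have IL: "w \<in> L" if "x \<le> w" "w \<le> y" for w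
    proof -
      have "w \<in> {a<..<b}" using that xy by auto
      then show ?thesis using I(1) by blast
    qed
    have "y \<in> g ` (V \<inter> X)"
    proof (rule dichotomy_interval[OF dset_image[OF Vs(2)]])
      show "x \<in> g ` (V \<inter> X)" using mem[OF IL[of x]] xy by simp
      show "x \<le> y" by fact
      fix z assume z: "x \<le> z" "z \<le> y"
      then have "a < z" "z < b" using xy by auto
      obtain V' where V': "V' = U \<or> V' = W" "h z \<in> V'" using cases[OF \<open>a < z\<close> \<open>z < b\<close>] by blast
      then have "openin (subtopology \<tau> ?C) V'" using UW by blast
      from nbhd[OF this V'(2) \<open>a < z\<close> \<open>z < b\<close>] obtain c d where cd: "c < z" "z < d"
        "\<forall>w. c < w \<and> w < d \<and> a < w \<and> w < b \<longrightarrow> h w \<in> V'" by blast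
      have "w \<in> g ` (V \<inter> X) \<longleftrightarrow> z \<in> g ` (V \<inter> X)" if w: "c < w" "w < d" "x \<le> w" "w \<le> y" for w
      proof -
        have "a < w" "w < b" using w xy by auto
        then have "h w \<in> V'" using cd(3) w by blast
        moreover have "h u \<in> V \<longleftrightarrow> V = V'" if "h u \<in> V'" for u
          using that V V'(1) UW(7) by blast
        ultimately have "h w \<in> V \<longleftrightarrow> h z \<in> V" using V'(2) by blast
        then show ?thesis using mem[OF IL] w z by simp
      qed
      then show "\<exists>c d. c < z \<and> z < d \<and> (\<forall>w. c < w \<and> w < d \<and> x \<le> w \<and> w \<le> y \<longrightarrow> (w \<in> g ` (V \<inter> X) \<longleftrightarrow> z \<in> g ` (V \<inter> X)))"
        using cd by blast
    qed
    then show ?thesis using mem[OF IL[of y]] xy by simp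
  qed
  obtain e e' where "e \<in> U" "e' \<in> W" using UW(3,4) by blast
  moreover from this have "e \<in> ?C" "e' \<in> ?C" using UW(8) by blast+
  ultimately obtain x y where x: "a < x" "x < b" "h x \<in> U" and y: "a < y" "y < b" "h y \<in> W" by auto
  consider "x \<le> y" | "y \<le> x" by force
  then show False
  proof cases
    case 1
    then have "h y \<in> U" using propagate[of U x y] x y by blast
    then show False using y UW(7) by blast
  next
    case 2
    then have "h x \<in> W" using propagate[of W y x] x y by blast
    then show False using x UW(7) by blast
  qed
qed

lemma finite_components_if_cofinitely_good:
  assumes B: "basis_of \<tau> m R" and fin: "finite {z \<in> L. \<not> good_at \<tau> z}"
    and Y: "definable M n Y" "Y \<subseteq> X"
  shows "finitely_many_components M n \<tau> Y"
proof -
  let ?bad = "{z \<in> L. \<not> good_at \<tau> z}"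
  define V where "V = g ` (Y \<inter> X) - ?bad"
  have "dset M V" unfolding V_def by (intro dset_Diff dset_image Y dset_finite fin)
  moreover have Vb: "lo \<le> x \<and> x \<le> hi" if "x \<in> V" for x using that g_bounds by (auto simp: V_def)
  ultimately have "\<exists>Q. finite Q \<and> (\<forall>x\<in>V - Q. \<exists>a\<in>Q. \<exists>b\<in>Q. a < x \<and> x < b \<and> {a<..<b} \<subseteq> V)"
    by (rule decompose_bounded)
  then obtain Q where Q: "finite Q" "\<forall>x\<in>V - Q. \<exists>a\<in>Q. \<exists>b\<in>Q. a < x \<and> x < b \<and> {a<..<b} \<subseteq> V"
    by blast
  \<comment> \<open>The pieces are singletons over the finitely many bad or exceptional points and
    images of intervals of good points. They may overlap; only finiteness, connectedness and
    covering matter.\<close>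
  define \<D> where "\<D> = (\<lambda>z. {h z}) ` (g ` (Y \<inter> X) \<inter> (?bad \<union> Q)) \<union>
    (\<lambda>(a, b). h ` {a<..<b}) ` {(a, b) \<in> Q \<times> Q. a < b \<and> {a<..<b} \<subseteq> V}"
  show ?thesis
  proof (rule finitely_many_componentsI)
    have "finite {(a, b) \<in> Q \<times> Q. a < b \<and> {a<..<b} \<subseteq> V}"
      by (rule finite_subset[of _ "Q \<times> Q"]) (use Q(1) in auto)
    then show "finite \<D>" unfolding \<D>_def using fin Q(1) by blast
    have VL: "V \<subseteq> L" by (auto simp: V_def L_def)
    have hV: "h w \<in> Y" if "w \<in> V" for w using that by (auto simp: V_def)
    show "\<Union>\<D> = Y"
    proof
      show "\<Union>\<D> \<subseteq> Y" using hV unfolding \<D>_def by auto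
      show "Y \<subseteq> \<Union>\<D>"
      proof
        fix y assume y: "y \<in> Y"
        then have "y \<in> X" "g y \<in> g ` (Y \<inter> X)" using Y by auto
        show "y \<in> \<Union>\<D>"
        proof (cases "g y \<in> ?bad \<union> Q")
          case True
          then have "{h (g y)} \<in> \<D>" unfolding \<D>_def using \<open>g y \<in> g ` (Y \<inter> X)\<close> by blast
          then show ?thesis using \<open>y \<in> X\<close> by auto
        next
          case False
          then have "g y \<in> V - Q" using \<open>g y \<in> g ` (Y \<inter> X)\<close> by (auto simp: V_def)
          then obtain a b where ab: "a \<in> Q" "b \<in> Q" "a < g y" "g y < b" "{a<..<b} \<subseteq> V" using Q(2) by blast
          then have "h ` {a<..<b} \<in> \<D>" unfolding \<D>_def by force
          moreover have "y \<in> h ` {a<..<b}" using ab \<open>y \<in> X\<close> by (intro image_eqI[of _ _ "g y"]) auto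
          ultimately show ?thesis by blast
        qed
      qed
    qed
    fix D assume "D \<in> \<D>"
    then consider z where "z \<in> L" "D = {h z}" | a b where "a < b" "{a<..<b} \<subseteq> V" "D = h ` {a<..<b}"
      unfolding \<D>_def L_def by auto
    then show "D \<noteq> {} \<and> definable M n D \<and> definably_connected M n \<tau> D"
    proof cases
      case (1 z)
      have "{x \<in> X. x \<in> X \<and> g x \<in> {z}} = {h z}" using 1 h_in g_h by auto
      then have "definable M n {h z}" using definable_preimage[OF definable_X dset_singleton[of M z]] by simp
      moreover have "definably_connected M n \<tau> {h z}" by (rule definably_connected_singleton)
      ultimately show ?thesis using 1 by simp
    next
      case (2 a b)
      have "{x \<in> X. x \<in> X \<and> g x \<in> {a<..<b}} = h ` {a<..<b}"
      proof (intro set_eqI iffI)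
        fix x assume "x \<in> {x \<in> X. x \<in> X \<and> g x \<in> {a<..<b}}"
        then show "x \<in> h ` {a<..<b}" by (intro image_eqI[of _ _ "g x"]) auto
      next
        fix x assume "x \<in> h ` {a<..<b}"
        then obtain w where w: "x = h w" "w \<in> {a<..<b}" by blast
        then have "w \<in> L" using 2 VL by blast
        then show "x \<in> {x \<in> X. x \<in> X \<and> g x \<in> {a<..<b}}" using w h_in g_h by simp
      qed
      then have "definable M n D" using definable_preimage[OF definable_X dset_interval(1)[of M a b]] 2 by simp
      moreover have "D \<noteq> {}" using dense[OF 2(1)] 2(3) by auto
      moreover have "definably_connected M n \<tau> D" unfolding 2(3)
      proof (rule interval_definably_connected)
        show "topspace \<tau> = X" by (rule basis_ofD[OF B])
        show "{a<..<b} \<subseteq> L" using 2 VL by blast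
        show "good_at \<tau> z" if "a < z" "z < b" for z
        proof -
          have "z \<in> V" using 2(2) that by auto
          then show ?thesis using VL by (auto simp: V_def)
        qed
      qed
      ultimately show ?thesis by blast
    qed
  qed
qed

text \<open>The set \<open>Y\<close> over the interval of
  \<open>totally_disconnected_interval\<close> is infinite, so one of finitely many components would
  have two points; the half-line that cuts between them disconnects it.\<close>

lemma cofinitely_good_if_finite_components:
  assumes B: "basis_of \<tau> m R"
    and comp: "\<And>Y. definable M n Y \<Longrightarrow> Y \<subseteq> X \<Longrightarrow> finitely_many_components M n \<tau> Y"
  shows "finite {z \<in> L. \<not> good_at \<tau> z}"
proof (rule ccontr)
  assume "infinite {z \<in> L. \<not> good_at \<tau> z}"
  note B' = basis_ofD[OF B]
  interpret T: line_basis M L m "on_line R" lo hi by (rule line_basis_on_line[OF B])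
  have "infinite {z \<in> L. \<not> T.good z}"
    using \<open>infinite {z \<in> L. \<not> good_at \<tau> z}\<close> unfolding good_set_eq[OF B] .
  then obtain p q where pq: "p < q" "{p<..<q} \<subseteq> L"
    and cut: "\<And>x y. p < x \<Longrightarrow> x < y \<Longrightarrow> y < q \<Longrightarrow> \<exists>S. dset M S \<and> x \<in> S \<and> y \<notin> S \<and>
      (\<forall>w. p < w \<and> w < q \<longrightarrow> (\<exists>b\<in>cpow m. on_line R b w \<and> (\<forall>v. on_line R b v \<and> p < v \<and> v < q \<longrightarrow> (v \<in> S \<longleftrightarrow> w \<in> S))))"
    by (rule T.totally_disconnected_interval) blast
  define Y where "Y = {x \<in> X. x \<in> X \<and> g x \<in> {p<..<q}}"
  have Yd: "definable M n Y" unfolding Y_def by (rule definable_preimage[OF definable_X dset_interval(1)])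
  moreover have "Y \<subseteq> X" by (auto simp: Y_def)
  ultimately have "finitely_many_components M n \<tau> Y" by (rule comp)
  then obtain \<C> where \<C>: "finite \<C>" "\<forall>C\<in>\<C>. definably_connected_component M n \<tau> Y C" "pairwise disjnt \<C>" "\<Union>\<C> = Y"
    unfolding finitely_many_components_def by (elim exE conjE) (rule that)
  have "{p<..<q} \<subseteq> g ` Y" using pq(2) h_in g_h unfolding Y_def by (auto simp: subset_iff image_iff) metis
  then have "infinite Y" using interval_infinite[OF pq(1)] finite_subset by blast
  then obtain C where C: "C \<in> \<C>" "infinite C" using \<C>(1,4) finite_Union by blast
  then have "C \<subseteq> Y" "definable M n C" "definably_connected M n \<tau> C"
    using \<C>(2) unfolding definably_connected_component_def by (auto simp: definably_connected_subtopology)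
  obtain a where "a \<in> C" using C(2) by (metis finite.emptyI ex_in_conv)
  moreover obtain b where "b \<in> C" "b \<noteq> a" proof -
    have "\<not> C \<subseteq> {a}" using C(2) finite_subset by blast
    then show ?thesis using that by blast
  qed
  ultimately obtain x y where xy: "x \<in> C" "y \<in> C" "g x < g y"
  proof (cases "g a < g b")
    case False
    have "a \<in> X" "b \<in> X" using \<open>a \<in> C\<close> \<open>b \<in> C\<close> \<open>C \<subseteq> Y\<close> by (auto simp: Y_def)
    then have "g a \<noteq> g b" using \<open>b \<noteq> a\<close> h_g by metis
    then have "g b < g a" using False by simp
    then show ?thesis using that \<open>a \<in> C\<close> \<open>b \<in> C\<close> by blast
  qed blast
  then have "p < g x" "g y < q" using \<open>C \<subseteq> Y\<close> by (auto simp: Y_def)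
  from cut[OF this(1) xy(3) this(2)] obtain S where S: "dset M S" "g x \<in> S" "g y \<notin> S"
    "\<forall>w. p < w \<and> w < q \<longrightarrow> (\<exists>b\<in>cpow m. on_line R b w \<and> (\<forall>v. on_line R b v \<and> p < v \<and> v < q \<longrightarrow> (v \<in> S \<longleftrightarrow> w \<in> S)))"
    by (elim exE conjE) (rule that)
  \<comment> \<open>On \<open>Y\<close> each point has a neighbourhood that does not cross the cut,
    so both sides of the cut are relatively open in \<open>C\<close>.\<close>
  have op: "openin (subtopology \<tau> C) {c \<in> C. g c \<in> A}" if A: "A = S \<or> A = - S" for A
  proof (subst openin_subopen, intro ballI)
    fix c assume c: "c \<in> {c \<in> C. g c \<in> A}"
    then have cX: "c \<in> X" "p < g c" "g c < q" using \<open>C \<subseteq> Y\<close> by (auto simp: Y_def)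
    then obtain b where b: "b \<in> cpow m" "on_line R b (g c)"
      "\<forall>v. on_line R b v \<and> p < v \<and> v < q \<longrightarrow> (v \<in> S \<longleftrightarrow> g c \<in> S)" using S(4) by blast
    have "openin (subtopology \<tau> C) ({x \<in> cpow n. R b x} \<inter> C)"
      using B'(3)[OF b(1)] unfolding openin_subtopology by blast
    moreover have "c \<in> {x \<in> cpow n. R b x} \<inter> C" using c cX b(2) X_sub by (auto simp: on_line_iff)
    moreover have "{x \<in> cpow n. R b x} \<inter> C \<subseteq> {c \<in> C. g c \<in> A}"
    proof
      fix e assume e: "e \<in> {x \<in> cpow n. R b x} \<inter> C"
      then have "e \<in> X" "p < g e" "g e < q" using \<open>C \<subseteq> Y\<close> by (auto simp: Y_def)
      then have "on_line R b (g e)" using e by (auto simp: on_line_def)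
      then have "g e \<in> S \<longleftrightarrow> g c \<in> S" using b(3) \<open>p < g e\<close> \<open>g e < q\<close> by blast
      then show "e \<in> {c \<in> C. g c \<in> A}" using A c e by auto
    qed
    ultimately show "\<exists>T. openin (subtopology \<tau> C) T \<and> c \<in> T \<and> T \<subseteq> {c \<in> C. g c \<in> A}" by blast
  qed
  have def: "definable M n {c \<in> C. g c \<in> A}" if "dset M A" for A
  proof -
    have "{x \<in> X. x \<in> C \<and> g x \<in> A} = {c \<in> C. g c \<in> A}" using \<open>C \<subseteq> Y\<close> by (auto simp: Y_def)
    then show ?thesis using definable_preimage[OF \<open>definable M n C\<close> that] by simp
  qed
  have "dset M (- S)" using S(1) unfolding dset_def Compl_iff by (rule dpred_neg)
  have "\<not> definably_connected M n \<tau> C"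
    unfolding definably_connected_def not_not
  proof (intro exI conjI)
    show "definable M n {c \<in> C. g c \<in> S}" "definable M n {c \<in> C. g c \<in> - S}"
      using def S(1) \<open>dset M (- S)\<close> by blast+
    show "openin (subtopology \<tau> C) {c \<in> C. g c \<in> S}" "openin (subtopology \<tau> C) {c \<in> C. g c \<in> - S}"
      using op by blast+
  qed (use xy S in auto)
  then show False using \<open>definably_connected M n \<tau> C\<close> by blast
qed

end

section \<open>The theorem\<close>

text \<open>A rectangle filled by the projection to the coordinates \<open>i\<close> and
  \<open>j\<close> is an open box in the image of \<open>X\<close> under restriction to
  \<open>{i, j}\<close>, which would give dimension at least two.\<close>

lemma thin_if_o_dim:
  fixes X :: "(nat \<Rightarrow> 'a::{linordered_group_add, linorder_topology}) set"
  assumes "omin (M :: ('a, 'f, 'r) fo_struct)" "o_dim n X = 1"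
  shows "omin.thin n X"
proof -
  interpret omin M by fact
  show ?thesis unfolding thin_def
  proof (intro allI impI, rule ccontr)
    fix i j a b c d
    assume *: "i < j \<and> j < n \<and> a < b \<and> (c::'a) < d"
      and "\<not> (\<exists>u v. a < u \<and> u < b \<and> c < v \<and> v < d \<and> \<not> (\<exists>x\<in>X. x i = u \<and> x j = v))"
    then have box: "\<exists>x\<in>X. x i = u \<and> x j = v" if "a < u" "u < b" "c < v" "v < d" for u v using that by blast
    let ?T = "\<lambda>J. product_topology (\<lambda>_. euclidean) J :: (nat \<Rightarrow> 'a) topology"
    let ?B = "PiE {i, j} (\<lambda>k. if k = i then {a<..<b} else {c<..<d})"
    have "openin (?T {i, j}) ?B"
      by (auto simp: openin_PiE open_greaterThanLessThan)
    moreover have "?B \<subseteq> (\<lambda>x. restrict x {i, j}) ` X"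
    proof
      fix f assume f: "f \<in> ?B"
      then have "f i \<in> {a<..<b}" "f j \<in> {c<..<d}" using * by (auto simp: PiE_iff)
      then obtain x where x: "x \<in> X" "x i = f i" "x j = f j" using box by auto
      then have "f = restrict x {i, j}" using f by (auto simp: fun_eq_iff PiE_iff extensional_def)
      then show "f \<in> (\<lambda>x. restrict x {i, j}) ` X" using x(1) by blast
    qed
    ultimately have "?B \<subseteq> ?T {i, j} interior_of ((\<lambda>x. restrict x {i, j}) ` X)"
      by (intro interior_of_maximal)
    moreover have "?B \<noteq> {}" using dense[of a b] dense[of c d] * by (auto simp: PiE_eq_empty_iff)
    ultimately have ne: "?T {i, j} interior_of ((\<lambda>x. restrict x {i, j}) ` X) \<noteq> {}" by blast
    let ?D = "{card J |J. J \<subseteq> {..<n} \<and> ?T J interior_of ((\<lambda>x. restrict x J) ` X) \<noteq> {}}"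
    have "{i, j} \<subseteq> {..<n} \<and> card {i, j} = 2" using * by auto
    with ne have "card {i, j} \<in> ?D" by (intro CollectI exI[of _ "{i, j}"]) auto
    then have "2 \<in> ?D" using \<open>{i, j} \<subseteq> {..<n} \<and> card {i, j} = 2\<close> by argo
    moreover have "finite ?D" by (rule finite_subset[of _ "card ` Pow {..<n}"]) auto
    ultimately have "2 \<le> Max (insert 0 ?D)" by (intro Max_ge) auto
    then show False using assms(2) by (simp add: o_dim_def)
  qed
qed

text \<open>The group need not be non-trivial, and over the trivial group \<open>M\<^sup>n\<close> is a point.\<close>

lemma trivial_case:
  fixes M :: "('a::{linordered_group_add, linorder_topology}, 'f, 'r) fo_struct"
  assumes triv: "\<And>x::'a. x = 0" and X: "definable M n X" "topspace \<tau> = X"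
  shows "\<exists>k Y. definable M k Y \<and> definably_homeomorphic M n \<tau> k (affine_topology k Y)"
    and "\<forall>Y. definable M n Y \<and> Y \<subseteq> X \<longrightarrow> finitely_many_components M n \<tau> Y"
    and "finite X"
proof -
  have eq: "x = y" if "x \<in> X" "y \<in> X" for x y
  proof
    fix i show "x i = y i" using triv[of "x i"] triv[of "y i"] by simp
  qed
  show "finite X"
  proof (cases "X = {}")
    case False
    then obtain x where "x \<in> X" by blast
    then have "X \<subseteq> {x}" using eq by blast
    then show ?thesis using finite_subset by blast
  qed simp
  have sub: "U = {} \<or> U = X" if "U \<subseteq> X" for U using that eq by blast
  have "openin \<tau> U \<longleftrightarrow> openin (affine_topology n X) U" for U
  proof -
    have t: "topspace (affine_topology n X) = X" by (rule topspace_affine[OF definable_sub[OF X(1)]])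
    have "openin \<sigma> U \<longleftrightarrow> U \<subseteq> X" if "topspace \<sigma> = X" for \<sigma>
      using sub[of U] openin_subset[of \<sigma> U] openin_topspace[of \<sigma>] openin_empty[of \<sigma>] that by auto
    then show ?thesis using t X(2) by simp
  qed
  then have "\<tau> = affine_topology n X" by (simp add: topology_eq)
  then have "homeomorphic_map \<tau> (affine_topology n X) (\<lambda>x. x)" by (simp add: homeomorphic_map_id[unfolded id_def])
  moreover have "definable M (n + n) ((\<lambda>x. concat_tuple n x x) ` topspace \<tau>)"
    unfolding definable_iff_dpred
  proof
    show "(\<lambda>x. concat_tuple n x x) ` topspace \<tau> \<subseteq> cpow (n + n)"
      using definable_sub[OF X(1)] unfolding X(2)
      by (auto simp: cpow_def PiE_iff extensional_def concat_tuple_def subset_iff split: if_splits)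
    \<comment> \<open>Over the trivial group there is a single assignment, so every predicate on
      assignments is constant.\<close>
    have "(\<lambda>s. restrict s {..<n + n} \<in> (\<lambda>x. concat_tuple n x x) ` topspace \<tau>) =
      (\<lambda>s. restrict (\<lambda>_. 0) {..<n + n} \<in> (\<lambda>x. concat_tuple n x x) ` topspace \<tau>)"
    proof
      fix s :: "nat \<Rightarrow> 'a"
      have "s = (\<lambda>_. 0)" using triv by auto
      then show "(restrict s {..<n + n} \<in> (\<lambda>x. concat_tuple n x x) ` topspace \<tau>) =
        (restrict (\<lambda>_. 0) {..<n + n} \<in> (\<lambda>x. concat_tuple n x x) ` topspace \<tau>)" by (simp only:)
    qed
    then show "dpred M (\<lambda>s. restrict s {..<n + n} \<in> (\<lambda>x. concat_tuple n x x) ` topspace \<tau>)"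
      by (simp only: dpred_const)
  qed
  ultimately have "definably_homeomorphic M n \<tau> n (affine_topology n X)"
    unfolding definably_homeomorphic_def by blast
  then show "\<exists>k Y. definable M k Y \<and> definably_homeomorphic M n \<tau> k (affine_topology k Y)" using X(1) by blast
  show "\<forall>Y. definable M n Y \<and> Y \<subseteq> X \<longrightarrow> finitely_many_components M n \<tau> Y"
  proof (intro allI impI)
    fix Y assume Y: "definable M n Y \<and> Y \<subseteq> X"
    show "finitely_many_components M n \<tau> Y"
    proof (cases "Y = {}")
      case True
      then show ?thesis by (intro finitely_many_componentsI[of "{}"]) auto
    next
      case False
      then obtain y where "Y = {y}" using Y eq by blast
      then show ?thesis using Y
        by (intro finitely_many_componentsI[of "{Y}"]) (auto intro: definably_connected_singleton)
    qed
  qed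
qed

theorem theorem4p1:
  fixes M :: "('a::{linordered_group_add, linorder_topology}, 'f, 'r) fo_struct"
    and n :: nat
    and X :: "(nat \<Rightarrow> 'a) set"
    and \<tau> :: "(nat \<Rightarrow> 'a) topology"
    and \<B> :: "(nat \<Rightarrow> 'a) set set"
  assumes "o_minimal M"
    and "definable M n X"
    and "bounded_in_power n X"
    and "o_dim n X = 1"
    and "topspace \<tau> = X"
    and "definable_basis M n \<tau> \<B>"
    and "Hausdorff_space \<tau>"
  defines "C1 \<equiv> \<exists>k Y. definable M k Y \<and> definably_homeomorphic M n \<tau> k (affine_topology k Y)"
    and "C2 \<equiv> \<forall>Y. definable M n Y \<and> Y \<subseteq> X \<longrightarrow> finitely_many_components M n \<tau> Y"
    and "C3 \<equiv> finite {x \<in> X. \<not> basis_at \<B> x \<preceq> affine_basis_at n X x}"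
    and "C4 \<equiv> \<exists>G. finite G \<and> G \<subseteq> X \<and>
                (\<forall>U. openin \<tau> U \<and> U \<subseteq> X - G \<longrightarrow> openin (affine_topology n X) U)"
  shows "(C1 \<longleftrightarrow> C2) \<and> (C2 \<longleftrightarrow> C3) \<and> (C3 \<longleftrightarrow> C4)"
proof (cases "\<exists>x::'a. x \<noteq> 0")
  case False
  then have triv: "x = 0" for x :: 'a by blast
  note t = trivial_case[OF triv assms(2,5)]
  have C4
    unfolding C4_def
  proof (intro exI[of _ X] conjI allI impI)
    fix U assume "openin \<tau> U \<and> U \<subseteq> X - X"
    then have "U = {}" by auto
    then show "openin (affine_topology n X) U" by simp
  qed (use t(3) in auto)
  moreover have C3 unfolding C3_def by (rule finite_subset[OF _ t(3)]) auto
  ultimately show ?thesis using t(1,2) unfolding C1_def C2_def by blast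
next
  case True
  interpret omin M by unfold_locales (use assms(1) True in auto)
  have "thin n X" by (rule thin_if_o_dim) (use omin_axioms assms(4) in auto)
  from thin_embedding[OF assms(2,3) this] obtain g lo hi where g: "dterm M (\<lambda>s. g (restrict s {..<n}))"
    "inj_on g X" "\<forall>x\<in>X. lo \<le> g x \<and> g x \<le> hi"
    by (elim exE conjE) (rule that)
  interpret chart M n X g lo hi by unfold_locales (use assms(2) g in auto)
  note basis = assms(6)[unfolded definable_basis_def]
  obtain m R where R: "\<B> = (\<lambda>b. {x \<in> cpow n. R b x}) ` cpow m"
    "dpred M (\<lambda>s. R (restrict (\<lambda>i. s (n + i)) {..<m}) (restrict s {..<n}))"
    by (rule definable_family_rep[OF conjunct1[OF basis]])
  have open_basis: "openin \<tau> U" if "U \<in> \<B>" for U using basis that by blast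
  have small: "\<exists>U\<in>\<B>. x \<in> U \<and> U \<subseteq> W" if "openin \<tau> W" "x \<in> W" for W x using basis that by blast
  have B: "basis_of \<tau> m R"
    unfolding basis_of_def
  proof (intro conjI ballI allI impI)
    show "openin \<tau> {x \<in> cpow n. R b x}" if "b \<in> cpow m" for b using open_basis that R(1) by blast
    show "\<exists>b\<in>cpow m. R b x \<and> (\<forall>y\<in>cpow n. R b y \<longrightarrow> y \<in> W)" if "openin \<tau> W \<and> x \<in> W" for W x
      using small[of W x] that unfolding R(1) by blast
  qed (use assms(5,7) R(2) in auto)
  \<comment> \<open>Condition (3) does not depend on the choice of the basis: it says that every
    open set around \<open>x\<close> contains the trace of a box.\<close>
  have nbhd: "basis_at \<B> x \<preceq> affine_basis_at n X x \<longleftrightarrow>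
      (\<forall>W. openin \<tau> W \<and> x \<in> W \<longrightarrow> (\<exists>B\<in>open_boxes n. x \<in> B \<and> B \<inter> X \<subseteq> W))" for x
  proof
    assume l: "basis_at \<B> x \<preceq> affine_basis_at n X x"
    show "\<forall>W. openin \<tau> W \<and> x \<in> W \<longrightarrow> (\<exists>B\<in>open_boxes n. x \<in> B \<and> B \<inter> X \<subseteq> W)"
    proof (intro allI impI)
      fix W assume "openin \<tau> W \<and> x \<in> W"
      then obtain U where U: "U \<in> \<B>" "x \<in> U" "U \<subseteq> W" using small by blast
      then obtain V where "V \<in> affine_basis_at n X x" "V \<subseteq> U"
        using l unfolding refined_by_def basis_at_def by blast
      then show "\<exists>B\<in>open_boxes n. x \<in> B \<and> B \<inter> X \<subseteq> W" using U(3) unfolding affine_basis_at_def by blast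
    qed
  next
    assume r: "\<forall>W. openin \<tau> W \<and> x \<in> W \<longrightarrow> (\<exists>B\<in>open_boxes n. x \<in> B \<and> B \<inter> X \<subseteq> W)"
    show "basis_at \<B> x \<preceq> affine_basis_at n X x"
      unfolding refined_by_def
    proof
      fix U assume "U \<in> basis_at \<B> x"
      then have "openin \<tau> U \<and> x \<in> U" using open_basis by (auto simp: basis_at_def)
      then obtain B where "B \<in> open_boxes n" "x \<in> B" "B \<inter> X \<subseteq> U" using r by blast
      then show "\<exists>V\<in>affine_basis_at n X x. V \<subseteq> U" unfolding affine_basis_at_def by blast
    qed
  qed
  have C3: "C3 \<longleftrightarrow> finite {z \<in> L. \<not> good_at \<tau> z}"
    unfolding C3_def nbhd by (rule affine_neighbourhoods_iff[OF B])
  have "C1 \<longleftrightarrow> C3"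
    unfolding C3 C1_def using affine_if_cofinitely_good[OF B] cofinitely_good_if_affine[OF B] by blast
  moreover have "C2 \<longleftrightarrow> C3"
    unfolding C3 C2_def
    using finite_components_if_cofinitely_good[OF B] cofinitely_good_if_finite_components[OF B] by blast
  moreover have "C3 \<longleftrightarrow> C4"
  proof
    \<comment> \<open>The exceptional set of (3) serves as \<open>G\<close>: an open set avoiding it
      is an affine neighbourhood of each of its points.\<close>
    let ?G = "{x \<in> X. \<not> basis_at \<B> x \<preceq> affine_basis_at n X x}"
    assume C3
    have "openin (affine_topology n X) U" if U: "openin \<tau> U" "U \<subseteq> X - ?G" for U
      unfolding openin_affine[OF X_sub]
    proof (intro conjI ballI)
      show "U \<subseteq> X" using U(2) by blast
      fix x assume "x \<in> U"
      then have "x \<in> X" "basis_at \<B> x \<preceq> affine_basis_at n X x" using U(2) by blast+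
      then show "\<exists>u v. (\<forall>i<n. u i < x i \<and> x i < v i) \<and> (\<forall>y\<in>X. (\<forall>i<n. u i < y i \<and> y i < v i) \<longrightarrow> y \<in> U)"
        unfolding nbhd box_basis[OF X_sub \<open>x \<in> X\<close>, symmetric] using U(1) \<open>x \<in> U\<close> by blast
    qed
    with \<open>C3\<close> show C4 unfolding C3_def C4_def by (intro exI[of _ ?G]) blast
  next
    assume C4
    then obtain G where G: "finite G" "G \<subseteq> X"
      "\<forall>U. openin \<tau> U \<and> U \<subseteq> X - G \<longrightarrow> openin (affine_topology n X) U"
      unfolding C4_def by (elim exE conjE) (rule that)
    have "basis_at \<B> x \<preceq> affine_basis_at n X x" if x: "x \<in> X" "x \<notin> G" for x
      unfolding nbhd
    proof (intro allI impI)
      fix W assume W: "openin \<tau> W \<and> x \<in> W"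
      \<comment> \<open>Finite sets are closed in a Hausdorff space, so removing \<open>G\<close>
        from an open set leaves an open set, to which (4) applies.\<close>
      have "closedin \<tau> G"
        using G assms(5,7) Hausdorff_imp_t1_space t1_space_closedin_finite by blast
      then have "openin \<tau> (W - G)" using W by (simp add: openin_diff)
      moreover have "W - G \<subseteq> X - G" using W openin_subset assms(5) by blast
      ultimately have "openin (affine_topology n X) (W - G)" using G(3) by blast
      moreover have "x \<in> W - G" using W x by blast
      ultimately have "\<exists>B\<in>open_boxes n. x \<in> B \<and> B \<inter> X \<subseteq> W - G"
        unfolding openin_affine[OF X_sub] box_basis[OF X_sub x(1)] by blast
      then show "\<exists>B\<in>open_boxes n. x \<in> B \<and> B \<inter> X \<subseteq> W" by blast
    qed
    then have "{x \<in> X. \<not> basis_at \<B> x \<preceq> affine_basis_at n X x} \<subseteq> G" by blast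
    then show C3 unfolding C3_def using G(1) finite_subset by blast
  qed
  ultimately show ?thesis by blast
qed

end
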